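(* Let $\mathcal V=\{v_1,\ldots,v_N\}\subset\mathbb R^d$ be such that $\mathrm{Span}\,\mathcal V=\mathbb R^d$ and $\sum_{v\in\mathcal V}v=0$, so that the problem $$C_{\mathcal V}=\max\left\{\Big|\bigcap_{v\in\mathcal V}H_v(c_v)\Big|:\ (c_v)_{v\in\mathcal V}\in\mathbb R^{\mathcal V},\ \sum_{v\in\mathcal V}c_v=1\right\}$$ has a solution. Then the polyhedron $\mathcal R_{\mathcal V}$ realizing the maximum is unique up to translation, with face normals $v/|v|$, $v\in\mathcal V$. Furthermore, there exists $\alpha_{\mathcal V}>0$ depending only on $\mathcal V$ such that for each $v\in\mathcal V$ the face $F_v$ of $\mathcal R_{\mathcal V}$ that has exterior normal $\frac{v}{|v|}$ satisfies $$\mathcal H^{d-1}(F_v)=\alpha_{\mathcal V}|v|.$$ Furthermore, $C_{\mathcal V}=|\mathcal R_{\mathcal V}|=\frac{\alpha_{\mathcal V}}d$.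
   Context: $|\cdot|$ of a set is Lebesgue measure on $\mathbb R^d$ and $\mathcal H^{d-1}$ is $(d-1)$-dimensional Hausdorff measure. For $v\in\mathbb R^d$ and $c\in\mathbb R$, $H_v(c):=\{p\in\mathbb R^d:\langle p,v\rangle\le c\}$.
   Formalization: It is assumed that 0 is not in V (so v/|v| is defined) and that distinct v in V have distinct directions v/|v|; otherwise the area formula fails, e.g. d=1, V={1,2,-3}, where the face with normal +1 would have measure both α and 2α. *)

theory Defs
  imports "HOL-Analysis.Analysis"
begin

definition halfspace :: "'a::euclidean_space \<Rightarrow> real \<Rightarrow> 'a set" where
  "halfspace v c = {p. p \<bullet> v \<le> c}"

definition cut_out :: "'a::euclidean_space set \<Rightarrow> ('a \<Rightarrow> real) \<Rightarrow> 'a set" where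
  "cut_out V c = (\<Inter>v\<in>V. halfspace v (c v))"

text \<open>Only the values of \<open>c\<close> on \<open>V\<close> matter. Volumes are taken in
  the extended nonnegative reals, so that an unbounded competitor would not count as having
  volume 0.\<close>

definition max_volume :: "'a::euclidean_space set \<Rightarrow> ennreal" where
  "max_volume V = (SUP c\<in>{c. (\<Sum>v\<in>V. c v) = 1}. emeasure lebesgue (cut_out V c))"

definition maximizer :: "'a::euclidean_space set \<Rightarrow> 'a set \<Rightarrow> bool" where
  "maximizer V R \<longleftrightarrow>
    (\<exists>c. is_arg_max (\<lambda>c. emeasure lebesgue (cut_out V c)) (\<lambda>c. (\<Sum>v\<in>V. c v) = 1) c \<and>
         R = cut_out V c)"

definition facet_with_normal :: "'a::euclidean_space set \<Rightarrow> 'a \<Rightarrow> 'a set \<Rightarrow> bool" where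
  "facet_with_normal R u F \<longleftrightarrow>
    F facet_of R \<and> norm u = 1 \<and>
    (\<exists>b. R \<subseteq> {x. u \<bullet> x \<le> b} \<and> F = R \<inter> {x. u \<bullet> x = b})"

text \<open>Hausdorff measure with the usual normalization, under which it agrees with Lebesgue
  measure on k-dimensional Euclidean space. Empty covering sets cost nothing,
  which only matters for \<open>k = 0\<close> (counting measure), where nonempty sets have cost
  \<open>0 ^ 0 = 1\<close> even if they are singletons. Boundedness is required because
  \<open>diameter\<close> is unspecified on unbounded sets.\<close>

definition hausdorff_content :: "nat \<Rightarrow> real \<Rightarrow> 'a::metric_space set \<Rightarrow> ennreal" where
  "hausdorff_content k \<delta> A =
    (INF C\<in>{C :: nat \<Rightarrow> 'a set.
            A \<subseteq> (\<Union>i. C i) \<and> (\<forall>i. bounded (C i) \<and> diameter (C i) \<le> \<delta>)}.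
       \<Sum>i. if C i = {} then 0
           else ennreal (unit_ball_vol (real k) * (diameter (C i) / 2) ^ k))"

definition hausdorff_measure :: "nat \<Rightarrow> 'a::metric_space set \<Rightarrow> ennreal" where
  "hausdorff_measure k A = (SUP \<delta>\<in>{0<..}. hausdorff_content k \<delta> A)"

end

theory Submission
  imports Defs
begin

text \<open>Write \<open>P(c)\<close> for the polytope cut out by the heights \<open>c\<close>, \<open>d\<close> for the dimension
  and \<open>C\<close> for the maximal volume. Since the vectors of \<open>V\<close> sum to zero, translating \<open>P(c)\<close> does
  not change the sum of the heights, and since they also span the space every \<open>P(c)\<close> is compact.
  Up to translation the competitors with nonempty interior are therefore given by the simplex
  \<open>c \<ge> 0\<close>, \<open>\<Sum>c = 1\<close>, on which the volume is upper semicontinuous, and a maximizer exists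
  (\<open>exists_optimal\<close>). By homogeneity \<open>|P(c')| \<le> C s ^ d\<close> as soon as the heights \<open>c'\<close> have sum
  \<open>s > 0\<close>.

  Let \<open>P(c)\<close> be a maximizer and \<open>A v\<close> the area of its face in direction \<open>v\<close>. Lowering the single
  height \<open>c v\<close> by \<open>t\<close> loses a slab of volume about \<open>t A v / |v|\<close>, and leaves at most
  \<open>C (1 - t) ^ d\<close>; letting \<open>t\<close> tend to 0 gives \<open>A v \<ge> d C |v|\<close> (\<open>optimal_area_ge\<close>). On the other hand,
  when the origin is an interior point, the pyramids from the origin over the faces do not overlap, so
  \<open>\<Sum> c v * A v / (d |v|) \<le> C\<close> (\<open>sum_pyramids_le_vol\<close>). As \<open>\<Sum>c = 1\<close> and all heights are
  positive, equality holds throughout: \<open>A v = d C |v|\<close>, which is the area formula with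
  \<open>\<alpha> = d C\<close> (\<open>optimal_area\<close>). In particular each \<open>v\<close> is the normal of a genuine facet.

  For uniqueness let \<open>P(c)\<close> and \<open>P(c')\<close> be maximizers, with \<open>c' > 0\<close>, and consider
  \<open>\<psi> t = |P(c - t c')|\<close>. The face of \<open>P(c - t c')\<close> in direction \<open>v\<close> plus \<open>t\<close> times that of
  \<open>P(c')\<close> lies in that of \<open>P(c)\<close>, and the last two have the same area. The Brunn-Minkowski
  inequality therefore bounds the area of the first by \<open>(1 - t) ^ (d - 1) * \<alpha> |v|\<close>
  (\<open>shrunken_facet_area_le\<close>), whence the lower right derivative of \<open>\<psi>\<close> at \<open>t\<close> is at least
  \<open>- d C (1 - t) ^ (d - 1)\<close> and \<open>\<psi> t \<ge> C (1 - t) ^ d > 0\<close> for \<open>t < 1\<close>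
  (\<open>shrunken_vol_ge\<close>). So \<open>P(c - t c')\<close> is nonempty for all \<open>t < 1\<close>, and by compactness
  \<open>P(c - c')\<close> contains a point \<open>p\<close>. Both \<open>\<Sum>(c - c')\<close> and the sum of the \<open>p \<bullet> v\<close> vanish, so
  the inequalities \<open>p \<bullet> v \<le> c v - c' v\<close> are equalities and \<open>P(c) = p + P(c')\<close>.

  Areas are handled as volumes of cylinders of height 1, so that Brunn-Minkowski is only needed in the
  ambient space. They agree with the Hausdorff measure because in every Euclidean space of dimension
  \<open>k\<close> the \<open>k\<close>-dimensional Hausdorff measure is the Lebesgue measure
  (\<open>hausdorff_measure_eq_lebesgue\<close>): one inequality is the isodiametric inequality, again a case of
  Brunn-Minkowski, and the other one is the Vitali covering theorem. This identity also shows that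
  isometries preserve volume, and hence gives Fubini's theorem along an arbitrary direction.\<close>

section \<open>Minkowski sums\<close>

lemma bounded_set_plus:
  fixes A B :: "'a::real_normed_vector set"
  assumes "bounded A" "bounded B"
  shows "bounded (A + B)"
proof -
  obtain a b where a: "\<And>x. x \<in> A \<Longrightarrow> norm x \<le> a" and b: "\<And>x. x \<in> B \<Longrightarrow> norm x \<le> b"
    using assms unfolding bounded_iff by metis
  have "norm z \<le> a + b" if "z \<in> A + B" for z
    using that a b by (force elim!: set_plus_elim intro: norm_triangle_le add_mono)
  then show ?thesis
    unfolding bounded_iff by blast
qed

lemma set_plus_Collect: "A + B = {x + y |x y. x \<in> A \<and> y \<in> B}"
  by (auto simp: set_plus_def)

lemma open_set_plus: "open A \<Longrightarrow> open (A + B)" for A B :: "'a::real_normed_vector set"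
proof -
  assume "open A"
  then have "open (\<Union>x\<in>A. \<Union>y\<in>B. {x + y})"
    by (intro open_sums) simp
  moreover have "(\<Union>x\<in>A. \<Union>y\<in>B. {x + y}) = A + B"
    by (auto simp: set_plus_def)
  ultimately show ?thesis
    by simp
qed

lemma open_set_plus_right: "open B \<Longrightarrow> open (A + B)" for A B :: "'a::real_normed_vector set"
  using open_set_plus[of B A] by (simp add: add.commute)

lemma compact_set_plus: "compact A \<Longrightarrow> compact B \<Longrightarrow> compact (A + B)"
  for A B :: "'a::real_normed_vector set"
  using compact_sums[of A B] by (simp add: set_plus_Collect)

section \<open>The Brunn-Minkowski inequality\<close>

lemma open_bounded_fmeasurable:
  fixes A :: "'a::euclidean_space set"
  shows "open A \<Longrightarrow> bounded A \<Longrightarrow> A \<in> fmeasurable lborel"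
  using emeasure_bounded_finite[of A] by (auto intro!: fmeasurableI)

text \<open>The Brunn-Minkowski inequality for boxes with side lengths \<open>x\<close> and \<open>y\<close>: after division by the
  right-hand side each summand is at most the mean of \<open>x i / (x i + y i)\<close>, respectively of
  \<open>y i / (x i + y i)\<close>, by the inequality of arithmetic and geometric means, and these means add up to 1.\<close>

lemma prod_root_superadditive:
  fixes x y :: "'i \<Rightarrow> real"
  assumes "finite I" "I \<noteq> {}" "\<And>i. i \<in> I \<Longrightarrow> 0 < x i" "\<And>i. i \<in> I \<Longrightarrow> 0 < y i"
  shows "root (card I) (\<Prod>i\<in>I. x i) + root (card I) (\<Prod>i\<in>I. y i)
    \<le> root (card I) (\<Prod>i\<in>I. x i + y i)"
proof -
  let ?n = "card I" and ?P = "\<Prod>i\<in>I. x i + y i"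
  have n: "?n > 0"
    using assms by (simp add: card_gt_0_iff)
  have P: "?P > 0"
    using assms by (intro prod_pos) (simp add: add_pos_pos)
  have ratio: "root ?n (\<Prod>i\<in>I. z i) / root ?n ?P \<le> (\<Sum>i\<in>I. z i / (x i + y i) / ?n)"
    if z: "\<And>i. i \<in> I \<Longrightarrow> 0 < z i" for z
  proof -
    have "(\<Prod>i\<in>I. z i / (x i + y i)) > 0"
      using assms z by (intro prod_pos) (simp add: add_pos_pos)
    then have "root ?n (\<Prod>i\<in>I. z i / (x i + y i)) = (\<Prod>i\<in>I. z i / (x i + y i)) powr (1 / ?n)"
      using n by (simp add: root_powr_inverse)
    also have "\<dots> \<le> (\<Sum>i\<in>I. z i / (x i + y i) / ?n)"
      using assms z by (intro arith_geom_mean) (auto simp: less_imp_le add_pos_pos)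
    finally show ?thesis
      by (simp add: prod_dividef real_root_divide)
  qed
  have "root ?n (\<Prod>i\<in>I. x i) / root ?n ?P + root ?n (\<Prod>i\<in>I. y i) / root ?n ?P
    \<le> (\<Sum>i\<in>I. x i / (x i + y i) / ?n) + (\<Sum>i\<in>I. y i / (x i + y i) / ?n)"
    using assms by (intro add_mono ratio)
  also have "\<dots> = (\<Sum>i\<in>I. (x i + y i) / (x i + y i) / ?n)"
    by (simp only: sum.distrib[symmetric] add_divide_distrib)
  also have "\<dots> = (\<Sum>i\<in>I. 1 / ?n)"
  proof (rule sum.cong)
    fix i assume "i \<in> I"
    then have "x i + y i \<noteq> 0"
      using assms(3,4)[of i] by linarith
    then show "(x i + y i) / (x i + y i) / ?n = 1 / ?n"
      by simp
  qed simp
  also have "\<dots> = 1"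
    using n by simp
  finally show ?thesis
    using P n by (simp add: field_simps real_root_gt_zero)
qed

lemma brunn_minkowski_box:
  fixes a b c d :: "'a::euclidean_space"
  assumes "box a b \<noteq> {}" "box c d \<noteq> {}"
  shows "(root DIM('a) (measure lborel (box a b)) + root DIM('a) (measure lborel (box c d))) ^ DIM('a)
    \<le> measure lborel (box a b + box c d)"
proof -
  have ab: "a \<bullet> i < b \<bullet> i" and cd: "c \<bullet> i < d \<bullet> i" if "i \<in> Basis" for i
    using assms that by (auto simp: box_ne_empty)
  have sub: "box (a + c) (b + d) \<subseteq> box a b + box c d"
  proof
    fix x assume x: "x \<in> box (a + c) (b + d)"
    \<comment> \<open>split every coordinate of \<open>x\<close> in proportion to the two side lengths\<close>
    define \<theta> where "\<theta> i = (x \<bullet> i - a \<bullet> i - c \<bullet> i) / ((b \<bullet> i - a \<bullet> i) + (d \<bullet> i - c \<bullet> i))" for i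
    define y where "y = (\<Sum>i\<in>Basis. (a \<bullet> i + \<theta> i * (b \<bullet> i - a \<bullet> i)) *\<^sub>R i)"
    have \<theta>: "0 < \<theta> i" "\<theta> i < 1"
      "x \<bullet> i = a \<bullet> i + c \<bullet> i + \<theta> i * (b \<bullet> i - a \<bullet> i) + \<theta> i * (d \<bullet> i - c \<bullet> i)"
      if i: "i \<in> Basis" for i
    proof -
      have *: "a \<bullet> i + c \<bullet> i < x \<bullet> i" "x \<bullet> i < b \<bullet> i + d \<bullet> i"
        using x i by (auto simp: box_def inner_simps)
      have pos: "(b \<bullet> i - a \<bullet> i) + (d \<bullet> i - c \<bullet> i) > 0"
        using ab[OF i] cd[OF i] by simp
      show "0 < \<theta> i" "\<theta> i < 1"
        using * pos by (auto simp: \<theta>_def)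
      have "\<theta> i * ((b \<bullet> i - a \<bullet> i) + (d \<bullet> i - c \<bullet> i)) = x \<bullet> i - a \<bullet> i - c \<bullet> i"
        using pos by (simp add: \<theta>_def)
      then show "x \<bullet> i = a \<bullet> i + c \<bullet> i + \<theta> i * (b \<bullet> i - a \<bullet> i) + \<theta> i * (d \<bullet> i - c \<bullet> i)"
        by (simp add: algebra_simps)
    qed
    have yi: "y \<bullet> i = a \<bullet> i + \<theta> i * (b \<bullet> i - a \<bullet> i)" if "i \<in> Basis" for i
      using that by (simp add: y_def)
    have in_between: "l < l + t * (u - l)" "l + t * (u - l) < u" if "0 < t" "t < 1" "l < u" for t l u :: real
      using that mult_strict_right_mono[of t 1 "u - l"] by (auto simp: algebra_simps)
    have "y \<in> box a b"
      using in_between[OF \<theta>(1,2) ab] by (simp add: mem_box yi)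
    moreover have "x - y \<in> box c d"
    proof -
      have "(x - y) \<bullet> i = c \<bullet> i + \<theta> i * (d \<bullet> i - c \<bullet> i)" if "i \<in> Basis" for i
        using \<theta>(3)[OF that] by (simp add: inner_diff_left yi that)
      then show ?thesis
        using in_between[OF \<theta>(1,2) cd] by (simp add: mem_box)
    qed
    ultimately have "y + (x - y) \<in> box a b + box c d"
      by (rule set_plus_intro)
    then show "x \<in> box a b + box c d"
      by simp
  qed
  have "root DIM('a) (measure lborel (box a b)) + root DIM('a) (measure lborel (box c d))
    \<le> root DIM('a) (measure lborel (box (a + c) (b + d)))"
    using prod_root_superadditive[of "Basis :: 'a set" "\<lambda>i. (b - a) \<bullet> i" "\<lambda>i. (d - c) \<bullet> i"] ab cd
    by (simp add: inner_diff_left measure_lborel_box_eq inner_add_left less_imp_le add_mono algebra_simps)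
  then have "(root DIM('a) (measure lborel (box a b)) + root DIM('a) (measure lborel (box c d))) ^ DIM('a)
    \<le> root DIM('a) (measure lborel (box (a + c) (b + d))) ^ DIM('a)"
    by (intro power_mono) auto
  also have "\<dots> = measure lborel (box (a + c) (b + d))"
    by (intro real_root_pow_pos2) auto
  also have "\<dots> \<le> measure lborel (box a b + box c d)"
  proof (rule measure_mono_fmeasurable[OF sub])
    have "open (box a b + box c d)" "bounded (box a b + box c d)"
      by (simp_all add: open_set_plus open_box bounded_set_plus)
    then show "box a b + box c d \<in> fmeasurable lborel"
      by (rule open_bounded_fmeasurable)
  qed auto
  finally show ?thesis .
qed

text \<open>Open boxes make the members of a packing literally disjoint and every union of them open; the
  price is that a cut along a hyperplane loses a null set.\<close>

definition box_packing :: "'a::euclidean_space set set \<Rightarrow> bool" where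
  "box_packing \<A> \<longleftrightarrow> finite \<A> \<and> \<A> \<noteq> {} \<and> pairwise disjnt \<A> \<and>
    (\<forall>X\<in>\<A>. X \<noteq> {} \<and> (\<exists>a b. X = box a b))"

lemma box_packing_open_bounded:
  assumes "box_packing \<A>"
  shows "open (\<Union>\<A>)" "bounded (\<Union>\<A>)" "\<Union>\<A> \<in> fmeasurable lborel" "measure lborel (\<Union>\<A>) > 0"
proof -
  show op: "open (\<Union>\<A>)"
    using assms by (intro open_Union) (auto simp: box_packing_def open_box)
  show bd: "bounded (\<Union>\<A>)"
    using assms by (intro bounded_Union) (auto simp: box_packing_def)
  show fm: "\<Union>\<A> \<in> fmeasurable lborel"
    using op bd by (rule open_bounded_fmeasurable)
  obtain a b where ab: "box a b \<in> \<A>" "box a b \<noteq> {}"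
    using assms unfolding box_packing_def by (metis all_not_in_conv)
  have "0 < measure lborel (box a b)"
    using ab(2) by (auto simp: box_ne_empty measure_lborel_box_eq inner_diff_left intro!: prod_pos)
  also have "\<dots> \<le> measure lborel (\<Union>\<A>)"
    using ab(1) fm by (intro measure_mono_fmeasurable) auto
  finally show "measure lborel (\<Union>\<A>) > 0" .
qed

lemma box_Int_coordinate_halfspace:
  fixes a b :: "'a::euclidean_space"
  assumes i: "i \<in> Basis"
  shows "box a b \<inter> {x. x \<bullet> i < s} = box a (b + (min s (b \<bullet> i) - b \<bullet> i) *\<^sub>R i)"
    and "box a b \<inter> {x. s < x \<bullet> i} = box (a + (max s (a \<bullet> i) - a \<bullet> i) *\<^sub>R i) b"
proof -
  have "(b + (min s (b \<bullet> i) - b \<bullet> i) *\<^sub>R i) \<bullet> j = (if j = i then min s (b \<bullet> i) else b \<bullet> j)"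
    "(a + (max s (a \<bullet> i) - a \<bullet> i) *\<^sub>R i) \<bullet> j = (if j = i then max s (a \<bullet> i) else a \<bullet> j)"
    if "j \<in> Basis" for j
    using that i by (auto simp: inner_add_left inner_Basis)
  then show "box a b \<inter> {x. x \<bullet> i < s} = box a (b + (min s (b \<bullet> i) - b \<bullet> i) *\<^sub>R i)"
    and "box a b \<inter> {x. s < x \<bullet> i} = box (a + (max s (a \<bullet> i) - a \<bullet> i) *\<^sub>R i) b"
    using i by (auto simp: set_eq_iff mem_box split: if_splits)
qed

text \<open>The halving step of the induction in the Hadwiger-Ohmann proof: cutting a packing with a
  halfspace does not increase the number of boxes, and decreases it when some box is lost.\<close>

lemma box_packing_restrict:
  assumes A: "box_packing \<A>" and H: "\<And>a b. \<exists>a' b'. box a b \<inter> H = box a' b'"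
    and ne: "\<Union>\<A> \<inter> H \<noteq> {}"
  defines "\<A>' \<equiv> (\<lambda>X. X \<inter> H) ` {X \<in> \<A>. X \<inter> H \<noteq> {}}"
  shows "box_packing \<A>'" "\<Union>\<A>' = \<Union>\<A> \<inter> H" "card \<A>' \<le> card \<A>"
    "Y \<in> \<A> \<Longrightarrow> Y \<inter> H = {} \<Longrightarrow> card \<A>' < card \<A>"
proof -
  have fin: "finite \<A>"
    using A by (simp add: box_packing_def)
  show "box_packing \<A>'"
    unfolding box_packing_def
  proof (intro conjI ballI)
    show "finite \<A>'"
      using fin by (simp add: \<A>'_def)
    show "\<A>' \<noteq> {}"
      using ne by (auto simp: \<A>'_def)
    show "pairwise disjnt \<A>'"
      using A by (fastforce simp: \<A>'_def box_packing_def pairwise_def disjnt_def)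
    show "X \<noteq> {}" if "X \<in> \<A>'" for X
      using that by (auto simp: \<A>'_def)
    show "\<exists>a b. X = box a b" if "X \<in> \<A>'" for X
      using that A H by (fastforce simp: \<A>'_def box_packing_def)
  qed
  show "\<Union>\<A>' = \<Union>\<A> \<inter> H"
    by (auto simp: \<A>'_def)
  have le: "card \<A>' \<le> card {X \<in> \<A>. X \<inter> H \<noteq> {}}"
    using fin by (auto simp: \<A>'_def intro!: card_image_le)
  also have "\<dots> \<le> card \<A>"
    using fin by (intro card_mono) auto
  finally show "card \<A>' \<le> card \<A>" .
  show "card \<A>' < card \<A>" if "Y \<in> \<A>" "Y \<inter> H = {}"
  proof -
    have "card {X \<in> \<A>. X \<inter> H \<noteq> {}} < card \<A>"
      using fin that by (intro psubset_card_mono) auto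
    with le show ?thesis by simp
  qed
qed

lemma coordinate_hyperplane_null:
  fixes i :: "'a::euclidean_space"
  assumes "i \<in> Basis"
  shows "measure lborel {x. x \<bullet> i = s} = 0" "emeasure lborel {x. x \<bullet> i = s} = 0"
proof -
  have "negligible {x. i \<bullet> x = s}"
    using assms by (intro negligible_hyperplane) auto
  then have "emeasure lebesgue {x. x \<bullet> i = s} = 0"
    by (simp add: negligible_iff_null_sets null_sets_def inner_commute)
  moreover have "{x. x \<bullet> i = s} \<in> sets lborel"
    by simp
  ultimately show "emeasure lborel {x. x \<bullet> i = s} = 0"
    by (simp add: emeasure_completion)
  then show "measure lborel {x. x \<bullet> i = s} = 0"
    by (simp add: measure_def)
qed

lemma measure_split_coordinate:
  fixes A :: "'a::euclidean_space set"
  assumes i: "i \<in> Basis" and A: "A \<in> fmeasurable lborel"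
  shows "measure lborel A = measure lborel (A \<inter> {x. x \<bullet> i < s}) + measure lborel (A \<inter> {x. s < x \<bullet> i})"
proof -
  have "AE x in lborel. x \<notin> {x. x \<bullet> i = s}"
    using coordinate_hyperplane_null[OF i, of s] by (intro AE_not_in null_setsI) auto
  then have "measure lborel A = measure lborel ((A \<inter> {x. x \<bullet> i < s}) \<union> (A \<inter> {x. s < x \<bullet> i}))"
    using A by (intro measure_eq_AE) (auto simp: fmeasurable_def elim!: eventually_mono)
  also have "\<dots> = measure lborel (A \<inter> {x. x \<bullet> i < s}) + measure lborel (A \<inter> {x. s < x \<bullet> i})"
  proof (rule measure_Union)
    have "A \<inter> {x. x \<bullet> i < s} \<in> fmeasurable lborel" "A \<inter> {x. s < x \<bullet> i} \<in> fmeasurable lborel"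
      using A by (auto intro: fmeasurable_Int_fmeasurable)
    then show "emeasure lborel (A \<inter> {x. x \<bullet> i < s}) \<noteq> \<infinity>"
      "emeasure lborel (A \<inter> {x. s < x \<bullet> i}) \<noteq> \<infinity>"
      "A \<inter> {x. x \<bullet> i < s} \<in> sets lborel" "A \<inter> {x. s < x \<bullet> i} \<in> sets lborel"
      by (auto simp: fmeasurable_def)
  qed auto
  finally show ?thesis .
qed

text \<open>The volume below the hyperplane at height \<open>s\<close> is a sum of explicit continuous functions of \<open>s\<close>,
  one for each box, so the intermediate value theorem applies.\<close>

lemma box_packing_split_proportion:
  fixes \<B> :: "'a::euclidean_space set set"
  assumes B: "box_packing \<B>" and i: "i \<in> Basis" and \<theta>: "0 \<le> \<theta>" "\<theta> \<le> 1"
  obtains s where "measure lborel (\<Union>\<B> \<inter> {x. x \<bullet> i < s}) = \<theta> * measure lborel (\<Union>\<B>)"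
proof -
  let ?B = "\<Union>\<B>"
  let ?g = "\<lambda>s. measure lborel (?B \<inter> {x. x \<bullet> i < s})"
  note props = box_packing_open_bounded[OF B]
  have piece: "continuous_on UNIV (\<lambda>s. measure lborel (X \<inter> {x. x \<bullet> i < s}))" if X: "X \<in> \<B>" for X
  proof -
    obtain a b where X: "X = box a b" and ne: "box a b \<noteq> {}"
      using B X unfolding box_packing_def by metis
    have lt: "a \<bullet> j < b \<bullet> j" if "j \<in> Basis" for j
      using ne that by (auto simp: box_ne_empty)
    have "measure lborel (X \<inter> {x. x \<bullet> i < s})
        = max 0 (min s (b \<bullet> i) - a \<bullet> i) * (\<Prod>j\<in>Basis - {i}. b \<bullet> j - a \<bullet> j)" for s
    proof -
      let ?b = "b + (min s (b \<bullet> i) - b \<bullet> i) *\<^sub>R i"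
      have bj: "?b \<bullet> j = (if j = i then min s (b \<bullet> i) else b \<bullet> j)" if "j \<in> Basis" for j
        using that i by (auto simp: inner_add_left inner_Basis)
      have "X \<inter> {x. x \<bullet> i < s} = box a ?b"
        unfolding X by (rule box_Int_coordinate_halfspace(1)[OF i])
      moreover have "measure lborel (box a ?b)
          = max 0 (min s (b \<bullet> i) - a \<bullet> i) * (\<Prod>j\<in>Basis - {i}. b \<bullet> j - a \<bullet> j)"
      proof (cases "a \<bullet> i \<le> min s (b \<bullet> i)")
        case True
        have "a \<bullet> j \<le> ?b \<bullet> j" if "j \<in> Basis" for j
          using bj[OF that] lt[OF that] True by simp
        then have "measure lborel (box a ?b) = (\<Prod>j\<in>Basis. ?b \<bullet> j - a \<bullet> j)"
          by (simp add: measure_lborel_box_eq inner_diff_left)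
        also have "\<dots> = (?b \<bullet> i - a \<bullet> i) * (\<Prod>j\<in>Basis - {i}. ?b \<bullet> j - a \<bullet> j)"
          using i by (simp add: prod.remove)
        also have "(\<Prod>j\<in>Basis - {i}. ?b \<bullet> j - a \<bullet> j) = (\<Prod>j\<in>Basis - {i}. b \<bullet> j - a \<bullet> j)"
          by (rule prod.cong) (auto simp: bj)
        finally show ?thesis
          using True bj[OF i] by simp
      next
        case False
        then have "\<not> a \<bullet> i \<le> ?b \<bullet> i"
          using bj[OF i] by simp
        then have "measure lborel (box a ?b) = 0"
          using i by (auto simp: measure_lborel_box_eq)
        moreover have "max 0 (min s (b \<bullet> i) - a \<bullet> i) = 0"
          using False lt[OF i] by simp
        ultimately show ?thesis
          by (simp only: mult_zero_left)
      qed
      ultimately show ?thesis by simp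
    qed
    then show ?thesis
      by (simp add: continuous_intros)
  qed
  have g_eq: "?g s = (\<Sum>X\<in>\<B>. measure lborel (X \<inter> {x. x \<bullet> i < s}))" for s
  proof -
    have "?B \<inter> {x. x \<bullet> i < s} = (\<Union>X\<in>\<B>. X \<inter> {x. x \<bullet> i < s})"
      by auto
    also have "measure lborel \<dots> = (\<Sum>X\<in>\<B>. measure lborel (X \<inter> {x. x \<bullet> i < s}))"
    proof (rule measure_finite_Union)
      show "finite \<B>" "disjoint_family_on (\<lambda>X. X \<inter> {x. x \<bullet> i < s}) \<B>"
        using B by (auto simp: box_packing_def disjoint_family_on_def pairwise_def disjnt_def)
      show "(\<lambda>X. X \<inter> {x. x \<bullet> i < s}) ` \<B> \<subseteq> sets lborel"
        using B by (auto simp: box_packing_def intro!: borel_open open_Int open_box open_halfspace_component_lt)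
      show "emeasure lborel (X \<inter> {x. x \<bullet> i < s}) \<noteq> \<infinity>" if "X \<in> \<B>" for X
        using that B emeasure_bounded_finite[of "X \<inter> {x. x \<bullet> i < s}"]
        by (auto simp: box_packing_def bounded_Int)
    qed
    finally show ?thesis .
  qed
  have cont: "continuous_on UNIV ?g"
    unfolding g_eq by (intro continuous_on_sum piece)
  obtain M where M: "\<And>x. x \<in> ?B \<Longrightarrow> \<bar>x \<bullet> i\<bar> \<le> M"
    using props(2) i unfolding bounded_iff by (meson Basis_le_norm order_trans)
  have lo: "?B \<inter> {x. x \<bullet> i < - M - 1} = {}"
    using M by fastforce
  have hi: "?B \<inter> {x. x \<bullet> i < M + 1} = ?B"
    using M by fastforce
  have "M \<ge> 0"
    using M props(4) by (metis abs_ge_zero all_not_in_conv less_irrefl measure_empty order_trans)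
  then have "\<exists>s\<ge>-M-1. s \<le> M+1 \<and> ?g s = \<theta> * measure lborel ?B"
    using \<theta> props(4) cont
    by (intro IVT') (auto simp: lo hi mult_left_le_one_le intro: continuous_on_subset)
  then show thesis
    using that by blast
qed

text \<open>The Hadwiger-Ohmann argument, by induction on the total number of boxes. Two disjoint boxes of
  \<open>\<A>\<close> are separated by a coordinate hyperplane, so both parts of \<open>\<A>\<close> have fewer boxes. Cutting \<open>\<B>\<close>
  by a parallel hyperplane in the same proportion \<open>\<theta>\<close> makes the inequalities for the two pairs of
  parts scale to \<open>\<theta>\<close> and \<open>1 - \<theta>\<close> times the inequality for the whole, while the sums of the parts
  stay on different sides of a third hyperplane.\<close>

lemma brunn_minkowski_box_packings:
  fixes \<A> \<B> :: "'a::euclidean_space set set"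
  assumes "box_packing \<A>" "box_packing \<B>"
  shows "(root DIM('a) (measure lborel (\<Union>\<A>)) + root DIM('a) (measure lborel (\<Union>\<B>))) ^ DIM('a)
    \<le> measure lborel (\<Union>\<A> + \<Union>\<B>)"
  using assms
proof (induction "card \<A> + card \<B>" arbitrary: \<A> \<B> rule: less_induct)
  case less
  let ?d = "DIM('a)"
  have d: "?d > 0" by simp
  have cut: "(root ?d (measure lborel (\<Union>\<A>)) + root ?d (measure lborel (\<Union>\<B>))) ^ ?d
    \<le> measure lborel (\<Union>\<A> + \<Union>\<B>)"
    if smaller: "\<And>\<A>' \<B>' :: 'a set set. card \<A>' + card \<B>' < card \<A> + card \<B> \<Longrightarrow> box_packing \<A>' \<Longrightarrow> box_packing \<B>'
      \<Longrightarrow> (root ?d (measure lborel (\<Union>\<A>')) + root ?d (measure lborel (\<Union>\<B>'))) ^ ?d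
        \<le> measure lborel (\<Union>\<A>' + \<Union>\<B>')"
    and A: "box_packing \<A>" and B: "box_packing \<B>" and card: "card \<A> \<ge> 2" for \<A> \<B> :: "'a set set"
  proof -
    let ?A = "\<Union>\<A>" and ?B = "\<Union>\<B>"
    note A' = box_packing_open_bounded[OF A] and B' = box_packing_open_bounded[OF B]
    obtain X Y where XY: "X \<in> \<A>" "Y \<in> \<A>" "X \<noteq> Y"
      using card by (metis card_le_Suc0_iff_eq A box_packing_def not_less_eq_eq numeral_2_eq_2)
    obtain a b where X: "X = box a b" "box a b \<noteq> {}"
      using A XY(1) unfolding box_packing_def by metis
    obtain a' b' where Y: "Y = box a' b'" "box a' b' \<noteq> {}"
      using A XY(2) unfolding box_packing_def by metis
    have "box a b \<inter> box a' b' = {}"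
      using A XY X Y by (auto simp: box_packing_def pairwise_def disjnt_def)
    then obtain i where i: "i \<in> Basis" and sep: "b \<bullet> i \<le> a' \<bullet> i \<or> b' \<bullet> i \<le> a \<bullet> i"
      using X(2) Y(2) unfolding disjoint_interval box_ne_empty by (meson not_less)
    have "\<exists>X\<in>\<A>. \<exists>Y\<in>\<A>. \<exists>t. X \<subseteq> {x. x \<bullet> i < t} \<and> Y \<subseteq> {x. t < x \<bullet> i}"
      using sep
    proof
      assume "b \<bullet> i \<le> a' \<bullet> i"
      then have "X \<subseteq> {x. x \<bullet> i < b \<bullet> i}" "Y \<subseteq> {x. b \<bullet> i < x \<bullet> i}"
        using i by (force simp: X Y mem_box)+
      with XY show ?thesis by blast
    next
      assume "b' \<bullet> i \<le> a \<bullet> i"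
      then have "Y \<subseteq> {x. x \<bullet> i < b' \<bullet> i}" "X \<subseteq> {x. b' \<bullet> i < x \<bullet> i}"
        using i by (force simp: X Y mem_box)+
      with XY show ?thesis by blast
    qed
    then obtain X Y t where XY: "X \<in> \<A>" "Y \<in> \<A>" "X \<subseteq> {x. x \<bullet> i < t}" "Y \<subseteq> {x. t < x \<bullet> i}"
      by blast
    have ne: "X \<noteq> {}" "Y \<noteq> {}"
      using A XY by (auto simp: box_packing_def)
    let ?lo = "\<lambda>t. {x::'a. x \<bullet> i < t}" and ?hi = "\<lambda>t. {x::'a. t < x \<bullet> i}"
    have boxes: "\<exists>c' d'. box c d \<inter> ?lo s = box c' d'" "\<exists>c' d'. box c d \<inter> ?hi s = box c' d'" for c d s
      using box_Int_coordinate_halfspace[OF i] by blast+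
    define Alo where "Alo = (\<lambda>X. X \<inter> ?lo t) ` {X \<in> \<A>. X \<inter> ?lo t \<noteq> {}}"
    define Ahi where "Ahi = (\<lambda>X. X \<inter> ?hi t) ` {X \<in> \<A>. X \<inter> ?hi t \<noteq> {}}"
    have "?A \<inter> ?lo t \<noteq> {}" "?A \<inter> ?hi t \<noteq> {}"
      using XY ne by fast+
    note Alo = box_packing_restrict[OF A boxes(1) this(1), folded Alo_def]
      and Ahi = box_packing_restrict[OF A boxes(2) this(2), folded Ahi_def]
    have cAlo: "card Alo < card \<A>"
      using XY by (intro Alo(4)[of Y]) force+
    have cAhi: "card Ahi < card \<A>"
      using XY by (intro Ahi(4)[of X]) force+
    define \<theta> where "\<theta> = measure lborel (\<Union>Alo) / measure lborel ?A"
    have splitA: "measure lborel ?A = measure lborel (\<Union>Alo) + measure lborel (\<Union>Ahi)"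
      unfolding Alo(2) Ahi(2) by (rule measure_split_coordinate[OF i A'(3)])
    have posA: "measure lborel (\<Union>Alo) > 0" "measure lborel (\<Union>Ahi) > 0"
      using box_packing_open_bounded(4) Alo(1) Ahi(1) by blast+
    have \<theta>: "0 < \<theta>" "\<theta> < 1"
      using posA A'(4) splitA by (auto simp: \<theta>_def)
    have mAlo: "measure lborel (\<Union>Alo) = \<theta> * measure lborel ?A"
      using A'(4) by (simp add: \<theta>_def)
    have mAhi: "measure lborel (\<Union>Ahi) = (1 - \<theta>) * measure lborel ?A"
      using splitA mAlo by (simp add: algebra_simps)
    obtain s where s: "measure lborel (?B \<inter> ?lo s) = \<theta> * measure lborel ?B"
      using box_packing_split_proportion[OF B i] \<theta> by (metis less_imp_le)
    have s': "measure lborel (?B \<inter> ?hi s) = (1 - \<theta>) * measure lborel ?B"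
      using measure_split_coordinate[OF i B'(3), of s] s by (simp add: algebra_simps)
    define Blo where "Blo = (\<lambda>X. X \<inter> ?lo s) ` {X \<in> \<B>. X \<inter> ?lo s \<noteq> {}}"
    define Bhi where "Bhi = (\<lambda>X. X \<inter> ?hi s) ` {X \<in> \<B>. X \<inter> ?hi s \<noteq> {}}"
    have "?B \<inter> ?lo s \<noteq> {}" "?B \<inter> ?hi s \<noteq> {}"
      using s s' \<theta> B'(4) by (metis measure_empty mult_eq_0_iff less_irrefl diff_gt_0_iff_gt)+
    note Blo = box_packing_restrict[OF B boxes(1) this(1), folded Blo_def]
      and Bhi = box_packing_restrict[OF B boxes(2) this(2), folded Bhi_def]
    let ?p = "root ?d (measure lborel ?A)" and ?q = "root ?d (measure lborel ?B)"
    have scale: "(root ?d (c * measure lborel ?A) + root ?d (c * measure lborel ?B)) ^ ?d = c * (?p + ?q) ^ ?d"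
      if "c > 0" for c
    proof -
      have "(root ?d (c * measure lborel ?A) + root ?d (c * measure lborel ?B)) = root ?d c * (?p + ?q)"
        by (simp add: real_root_mult algebra_simps)
      then show ?thesis
        using that by (simp add: power_mult_distrib real_root_pow_pos2)
    qed
    have lo: "\<theta> * (?p + ?q) ^ ?d \<le> measure lborel (\<Union>Alo + \<Union>Blo)"
      using smaller[OF _ Alo(1) Blo(1)] cAlo Blo(3) scale[of \<theta>] \<theta> by (simp add: mAlo Blo(2) s)
    have hi: "(1 - \<theta>) * (?p + ?q) ^ ?d \<le> measure lborel (\<Union>Ahi + \<Union>Bhi)"
      using smaller[OF _ Ahi(1) Bhi(1)] cAhi Bhi(3) scale[of "1 - \<theta>"] \<theta> by (simp add: mAhi Bhi(2) s')
    have fm: "?A + ?B \<in> fmeasurable lborel"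
      using A' B' by (intro open_bounded_fmeasurable open_set_plus bounded_set_plus)
    have mono: "measure lborel (\<Union>Alo + \<Union>Blo) \<le> measure lborel ((?A + ?B) \<inter> ?lo (t + s))"
      "measure lborel (\<Union>Ahi + \<Union>Bhi) \<le> measure lborel ((?A + ?B) \<inter> ?hi (t + s))"
    proof -
      show "measure lborel (\<Union>Alo + \<Union>Blo) \<le> measure lborel ((?A + ?B) \<inter> ?lo (t + s))"
        using box_packing_open_bounded(1)[OF Alo(1)] fm
        by (intro measure_mono_fmeasurable)
          (auto simp: Alo(2) Blo(2) set_plus_def inner_add_left add_strict_mono
            intro!: fmeasurable_Int_fmeasurable borel_open open_set_plus[unfolded set_plus_def])
      show "measure lborel (\<Union>Ahi + \<Union>Bhi) \<le> measure lborel ((?A + ?B) \<inter> ?hi (t + s))"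
        using box_packing_open_bounded(1)[OF Ahi(1)] fm
        by (intro measure_mono_fmeasurable)
          (auto simp: Ahi(2) Bhi(2) set_plus_def inner_add_left add_strict_mono
            intro!: fmeasurable_Int_fmeasurable borel_open open_set_plus[unfolded set_plus_def])
    qed
    have "(?p + ?q) ^ ?d = \<theta> * (?p + ?q) ^ ?d + (1 - \<theta>) * (?p + ?q) ^ ?d"
      by (simp add: algebra_simps)
    also have "\<dots> \<le> measure lborel ((?A + ?B) \<inter> ?lo (t + s)) + measure lborel ((?A + ?B) \<inter> ?hi (t + s))"
      using lo hi mono by linarith
    also have "\<dots> = measure lborel (?A + ?B)"
      using measure_split_coordinate[OF i fm, of "t + s"] by simp
    finally show ?thesis .
  qed
  have card_pos: "card \<A> > 0" "card \<B> > 0"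
    using less.prems by (auto simp: box_packing_def card_gt_0_iff)
  consider "card \<A> \<ge> 2" | "card \<B> \<ge> 2" | "card \<A> = 1" "card \<B> = 1"
    using card_pos by linarith
  then show ?case
  proof cases
    case 1
    show ?thesis
      by (rule cut) (use 1 less.hyps less.prems in auto)
  next
    case 2
    have "(root ?d (measure lborel (\<Union>\<B>)) + root ?d (measure lborel (\<Union>\<A>))) ^ ?d
      \<le> measure lborel (\<Union>\<B> + \<Union>\<A>)"
      by (rule cut) (use 2 less.hyps less.prems in \<open>auto simp: add.commute[of "card \<B>"]\<close>)
    then show ?thesis
      by (simp add: add.commute)
  next
    case 3
    then obtain X Y where "\<A> = {X}" "\<B> = {Y}"
      by (auto simp: card_1_singleton_iff)
    with less.prems show ?thesis
      by (auto simp: box_packing_def intro: brunn_minkowski_box)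
  qed
qed

text \<open>An open set is a countable union of closed boxes with disjoint interiors; the interiors
  exhaust it up to a null set, and finitely many of them exhaust it up to \<open>e\<close>.\<close>

lemma open_box_packing_exhaustion:
  fixes S :: "'a::euclidean_space set"
  assumes S: "open S" "bounded S" "S \<noteq> {}" and e: "e > 0"
  obtains \<A> where "box_packing \<A>" "\<Union>\<A> \<subseteq> S" "measure lborel S - e < measure lborel (\<Union>\<A>)"
proof -
  obtain a b where ab: "S \<subseteq> cbox a b" "box a b \<noteq> {}"
  proof -
    obtain a where "S \<subseteq> box (-a) a"
      using bounded_subset_box_symmetric[OF S(2)] .
    then show thesis
      using S(3) that[of "-a" a] box_subset_cbox by blast
  qed
  \<comment> \<open>points outside \<open>S\<close> do not matter for the covering, but a gauge needs a value there\<close>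
  have gauge: "gauge (\<lambda>x. if x \<in> S then S else UNIV)"
    using S(1) by (auto simp: gauge_def)
  obtain \<D> where \<D>: "countable \<D>" "\<And>K. K \<in> \<D> \<Longrightarrow> interior K \<noteq> {} \<and> (\<exists>c d. K = cbox c d)"
    "pairwise (\<lambda>A B. interior A \<inter> interior B = {}) \<D>"
    "\<And>K. K \<in> \<D> \<Longrightarrow> \<exists>x\<in>S \<inter> K. K \<subseteq> (if x \<in> S then S else UNIV)" "S \<subseteq> \<Union>\<D>"
    by (rule covering_lemma[OF ab gauge]) (rule that)
  have sub: "K \<subseteq> S" if "K \<in> \<D>" for K
    using \<D>(4)[OF that] by auto
  have ne: "\<D> \<noteq> {}"
    using \<D>(5) S(3) by auto
  let ?U = "\<Union>K\<in>\<D>. interior K"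
  have null: "S - ?U \<in> null_sets lebesgue"
  proof -
    have "negligible (\<Union>K\<in>\<D>. K - interior K)"
      using \<D>(1)
    proof (rule negligible_countable_Union[OF countable_image])
      show "negligible X" if "X \<in> (\<lambda>K. K - interior K) ` \<D>" for X
      proof -
        from that obtain K where K: "K \<in> \<D>" "X = K - interior K"
          by blast
        then obtain c d where "K = cbox c d"
          using \<D>(2) by blast
        then show ?thesis
          by (simp add: K(2) interior_cbox negligible_frontier_interval)
      qed
    qed
    then have "negligible (S - ?U)"
      by (rule negligible_subset) (use \<D>(5) in auto)
    then show ?thesis
      by (simp add: negligible_iff_null_sets)
  qed
  have U: "?U \<in> sets borel" "S \<in> sets borel"
    using S by (auto intro!: borel_open open_UN)
  have USeq: "measure lborel ?U = measure lborel S"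
  proof -
    have "measure lebesgue (S - (S - ?U)) = measure lebesgue S"
      using null U by (intro measure_Diff_null_set) auto
    moreover have "S - (S - ?U) = ?U"
      using sub interior_subset by blast
    ultimately show ?thesis
      using U by (simp add: measure_completion)
  qed
  let ?K = "from_nat_into \<D>"
  define F where "F n = (\<lambda>k. interior (?K k)) ` {..n}" for n :: nat
  have range: "range ?K = \<D>"
    using ne \<D>(1) by (rule range_from_nat_into)
  have KD: "?K k \<in> \<D>" for k
    using ne by (rule from_nat_into)
  have int_sub: "interior (?K k) \<subseteq> S" for k
    by (rule order_trans[OF interior_subset sub[OF KD]])
  have "(\<lambda>n. measure lborel (\<Union>(F n))) \<longlonglongrightarrow> measure lborel (\<Union>n. \<Union>(F n))"
  proof (rule Lim_measure_incseq)
    show "range (\<lambda>n. \<Union>(F n)) \<subseteq> sets lborel"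
      by (auto simp: F_def intro!: borel_open)
    show "incseq (\<lambda>n. \<Union>(F n))"
      by (auto simp: incseq_def F_def intro: order_trans)
    have "emeasure lborel (\<Union>n. \<Union>(F n)) \<le> emeasure lborel S"
      using int_sub S(1) by (intro emeasure_mono) (auto simp: F_def)
    then show "emeasure lborel (\<Union>n. \<Union>(F n)) \<noteq> \<infinity>"
      using emeasure_bounded_finite[OF S(2)] by auto
  qed
  also have "(\<Union>n. \<Union>(F n)) = (\<Union>K\<in>range ?K. interior K)"
    by (auto simp: F_def)
  also have "\<dots> = ?U"
    by (simp only: range)
  finally have "(\<lambda>n. measure lborel (\<Union>(F n))) \<longlonglongrightarrow> measure lborel S"
    by (simp only: USeq)
  then have "\<forall>\<^sub>F n in sequentially. measure lborel S - e < measure lborel (\<Union>(F n))"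
    using e by (intro order_tendstoD(1)[of _ "measure lborel S"]) auto
  then obtain n where n: "measure lborel S - e < measure lborel (\<Union>(F n))"
    by (auto simp: eventually_sequentially)
  have "box_packing (F n)"
    unfolding box_packing_def
  proof (intro conjI ballI)
    show "pairwise disjnt (F n)"
      unfolding pairwise_def
    proof (intro ballI impI)
      fix X Y assume "X \<in> F n" "Y \<in> F n" "X \<noteq> Y"
      then obtain j k where XY: "X = interior (?K j)" "Y = interior (?K k)"
        by (auto simp: F_def)
      moreover have "?K j \<noteq> ?K k"
        using XY \<open>X \<noteq> Y\<close> by auto
      ultimately show "disjnt X Y"
        using \<D>(3) KD[of j] KD[of k] by (simp add: pairwise_def disjnt_def)
    qed
    show "X \<noteq> {}" "\<exists>a b. X = box a b" if "X \<in> F n" for X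
    proof -
      from that obtain k where "X = interior (?K k)"
        by (auto simp: F_def)
      then show "X \<noteq> {}" "\<exists>a b. X = box a b"
        using \<D>(2)[OF KD[of k]] interior_cbox by metis+
    qed
  qed (auto simp: F_def)
  then show thesis
    using n int_sub by (intro that[of "F n"]) (auto simp: F_def)
qed

lemma brunn_minkowski_open:
  fixes A B :: "'a::euclidean_space set"
  assumes A: "open A" "bounded A" "A \<noteq> {}" and B: "open B" "bounded B" "B \<noteq> {}"
  shows "(root DIM('a) (measure lborel A) + root DIM('a) (measure lborel B)) ^ DIM('a)
    \<le> measure lborel (A + B)"
proof -
  let ?d = "DIM('a)"
  have approx: "(root ?d (measure lborel A - e) + root ?d (measure lborel B - e)) ^ ?d \<le> measure lborel (A + B)"
    if e: "e > 0" "e < measure lborel A" "e < measure lborel B" for e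
  proof -
    obtain \<A> where \<A>: "box_packing \<A>" "\<Union>\<A> \<subseteq> A" "measure lborel A - e < measure lborel (\<Union>\<A>)"
      using open_box_packing_exhaustion[OF A e(1)] .
    obtain \<B> where \<B>: "box_packing \<B>" "\<Union>\<B> \<subseteq> B" "measure lborel B - e < measure lborel (\<Union>\<B>)"
      using open_box_packing_exhaustion[OF B e(1)] .
    have "(root ?d (measure lborel A - e) + root ?d (measure lborel B - e)) ^ ?d
      \<le> (root ?d (measure lborel (\<Union>\<A>)) + root ?d (measure lborel (\<Union>\<B>))) ^ ?d"
      using \<A>(3) \<B>(3) e by (intro power_mono add_mono) auto
    also have "\<dots> \<le> measure lborel (\<Union>\<A> + \<Union>\<B>)"
      using brunn_minkowski_box_packings \<A>(1) \<B>(1) .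
    also have "\<dots> \<le> measure lborel (A + B)"
      using \<A> \<B> A B box_packing_open_bounded(1)[OF \<A>(1)]
      by (intro measure_mono_fmeasurable set_plus_mono2 open_bounded_fmeasurable open_set_plus bounded_set_plus)
        (auto intro!: borel_open open_set_plus)
    finally show ?thesis .
  qed
  have pos: "measure lborel S > 0" if "open S" "bounded S" "S \<noteq> {}" for S :: "'a set"
    using open_box_packing_exhaustion[OF that, of "1"] box_packing_open_bounded(4)
      measure_mono_fmeasurable[OF _ _ open_bounded_fmeasurable[OF that(1,2)]]
    by (metis box_packing_open_bounded(3) fmeasurableD less_le_trans zero_less_one)
  have lim: "((\<lambda>e. (root ?d (measure lborel A - e) + root ?d (measure lborel B - e)) ^ ?d)
      \<longlongrightarrow> (root ?d (measure lborel A - 0) + root ?d (measure lborel B - 0)) ^ ?d) (at_right 0)"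
    by (intro tendsto_intros)
  have ev: "\<forall>\<^sub>F e in at_right 0. (root ?d (measure lborel A - e) + root ?d (measure lborel B - e)) ^ ?d
      \<le> measure lborel (A + B)"
    using pos[OF A] pos[OF B] unfolding eventually_at_right_field
    by (intro exI[of _ "min (measure lborel A) (measure lborel B)"]) (auto intro: approx)
  show ?thesis
    using tendsto_upperbound[OF lim ev] by simp
qed

lemma compact_fmeasurable: "compact K \<Longrightarrow> K \<in> fmeasurable lborel" for K :: "'a::euclidean_space set"
  using emeasure_bounded_finite[of K] by (auto intro!: fmeasurableI simp: compact_imp_bounded compact_imp_closed)

lemma measure_lebesgue_compact:
  "compact K \<Longrightarrow> measure lebesgue K = measure lborel K" for K :: "'a::euclidean_space set"
  by (simp add: measure_completion compact_imp_closed)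

text \<open>The radius is \<open>2 / (n + 1)\<close> because it arises as the sum of two radii \<open>1 / (n + 1)\<close> in the passage from
  open to compact sets.\<close>

lemma measure_neighbourhoods_tendsto:
  fixes K :: "'a::euclidean_space set"
  assumes K: "compact K"
  shows "(\<lambda>n. measure lborel (K + ball 0 (2 / real (Suc n)))) \<longlonglongrightarrow> measure lborel K"
proof -
  let ?N = "\<lambda>n. K + ball 0 (2 / real (Suc n))"
  have op: "open (?N n)" for n
    by (simp add: open_set_plus_right)
  have "(\<Inter>n. ?N n) = K"
  proof (intro subset_antisym subsetI)
    fix x assume x: "x \<in> (\<Inter>n. ?N n)"
    have "\<exists>y\<in>K. dist y x < e" if "e > 0" for e
    proof -
      obtain n where n: "2 / real (Suc n) < e"
        using reals_Archimedean[of "e / 2"] \<open>e > 0\<close> by (auto simp: field_simps)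
      have "x \<in> ?N n" using x by blast
      then obtain y z where "x = y + z" "y \<in> K" "norm z < 2 / real (Suc n)"
        by (auto simp: set_plus_def)
      with n show ?thesis
        by (intro bexI[of _ y]) (auto simp: dist_norm)
    qed
    then have "x \<in> closure K"
      by (simp add: closure_approachable)
    then show "x \<in> K"
      using K by (simp add: compact_imp_closed closure_closed)
  next
    fix x assume "x \<in> K"
    then have "x + 0 \<in> ?N n" for n
      by (intro set_plus_intro) auto
    then show "x \<in> (\<Inter>n. ?N n)" by simp
  qed
  moreover have "(\<lambda>n. measure lborel (?N n)) \<longlonglongrightarrow> measure lborel (\<Inter>n. ?N n)"
  proof (rule Lim_measure_decseq)
    show "range ?N \<subseteq> sets lborel"
      using op by auto
    show "decseq ?N"
      by (intro decseq_SucI set_plus_mono2 subset_ball) (auto simp: frac_le)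
    show "emeasure lborel (?N n) \<noteq> \<infinity>" for n
      using emeasure_bounded_finite[of "?N n"] K by (auto simp: bounded_set_plus compact_imp_bounded)
  qed
  ultimately show ?thesis by simp
qed

text \<open>The summands are replaced by open neighbourhoods of radius \<open>1 / (n + 1)\<close>, whose sum lies in the
  neighbourhood of \<open>A + B\<close> of twice that radius; the volume of the latter tends to that of \<open>A + B\<close>.\<close>

theorem brunn_minkowski:
  fixes A B :: "'a::euclidean_space set"
  assumes A: "compact A" "A \<noteq> {}" and B: "compact B" "B \<noteq> {}"
  shows "root DIM('a) (measure lebesgue A) + root DIM('a) (measure lebesgue B)
    \<le> root DIM('a) (measure lebesgue (A + B))"
proof -
  let ?d = "DIM('a)"
  let ?e = "\<lambda>n. 1 / real (Suc n)"
  have d: "?d > 0" by simp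
  have "(root ?d (measure lborel A) + root ?d (measure lborel B)) ^ ?d
      \<le> measure lborel ((A + B) + ball 0 (2 / real (Suc n)))" for n
  proof -
    let ?U = "ball (0::'a) (?e n)"
    have op: "open (A + ?U)" "open (B + ?U)"
      by (simp_all add: open_set_plus_right)
    have bd: "bounded (A + ?U)" "bounded (B + ?U)"
      using A B by (auto intro: bounded_set_plus compact_imp_bounded)
    have sup: "A \<subseteq> A + ?U" "B \<subseteq> B + ?U"
      using set_plus_intro[of _ _ 0 ?U] by fastforce+
    have "(root ?d (measure lborel A) + root ?d (measure lborel B)) ^ ?d
      \<le> (root ?d (measure lborel (A + ?U)) + root ?d (measure lborel (B + ?U))) ^ ?d"
      using sup op bd compact_fmeasurable[OF A(1)] compact_fmeasurable[OF B(1)]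
      by (intro power_mono add_mono real_root_le_mono measure_mono_fmeasurable open_bounded_fmeasurable) auto
    also have "\<dots> \<le> measure lborel ((A + ?U) + (B + ?U))"
      using op bd sup A B by (intro brunn_minkowski_open) auto
    also have "\<dots> \<le> measure lborel ((A + B) + ball 0 (2 / real (Suc n)))"
    proof (rule measure_mono_fmeasurable)
      show "(A + ?U) + (B + ?U) \<subseteq> (A + B) + ball 0 (2 / real (Suc n))"
      proof
        fix x assume "x \<in> (A + ?U) + (B + ?U)"
        then obtain a u b v where x: "x = (a + u) + (b + v)" "a \<in> A" "b \<in> B" "norm u < ?e n" "norm v < ?e n"
          by (auto simp: set_plus_def)
        have "norm (u + v) < 2 / real (Suc n)"
          using norm_triangle_ineq[of u v] x(4,5) by simp
        then have "(a + b) + (u + v) \<in> (A + B) + ball 0 (2 / real (Suc n))"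
          using x by (intro set_plus_intro) auto
        then show "x \<in> (A + B) + ball 0 (2 / real (Suc n))"
          by (simp add: x(1) algebra_simps)
      qed
      show "(A + ?U) + (B + ?U) \<in> sets lborel"
        using op by (auto intro!: borel_open open_set_plus)
      have "open (A + B + ball 0 (2 / real (Suc n)))"
        by (simp add: open_set_plus_right)
      moreover have "bounded (A + B + ball 0 (2 / real (Suc n)))"
        using bounded_set_plus[OF bounded_set_plus[OF compact_imp_bounded compact_imp_bounded] bounded_ball] A B
        by blast
      ultimately show "A + B + ball 0 (2 / real (Suc n)) \<in> fmeasurable lborel"
        by (rule open_bounded_fmeasurable)
    qed
    finally show ?thesis .
  qed
  moreover have "compact (A + B)"
    using A B by (simp add: compact_set_plus)
  ultimately have "(root ?d (measure lborel A) + root ?d (measure lborel B)) ^ ?d \<le> measure lborel (A + B)"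
    using measure_neighbourhoods_tendsto[of "A + B"] by (intro LIMSEQ_le_const) auto
  then have "root ?d ((root ?d (measure lborel A) + root ?d (measure lborel B)) ^ ?d)
      \<le> root ?d (measure lborel (A + B))"
    by (intro real_root_le_mono) auto
  then show ?thesis
    using A B d by (simp add: measure_lebesgue_compact compact_set_plus real_root_power_cancel)
qed

section \<open>Hausdorff measure in the top dimension is Lebesgue measure\<close>

text \<open>Brunn-Minkowski for \<open>C\<close> and \<open>- C\<close>: their sum, the difference set of \<open>C\<close>, has at least
  \<open>2 ^ DIM('a)\<close> times the volume of \<open>C\<close>, and it lies in the ball around 0 whose radius is the diameter
  of \<open>C\<close>.\<close>

theorem isodiametric_inequality:
  fixes C :: "'a::euclidean_space set"
  assumes C: "compact C" "C \<noteq> {}"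
  shows "measure lebesgue C \<le> unit_ball_vol DIM('a) * (diameter C / 2) ^ DIM('a)"
proof -
  let ?d = "DIM('a)" and ?N = "uminus ` C"
  have d: "?d > 0" by simp
  have N: "compact ?N" "?N \<noteq> {}"
    using C compact_negations[OF C(1)] by auto
  have "measure lebesgue ?N = measure lebesgue C"
    using measure_lebesgue_affine[of "-1" 0 C] by simp
  then have "2 * root ?d (measure lebesgue C) \<le> root ?d (measure lebesgue (C + ?N))"
    using brunn_minkowski[OF C N] by simp
  also have "\<dots> \<le> root ?d (measure lebesgue (cball (0::'a) (diameter C)))"
  proof (intro real_root_le_mono measure_mono_fmeasurable)
    show "C + ?N \<subseteq> cball 0 (diameter C)"
      using diameter_bounded_bound[OF compact_imp_bounded[OF C(1)]]
      by (auto simp: set_plus_def dist_norm)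
    show "C + ?N \<in> sets lebesgue"
      using compact_set_plus[OF C(1) N(1)] by (auto dest: compact_imp_closed)
  qed auto
  also have "measure lebesgue (cball (0::'a) (diameter C)) = unit_ball_vol ?d * diameter C ^ ?d"
    by (simp add: measure_lebesgue_compact content_cball diameter_ge_0 compact_imp_bounded[OF C(1)])
  finally have "(2 * root ?d (measure lebesgue C)) ^ ?d \<le> root ?d (unit_ball_vol ?d * diameter C ^ ?d) ^ ?d"
    by (intro power_mono) auto
  then have "2 ^ ?d * measure lebesgue C \<le> unit_ball_vol ?d * diameter C ^ ?d"
    by (simp add: power_mult_distrib real_root_pow_pos2 diameter_ge_0 compact_imp_bounded[OF C(1)])
  then show ?thesis
    by (simp add: power_divide field_simps)
qed

text \<open>The volume of a \<open>k\<close>-dimensional ball with the same diameter as \<open>C\<close>; an empty covering set is free.\<close>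

definition ball_cost :: "nat \<Rightarrow> 'a::metric_space set \<Rightarrow> ennreal" where
  "ball_cost k C = (if C = {} then 0 else ennreal (unit_ball_vol (real k) * (diameter C / 2) ^ k))"

lemma hausdorff_content_ball_cost:
  "hausdorff_content k \<delta> A =
    (INF C\<in>{C :: nat \<Rightarrow> 'a::metric_space set.
            A \<subseteq> (\<Union>i. C i) \<and> (\<forall>i. bounded (C i) \<and> diameter (C i) \<le> \<delta>)}.
       \<Sum>i. ball_cost k (C i))"
  unfolding hausdorff_content_def ball_cost_def ..

lemma emeasure_le_ball_cost:
  fixes C :: "'a::euclidean_space set"
  assumes "bounded C"
  shows "emeasure lebesgue (closure C) \<le> ball_cost DIM('a) C"
proof (cases "C = {}")
  case False
  have cc: "compact (closure C)"
    using assms by simp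
  have "emeasure lebesgue (closure C) = ennreal (measure lebesgue (closure C))"
    using cc by (intro emeasure_eq_measure2 lmeasurable_compact)
  also have "\<dots> \<le> ennreal (unit_ball_vol DIM('a) * (diameter (closure C) / 2) ^ DIM('a))"
    using False cc by (intro ennreal_leI isodiametric_inequality) auto
  finally show ?thesis
    using False assms by (simp add: ball_cost_def diameter_closure)
qed simp

lemma emeasure_le_hausdorff_measure:
  fixes A :: "'a::euclidean_space set"
  assumes A: "A \<in> sets lebesgue"
  shows "emeasure lebesgue A \<le> hausdorff_measure DIM('a) A"
proof -
  have "emeasure lebesgue A \<le> hausdorff_content DIM('a) 1 A"
    unfolding hausdorff_content_ball_cost
  proof (rule INF_greatest, clarify)
    fix C :: "nat \<Rightarrow> 'a set"
    assume C: "A \<subseteq> (\<Union>i. C i)" "\<forall>i. bounded (C i) \<and> diameter (C i) \<le> 1"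
    have "emeasure lebesgue A \<le> emeasure lebesgue (\<Union>i. closure (C i))"
    proof (intro emeasure_mono)
      show "A \<subseteq> (\<Union>i. closure (C i))"
        using C(1) by (rule order_trans) (intro UN_mono closure_subset subset_refl)
    qed auto
    also have "\<dots> \<le> (\<Sum>i. emeasure lebesgue (closure (C i)))"
      by (intro emeasure_subadditive_countably) auto
    also have "\<dots> \<le> (\<Sum>i. ball_cost DIM('a) (C i))"
      using C(2) by (intro suminf_le emeasure_le_ball_cost) auto
    finally show "emeasure lebesgue A \<le> (\<Sum>i. ball_cost DIM('a) (C i))" .
  qed
  also have "\<dots> \<le> hausdorff_measure DIM('a) A"
    unfolding hausdorff_measure_def by (intro SUP_upper) auto
  finally show ?thesis .
qed

text \<open>Coverings indexed by an arbitrary countable set, since the Vitali theorems deliver such families.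
  Indices outside the range of the enumeration get the empty set, which costs nothing.\<close>

lemma hausdorff_content_le_countable_cover:
  fixes C :: "'i \<Rightarrow> 'a::metric_space set"
  assumes I: "countable I" and cover: "A \<subseteq> (\<Union>i\<in>I. C i)" and \<delta>: "0 \<le> \<delta>"
    and C: "\<And>i. i \<in> I \<Longrightarrow> bounded (C i) \<and> diameter (C i) \<le> \<delta>"
  shows "hausdorff_content k \<delta> A \<le> (\<integral>\<^sup>+i. ball_cost k (C i) \<partial>count_space I)"
proof -
  let ?J = "to_nat_on I ` I"
  define D where "D n = (if n \<in> ?J then C (from_nat_into I n) else {})" for n
  have D: "D (to_nat_on I i) = C i" if "i \<in> I" for i
    using that I by (auto simp: D_def)
  have "hausdorff_content k \<delta> A \<le> (\<Sum>n. ball_cost k (D n))"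
    unfolding hausdorff_content_ball_cost
  proof (rule INF_lower, clarify, intro conjI allI)
    show "A \<subseteq> (\<Union>n. D n)"
    proof
      fix x assume "x \<in> A"
      then obtain i where "i \<in> I" "x \<in> C i"
        using cover by blast
      then show "x \<in> (\<Union>n. D n)"
        using D by blast
    qed
    show "bounded (D n)" "diameter (D n) \<le> \<delta>" for n
      using C \<delta> I by (auto simp: D_def)
  qed
  also have "\<dots> = (\<integral>\<^sup>+n. ball_cost k (D n) \<partial>count_space UNIV)"
    by (simp add: nn_integral_count_space_nat)
  also have "\<dots> = (\<integral>\<^sup>+n. ball_cost k (D n) \<partial>count_space ?J)"
    by (rule nn_integral_count_space_eq) (auto simp: D_def ball_cost_def)
  also have "\<dots> = (\<integral>\<^sup>+i. ball_cost k (D (to_nat_on I i)) \<partial>count_space I)"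
    using I by (intro nn_integral_bij_count_space[symmetric] inj_on_imp_bij_betw inj_on_to_nat_on)
  also have "\<dots> = (\<integral>\<^sup>+i. ball_cost k (C i) \<partial>count_space I)"
    by (intro nn_integral_cong) (simp add: D)
  finally show ?thesis .
qed

lemma nn_integral_count_space_Plus:
  "(\<integral>\<^sup>+x. f x \<partial>count_space (A <+> B))
    = (\<integral>\<^sup>+x. f (Inl x) \<partial>count_space A) + (\<integral>\<^sup>+x. f (Inr x) \<partial>count_space B)"
proof -
  have "(\<integral>\<^sup>+x. f x \<partial>count_space (A <+> B))
      = (\<integral>\<^sup>+x. f x * indicator (Inl ` A) x + f x * indicator (Inr ` B) x \<partial>count_space UNIV)"
    by (subst nn_integral_count_space_indicator)
      (auto simp: Plus_def intro!: nn_integral_cong split: split_indicator)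
  also have "\<dots> = (\<integral>\<^sup>+x. f x \<partial>count_space (Inl ` A)) + (\<integral>\<^sup>+x. f x \<partial>count_space (Inr ` B))"
    by (subst nn_integral_add) (auto simp: nn_integral_count_space_indicator)
  also have "(\<integral>\<^sup>+x. f x \<partial>count_space (Inl ` A)) = (\<integral>\<^sup>+x. f (Inl x) \<partial>count_space A)"
    by (intro nn_integral_bij_count_space[symmetric] inj_on_imp_bij_betw) auto
  also have "(\<integral>\<^sup>+x. f x \<partial>count_space (Inr ` B)) = (\<integral>\<^sup>+x. f (Inr x) \<partial>count_space B)"
    by (intro nn_integral_bij_count_space[symmetric] inj_on_imp_bij_betw) auto
  finally show ?thesis .
qed

lemma ball_cost_cball:
  fixes x :: "'a::euclidean_space"
  assumes "0 < r" "0 < c"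
  shows "ball_cost DIM('a) (cball x (c * r)) = ennreal (c ^ DIM('a)) * emeasure lebesgue (cball x r)"
proof -
  have "\<not> c * r < 0"
    using assms by (simp add: not_less)
  then show ?thesis
    using assms by (simp add: ball_cost_def emeasure_cball ennreal_mult[symmetric] power_mult_distrib mult_ac)
qed

text \<open>With \<open>c = 1\<close> this bounds the cost of a disjoint packing; \<open>c = 5\<close> is the enlargement in
  Vitali's covering lemma.\<close>

lemma disjoint_cballs_cost_le:
  fixes T :: "'a::euclidean_space set"
  assumes "open T" "countable J" "0 < c"
    and J: "\<And>i. i \<in> J \<Longrightarrow> 0 < snd i \<and> cball (fst i) (snd i) \<subseteq> T"
    and disj: "pairwise (\<lambda>i j. disjnt (cball (fst i) (snd i)) (cball (fst j) (snd j))) J"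
  shows "(\<integral>\<^sup>+i. ball_cost DIM('a) (cball (fst i) (c * snd i)) \<partial>count_space J)
    \<le> ennreal (c ^ DIM('a)) * emeasure lebesgue T"
proof -
  have "(\<integral>\<^sup>+i. ball_cost DIM('a) (cball (fst i) (c * snd i)) \<partial>count_space J)
      = (\<integral>\<^sup>+i. ennreal (c ^ DIM('a)) * emeasure lebesgue (cball (fst i) (snd i)) \<partial>count_space J)"
    using J assms(3) by (intro nn_integral_cong ball_cost_cball) auto
  also have "\<dots> = ennreal (c ^ DIM('a)) * (\<integral>\<^sup>+i. emeasure lebesgue (cball (fst i) (snd i)) \<partial>count_space J)"
    by (rule nn_integral_cmult) simp
  also have "(\<integral>\<^sup>+i. emeasure lebesgue (cball (fst i) (snd i)) \<partial>count_space J)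
      = emeasure lebesgue (\<Union>i\<in>J. cball (fst i) (snd i))"
    using assms(2) disj
    by (intro emeasure_UN_countable[symmetric])
      (simp_all add: disjoint_family_on_def pairwise_def disjnt_def)
  also have "\<dots> \<le> emeasure lebesgue T"
    using J assms(1) by (intro emeasure_mono) auto
  finally show ?thesis
    by (simp add: mult_left_mono)
qed

text \<open>By Vitali's theorem small disjoint balls inside a slightly larger open set cover \<open>A\<close> up to a null
  set \<open>N\<close>, and the cost of a ball is its volume. The null set lies in an open set of tiny volume and is
  covered by five times enlarged disjoint balls of that set.\<close>

lemma hausdorff_content_le_emeasure:
  fixes A :: "'a::euclidean_space set"
  assumes A: "A \<in> sets lebesgue" and \<delta>: "0 < \<delta>"
  shows "hausdorff_content DIM('a) \<delta> A \<le> emeasure lebesgue A"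
proof -
  let ?d = "DIM('a)"
  have "hausdorff_content ?d \<delta> A \<le> emeasure lebesgue A + ennreal e" if e: "e > 0" for e
  proof -
    \<comment> \<open>half of \<open>e\<close> is spent on the open set around \<open>A\<close>, the other half on the enlarged balls\<close>
    define e1 where "e1 = e / (2 * 5 ^ ?d)"
    have e1: "0 < e1" "5 ^ ?d * e1 = e / 2"
      using e by (auto simp: e1_def)
    obtain T where T: "open T" "A \<subseteq> T" "T - A \<in> lmeasurable" "emeasure lebesgue (T - A) < ennreal (e/2)"
      by (rule sets_lebesgue_outer_open[OF A half_gt_zero[OF e]])
    have mT: "emeasure lebesgue T \<le> emeasure lebesgue A + ennreal (e/2)"
    proof -
      have "emeasure lebesgue T = emeasure lebesgue (A \<union> (T - A))"
        using T(2) by (simp add: Un_absorb1)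
      also have "\<dots> \<le> emeasure lebesgue A + emeasure lebesgue (T - A)"
        using A T(1) by (intro emeasure_subadditive) auto
      also have "\<dots> \<le> emeasure lebesgue A + ennreal (e/2)"
        using T(4) by (intro add_left_mono) auto
      finally show ?thesis .
    qed
    define K where "K = {(x::'a, r::real). 0 < r \<and> r \<le> \<delta> / 2 \<and> cball x r \<subseteq> T}"
    have fine: "\<exists>i. i \<in> K \<and> x \<in> cball (fst i) (snd i) \<and> snd i < s" if x: "x \<in> A" and s: "0 < s" for x s
    proof -
      obtain r where r: "r > 0" "cball x r \<subseteq> T"
        using T(1) subsetD[OF T(2) x] unfolding open_contains_cball by blast
      let ?r = "min (min r (\<delta> / 2)) (s / 2)"
      have "cball x ?r \<subseteq> cball x r"
        by (rule subset_cball) simp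
      then have "(x, ?r) \<in> K"
        using r \<delta> s by (auto simp: K_def)
      then show ?thesis
        using r \<delta> s by (intro exI[of _ "(x, ?r)"]) auto
    qed
    obtain J where J: "countable J" "J \<subseteq> K"
      "pairwise (\<lambda>i j. disjnt (cball (fst i) (snd i)) (cball (fst j) (snd j))) J"
      "negligible (A - (\<Union>i\<in>J. cball (fst i) (snd i)))"
    proof (rule Vitali_covering_theorem_cballs[of K snd A fst])
      show "0 < snd i" if "i \<in> K" for i
        using that by (auto simp: K_def)
    qed (use fine in auto)
    let ?N = "A - (\<Union>i\<in>J. cball (fst i) (snd i))"
    have N: "?N \<in> sets lebesgue" "emeasure lebesgue ?N = 0"
      using J(4) by (auto simp: negligible_iff_null_sets)
    obtain W where W: "open W" "?N \<subseteq> W" "W - ?N \<in> lmeasurable" "emeasure lebesgue (W - ?N) < ennreal e1"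
      by (rule sets_lebesgue_outer_open[OF N(1) e1(1)])
    have mW: "emeasure lebesgue W \<le> ennreal e1"
    proof -
      have "emeasure lebesgue W = emeasure lebesgue (?N \<union> (W - ?N))"
        using W(2) by (simp add: Un_absorb1)
      also have "\<dots> \<le> emeasure lebesgue ?N + emeasure lebesgue (W - ?N)"
        using N(1) W(1) by (intro emeasure_subadditive) auto
      finally show ?thesis
        using N(2) W(4) by (simp del: emeasure_completion)
    qed
    \<comment> \<open>radius at most \<open>\<delta> / 10\<close>, as the five times enlarged balls must have diameter at most \<open>\<delta>\<close>\<close>
    define L where "L = {(x::'a, r::real). 0 < r \<and> r \<le> \<delta> / 10 \<and> cball x r \<subseteq> W}"
    have cover: "?N \<subseteq> (\<Union>i\<in>L. cball (fst i) (snd i))"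
    proof
      fix x assume x: "x \<in> ?N"
      obtain r where r: "r > 0" "cball x r \<subseteq> W"
        using W(1) subsetD[OF W(2) x] unfolding open_contains_cball by blast
      let ?r = "min r (\<delta> / 10)"
      have "cball x ?r \<subseteq> cball x r"
        by (rule subset_cball) simp
      then have "(x, ?r) \<in> L"
        using r \<delta> by (auto simp: L_def)
      then show "x \<in> (\<Union>i\<in>L. cball (fst i) (snd i))"
        using r \<delta> by (intro UN_I[of "(x, ?r)"]) auto
    qed
    obtain M where M: "countable M" "M \<subseteq> L"
      "pairwise (\<lambda>i j. disjnt (cball (fst i) (snd i)) (cball (fst j) (snd j))) M"
      "?N \<subseteq> (\<Union>i\<in>M. cball (fst i) (5 * snd i))"
    proof (rule Vitali_covering_lemma_cballs[OF cover])
      show "0 < snd i \<and> snd i \<le> \<delta> / 10" if "i \<in> L" for i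
        using that by (auto simp: L_def)
    qed
    let ?C = "case_sum (\<lambda>i. cball (fst i) (1 * snd i)) (\<lambda>i. cball (fst i) (5 * snd i))"
    have "hausdorff_content ?d \<delta> A \<le> (\<integral>\<^sup>+i. ball_cost ?d (?C i) \<partial>count_space (J <+> M))"
    proof (rule hausdorff_content_le_countable_cover)
      show "countable (J <+> M)"
        using J(1) M(1) by (simp add: Plus_def)
      show "A \<subseteq> (\<Union>i\<in>J <+> M. ?C i)"
      proof
        fix x assume "x \<in> A"
        then consider i where "i \<in> J" "x \<in> cball (fst i) (snd i)"
          | i where "i \<in> M" "x \<in> cball (fst i) (5 * snd i)"
          using M(4) by blast
        then show "x \<in> (\<Union>i\<in>J <+> M. ?C i)"
        proof cases
          case 1
          then show ?thesis by (intro UN_I[of "Inl i"]) auto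
        next
          case 2
          then show ?thesis by (intro UN_I[of "Inr i"]) auto
        qed
      qed
      show "bounded (?C i) \<and> diameter (?C i) \<le> \<delta>" if "i \<in> J <+> M" for i
        using that J(2) M(2) \<delta> by (auto simp: K_def L_def)
    qed (use \<delta> in simp)
    also have "\<dots> = (\<integral>\<^sup>+i. ball_cost ?d (cball (fst i) (1 * snd i)) \<partial>count_space J)
        + (\<integral>\<^sup>+i. ball_cost ?d (cball (fst i) (5 * snd i)) \<partial>count_space M)"
      by (simp only: nn_integral_count_space_Plus sum.case)
    also have "\<dots> \<le> ennreal (1 ^ ?d) * emeasure lebesgue T + ennreal (5 ^ ?d) * emeasure lebesgue W"
    proof (intro add_mono disjoint_cballs_cost_le)
      show "0 < snd i \<and> cball (fst i) (snd i) \<subseteq> T" if "i \<in> J" for i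
        using subsetD[OF J(2) that] by (simp add: K_def split_beta)
      show "0 < snd i \<and> cball (fst i) (snd i) \<subseteq> W" if "i \<in> M" for i
        using subsetD[OF M(2) that] by (simp add: L_def split_beta)
    qed (use T W J M in auto)
    also have "\<dots> \<le> (emeasure lebesgue A + ennreal (e/2)) + ennreal (5 ^ ?d) * ennreal e1"
      using mT mW by (intro add_mono mult_left_mono) auto
    also have "ennreal (5 ^ ?d) * ennreal e1 = ennreal (e/2)"
      using e1 by (subst ennreal_mult[symmetric]) auto
    also have "(emeasure lebesgue A + ennreal (e/2)) + ennreal (e/2) = emeasure lebesgue A + ennreal e"
      using e by (simp add: add.assoc ennreal_plus[symmetric] del: ennreal_plus)
    finally show ?thesis .
  qed
  then show ?thesis
    by (rule ennreal_le_epsilon)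
qed

theorem hausdorff_measure_eq_lebesgue:
  fixes A :: "'a::euclidean_space set"
  assumes "A \<in> sets lebesgue"
  shows "hausdorff_measure DIM('a) A = emeasure lebesgue A"
proof (rule antisym)
  show "hausdorff_measure DIM('a) A \<le> emeasure lebesgue A"
    unfolding hausdorff_measure_def
  proof (rule SUP_least)
    show "hausdorff_content DIM('a) \<delta> A \<le> emeasure lebesgue A" if "\<delta> \<in> {0<..}" for \<delta>
      using that by (intro hausdorff_content_le_emeasure[OF assms]) simp
  qed
qed (rule emeasure_le_hausdorff_measure[OF assms])

lemma diameter_image_le:
  fixes f :: "'a::metric_space \<Rightarrow> 'b::metric_space"
  assumes "bounded X" "\<And>x y. x \<in> X \<Longrightarrow> y \<in> X \<Longrightarrow> dist (f x) (f y) \<le> dist x y"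
  shows "diameter (f ` X) \<le> diameter X"
proof (cases "X = {}")
  case False
  have "(SUP (x,y) \<in> f ` X \<times> f ` X. dist x y) \<le> diameter X"
  proof (rule cSUP_least, use False in simp, clarsimp)
    fix x y assume xy: "x \<in> X" "y \<in> X"
    show "dist (f x) (f y) \<le> diameter X"
      by (rule order_trans[OF assms(2)[OF xy] diameter_bounded_bound[OF assms(1) xy]])
  qed
  then show ?thesis
    using False by (simp add: diameter_def)
qed simp

text \<open>A covering of \<open>A\<close> restricts to \<open>A\<close> and is then carried along by \<open>f\<close>, which decreases diameters.\<close>

lemma hausdorff_measure_image_le:
  fixes f :: "'a::metric_space \<Rightarrow> 'b::metric_space"
  assumes f: "\<And>x y. x \<in> A \<Longrightarrow> y \<in> A \<Longrightarrow> dist (f x) (f y) \<le> dist x y"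
  shows "hausdorff_measure k (f ` A) \<le> hausdorff_measure k A"
proof -
  have "hausdorff_content k \<delta> (f ` A) \<le> hausdorff_content k \<delta> A" for \<delta>
    unfolding hausdorff_content_ball_cost
  proof (rule INF_greatest, clarify)
    fix C :: "nat \<Rightarrow> 'a set"
    assume C: "A \<subseteq> (\<Union>i. C i)" "\<forall>i. bounded (C i) \<and> diameter (C i) \<le> \<delta>"
    let ?D = "\<lambda>i. f ` (C i \<inter> A)"
    have bd: "bounded (C i \<inter> A)" for i
      using C(2) by (auto intro: bounded_subset)
    have "bounded (f ` (C i \<inter> A))" for i
    proof -
      obtain x e where "\<forall>y\<in>C i \<inter> A. dist x y \<le> e" and "x \<in> C i \<inter> A \<or> C i \<inter> A = {}"
        using bd[of i] bounded_any_center by (metis all_not_in_conv bounded_def)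
      then show ?thesis
        using f unfolding bounded_def by (intro exI[of _ "f x"] exI[of _ e]) force
    qed
    have diam: "diameter (?D i) \<le> diameter (C i)" for i
      using diameter_image_le[OF bd[of i], of f] f diameter_subset[of "C i \<inter> A" "C i"] C(2) by force
    have "(INF C\<in>{C :: nat \<Rightarrow> 'b set. f ` A \<subseteq> (\<Union>i. C i) \<and> (\<forall>i. bounded (C i) \<and> diameter (C i) \<le> \<delta>)}.
        \<Sum>i. ball_cost k (C i)) \<le> (\<Sum>i. ball_cost k (?D i))"
    proof (rule INF_lower, clarify, intro conjI allI)
      show "f ` A \<subseteq> (\<Union>i. ?D i)"
        using C(1) by blast
      show "bounded (?D i)" for i by fact
      show "diameter (?D i) \<le> \<delta>" for i
        using diam[of i] C(2) by (meson order_trans)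
    qed
    also have "\<dots> \<le> (\<Sum>i. ball_cost k (C i))"
    proof (rule suminf_le)
      fix i
      have "0 \<le> diameter (?D i)"
        by (rule diameter_ge_0) fact
      then show "ball_cost k (?D i) \<le> ball_cost k (C i)"
        using diam[of i] by (auto simp: ball_cost_def intro!: ennreal_leI mult_left_mono power_mono)
    qed auto
    finally show "(INF C\<in>{C :: nat \<Rightarrow> 'b set. f ` A \<subseteq> (\<Union>i. C i) \<and> (\<forall>i. bounded (C i) \<and> diameter (C i) \<le> \<delta>)}.
        \<Sum>i. ball_cost k (C i)) \<le> (\<Sum>i. ball_cost k (C i))" .
  qed
  then show ?thesis
    unfolding hausdorff_measure_def by (intro SUP_mono) blast
qed

lemma hausdorff_measure_isometric_image:
  fixes f :: "'a::metric_space \<Rightarrow> 'b::metric_space"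
  assumes f: "\<And>x y. x \<in> A \<Longrightarrow> y \<in> A \<Longrightarrow> dist (f x) (f y) = dist x y"
  shows "hausdorff_measure k (f ` A) = hausdorff_measure k A"
proof (rule antisym)
  show "hausdorff_measure k (f ` A) \<le> hausdorff_measure k A"
    by (rule hausdorff_measure_image_le) (simp add: f)
  have inj: "inj_on f A"
    using f by (metis dist_eq_0_iff inj_onI)
  have "hausdorff_measure k (inv_into A f ` f ` A) \<le> hausdorff_measure k (f ` A)"
    by (rule hausdorff_measure_image_le) (use f inj in \<open>auto simp: inv_into_f_f\<close>)
  then show "hausdorff_measure k A \<le> hausdorff_measure k (f ` A)"
    using inj by (simp add: inv_into_image_cancel)
qed

text \<open>Volume is determined by the metric alone, being a Hausdorff measure. In particular it is invariant
  under rotations and under isometries between different Euclidean spaces of the same dimension.\<close>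

lemma emeasure_isometric_image:
  fixes f :: "'a::euclidean_space \<Rightarrow> 'b::euclidean_space"
  assumes "DIM('a) = DIM('b)" "\<And>x y. dist (f x) (f y) = dist x y" "compact K"
  shows "emeasure lebesgue (f ` K) = emeasure lebesgue K"
proof -
  have "continuous_on K f"
    using assms(2) by (force simp: continuous_on_iff)
  then have "compact (f ` K)"
    using assms(3) by (rule compact_continuous_image)
  then have sets: "f ` K \<in> sets lebesgue" "K \<in> sets lebesgue"
    using assms(3) by (auto intro: lmeasurable_compact fmeasurableD)
  have "emeasure lebesgue (f ` K) = hausdorff_measure DIM('b) (f ` K)"
    by (rule hausdorff_measure_eq_lebesgue[OF sets(1), symmetric])
  also have "\<dots> = hausdorff_measure DIM('a) K"
    using assms(1,2) by (simp add: hausdorff_measure_isometric_image)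
  also have "\<dots> = emeasure lebesgue K"
    by (rule hausdorff_measure_eq_lebesgue[OF sets(2)])
  finally show ?thesis .
qed

section \<open>Prisms and pyramids over subsets of a hyperplane\<close>

text \<open>An index type with \<open>DIM('a) - 1\<close> elements, so that \<open>real ^ 'a hyperplane_index\<close> serves as the
  model of a hyperplane of \<open>'a\<close>. In dimension 1, where no Euclidean space is a model of a hyperplane,
  the default is the whole basis, since types are nonempty.\<close>

typedef (overloaded) ('a::euclidean_space) hyperplane_index =
  "{i :: 'a. i \<in> Basis \<and> (DIM('a) = 1 \<or> i \<noteq> (SOME b. b \<in> Basis))}"
proof -
  have "\<exists>i::'a. i \<in> Basis \<and> i \<noteq> b" if "DIM('a) \<noteq> 1" for b
  proof (rule ccontr)
    assume "\<nexists>i::'a. i \<in> Basis \<and> i \<noteq> b"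
    then have "Basis = {b}"
      using nonempty_Basis by blast
    then have "DIM('a) = card {b}"
      by (rule arg_cong)
    then show False
      using that by simp
  qed
  then show ?thesis
    using nonempty_Basis by blast
qed

lemma bij_betw_Rep_hyperplane_index:
  "bij_betw Rep_hyperplane_index UNIV
    {i :: 'a::euclidean_space. i \<in> Basis \<and> (DIM('a) = 1 \<or> i \<noteq> (SOME b. b \<in> Basis))}"
  unfolding bij_betw_def
proof
  show "inj (Rep_hyperplane_index :: 'a hyperplane_index \<Rightarrow> 'a)"
    by (rule injI) (simp add: Rep_hyperplane_index_inject)
qed (rule type_definition.Rep_range[OF type_definition_hyperplane_index])

instance hyperplane_index :: (euclidean_space) finite
proof
  show "finite (UNIV :: 'a hyperplane_index set)"
    using bij_betw_finite[OF bij_betw_Rep_hyperplane_index] by simp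
qed

lemma card_hyperplane_index:
  assumes "DIM('a::euclidean_space) \<noteq> 1"
  shows "CARD('a hyperplane_index) = DIM('a) - 1"
proof -
  have "(SOME b::'a. b \<in> Basis) \<in> Basis"
    using nonempty_Basis by (rule some_in_eq[THEN iffD2])
  moreover have "{i::'a. i \<in> Basis \<and> (DIM('a) = 1 \<or> i \<noteq> (SOME b. b \<in> Basis))} = Basis - {SOME b. b \<in> Basis}"
    using assms by auto
  ultimately show ?thesis
    using bij_betw_same_card[OF bij_betw_Rep_hyperplane_index[where 'a='a]]
    by (simp add: card_Diff_singleton)
qed

text \<open>Used for unit vectors \<open>u\<close> and sets \<open>S\<close> in a hyperplane orthogonal to \<open>u\<close>.\<close>

definition cylinder :: "'a::real_vector \<Rightarrow> 'a set \<Rightarrow> real \<Rightarrow> 'a set" where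
  "cylinder u S h = (\<lambda>(x, s). x + s *\<^sub>R u) ` (S \<times> {0..h})"

definition pyramid :: "'a::real_vector set \<Rightarrow> 'a set" where
  "pyramid S = (\<lambda>(t, x). t *\<^sub>R x) ` ({0..1} \<times> S)"

text \<open>For \<open>S\<close> in a hyperplane orthogonal to the unit vector \<open>u\<close> this is its volume in dimension
  \<open>DIM('a) - 1\<close>. Expressing it as a volume in the ambient space treats dimension 1, where the facets
  are points of area 1, like every other dimension.\<close>

definition facet_area :: "'a::euclidean_space \<Rightarrow> 'a set \<Rightarrow> real" where
  "facet_area u S = measure lebesgue (cylinder u S 1)"

lemma compact_cylinder: "compact S \<Longrightarrow> compact (cylinder u S h)" for u :: "'a::real_normed_vector"
  unfolding cylinder_def split_beta
  by (intro compact_continuous_image compact_Times continuous_intros) auto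

lemma compact_pyramid: "compact S \<Longrightarrow> compact (pyramid S)" for S :: "'a::real_normed_vector set"
  unfolding pyramid_def split_beta
  by (intro compact_continuous_image compact_Times continuous_intros) auto

lemma emeasure_lebesgue_compact:
  "compact K \<Longrightarrow> emeasure lebesgue K = emeasure lborel K" for K :: "'a::euclidean_space set"
  by (simp add: compact_imp_closed)

lemma hausdorff_measure_0_singleton: "hausdorff_measure 0 {x} = 1"
proof -
  have content: "hausdorff_content 0 \<delta> {x} = 1" if "\<delta> > 0" for \<delta>
  proof (rule antisym)
    have "hausdorff_content 0 \<delta> {x} \<le> (\<integral>\<^sup>+i. ball_cost 0 {x} \<partial>count_space {()})"
      using that by (intro hausdorff_content_le_countable_cover) auto
    also have "\<dots> = 1"
      by (simp add: nn_integral_count_space_finite ball_cost_def)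
    finally show "hausdorff_content 0 \<delta> {x} \<le> 1" .
    show "1 \<le> hausdorff_content 0 \<delta> {x}"
      unfolding hausdorff_content_ball_cost
    proof (rule INF_greatest, clarify)
      fix C :: "nat \<Rightarrow> 'a set"
      assume "{x} \<subseteq> (\<Union>i. C i)"
      then obtain i where "C i \<noteq> {}" by blast
      then have "1 = (\<Sum>i\<in>{i}. ball_cost 0 (C i))"
        by (simp add: ball_cost_def)
      also have "\<dots> \<le> (\<Sum>i. ball_cost 0 (C i))"
        by (intro sum_le_suminf) auto
      finally show "1 \<le> (\<Sum>i. ball_cost 0 (C i))" .
    qed
  qed
  show ?thesis
    unfolding hausdorff_measure_def
  proof (rule antisym)
    show "(SUP \<delta>\<in>{0<..}. hausdorff_content 0 \<delta> {x}) \<le> 1"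
      by (rule SUP_least) (simp add: content)
    show "1 \<le> (SUP \<delta>\<in>{0<..}. hausdorff_content 0 \<delta> {x})"
      using content[of 1] by (intro SUP_upper2[of 1]) auto
  qed
qed

lemma hausdorff_measure_empty: "hausdorff_measure k {} = 0"
proof -
  have "hausdorff_content k \<delta> ({}::'a set) \<le> (\<integral>\<^sup>+i. ball_cost k ({}::'a set) \<partial>count_space ({}::unit set))"
    if "\<delta> > 0" for \<delta>
    using that by (intro hausdorff_content_le_countable_cover) auto
  then show ?thesis
    unfolding hausdorff_measure_def
    by (intro antisym SUP_least) (auto simp: nn_integral_count_space_finite)
qed

text \<open>Fubini's theorem: the slice at height \<open>s\<close> is the dilation of the base by \<open>s / k\<close>.\<close>

lemma measure_pyramid_product:
  fixes S :: "'b::euclidean_space set"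
  assumes S: "compact S" and k: "k > 0"
  shows "measure lebesgue ((\<lambda>(t, y). (t *\<^sub>R y, t * k)) ` ({0..1} \<times> S))
    = k * measure lebesgue S / real (Suc DIM('b))"
proof -
  let ?n = "DIM('b)"
  define X where "X = (\<lambda>(t, y). (t *\<^sub>R y, t * k)) ` ({0..1} \<times> S)"
  define m where "m = measure lebesgue S"
  have X: "compact X"
    unfolding X_def split_beta using S
    by (intro compact_continuous_image compact_Times continuous_intros) auto
  have slice: "emeasure lborel ((\<lambda>y. (y, s)) -` X) = ennreal ((s / k) ^ ?n * m) * indicator {0..k} s" for s
  proof (cases "0 \<le> s \<and> s \<le> k")
    case True
    have "(\<lambda>y. (y, s)) -` X = (\<lambda>y. (s / k) *\<^sub>R y) ` S"
    proof (intro subset_antisym subsetI)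
      fix y assume "y \<in> (\<lambda>y. (y, s)) -` X"
      then obtain t z where "z \<in> S" "y = t *\<^sub>R z" "s = t * k"
        by (auto simp: X_def)
      then show "y \<in> (\<lambda>y. (s / k) *\<^sub>R y) ` S"
        using k by auto
    next
      fix y assume "y \<in> (\<lambda>y. (s / k) *\<^sub>R y) ` S"
      then obtain z where "z \<in> S" "y = (s / k) *\<^sub>R z" by blast
      then show "y \<in> (\<lambda>y. (y, s)) -` X"
        using k True by (auto simp: X_def image_iff intro!: bexI[of _ "(s / k, z)"])
    qed
    moreover have "compact ((\<lambda>y. (s / k) *\<^sub>R y) ` S)"
      by (rule compact_scaling[OF S])
    ultimately have "emeasure lborel ((\<lambda>y. (y, s)) -` X) = ennreal (measure lebesgue ((\<lambda>y. (s / k) *\<^sub>R y) ` S))"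
      by (metis emeasure_lebesgue_compact emeasure_eq_measure2 lmeasurable_compact)
    also have "measure lebesgue ((\<lambda>y. (s / k) *\<^sub>R y) ` S) = (s / k) ^ ?n * m"
      using measure_lebesgue_affine[of "s / k" 0 S] True k by (simp add: m_def)
    finally show ?thesis
      using True by simp
  next
    case False
    then have "(\<lambda>y. (y, s)) -` X = {}"
      using k by (auto simp: X_def mult_le_cancel_right1 mult_left_le_one_le)
    then show ?thesis
      using False by simp
  qed
  have deriv: "DERIV (\<lambda>s. k * m / Suc ?n * (s / k) ^ Suc ?n) s :> (s / k) ^ ?n * m" for s
  proof -
    have "DERIV (\<lambda>s. s / k) s :> 1 / k"
      using k by (auto intro!: derivative_eq_intros)
    then have "DERIV (\<lambda>s. (s / k) ^ Suc ?n) s :> (1 + real ?n) * (1 / k * (s / k) ^ ?n)"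
      by (rule DERIV_power_Suc)
    then have "DERIV (\<lambda>s. k * m / Suc ?n * (s / k) ^ Suc ?n) s
        :> k * m / Suc ?n * ((1 + real ?n) * (1 / k * (s / k) ^ ?n))"
      by (rule DERIV_cmult)
    moreover have "k * m / Suc ?n * ((1 + real ?n) * (1 / k * (s / k) ^ ?n)) = (s / k) ^ ?n * m"
      using k by (simp add: divide_simps)
    ultimately show ?thesis
      by (simp only:)
  qed
  have nonneg: "0 \<le> (s / k) ^ ?n * m" if "0 \<le> s" for s
    using that k by (simp add: m_def)
  have "emeasure lborel X = emeasure (lborel \<Otimes>\<^sub>M lborel) X"
    by (simp add: lborel_prod)
  also have "\<dots> = (\<integral>\<^sup>+s. emeasure lborel ((\<lambda>y. (y, s)) -` X) \<partial>lborel)"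
    using X by (intro lborel_pair.emeasure_pair_measure_alt2, subst lborel_prod) (simp add: compact_imp_closed)
  also have "\<dots> = (\<integral>\<^sup>+s. ennreal ((s / k) ^ ?n * m) * indicator {0..k} s \<partial>lborel)"
    by (simp only: slice)
  also have "\<dots> = ennreal (k * m / Suc ?n * (k / k) ^ Suc ?n - k * m / Suc ?n * (0 / k) ^ Suc ?n)"
    using k nonneg by (intro nn_integral_FTC_Icc deriv) auto
  also have "\<dots> = ennreal (k * m / Suc ?n)"
    using k by simp
  finally have "emeasure lebesgue X = ennreal (k * m / Suc ?n)"
    using X by (simp add: emeasure_lebesgue_compact)
  then show ?thesis
    unfolding X_def m_def using k by (intro measure_eq_emeasure_eq_ennreal) auto
qed

lemma hyperplane_coordinates:
  fixes u :: "'a::euclidean_space"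
  assumes u: "norm u = 1" and d: "DIM('a) \<noteq> 1"
  obtains E :: "real ^ 'a hyperplane_index \<Rightarrow> 'a" and G
    where "linear E" "linear G" "\<And>y. norm (E y) = norm y" "\<And>y. u \<bullet> E y = 0" "\<And>y. G (E y) = y"
      "\<And>x. u \<bullet> x = 0 \<Longrightarrow> E (G x) = x"
proof -
  have dim: "dim (UNIV :: (real ^ 'a hyperplane_index) set) = dim {x. u \<bullet> x = 0}"
    using u d by (subst dim_hyperplane) (auto simp: card_hyperplane_index)
  show thesis
  proof (rule isometries_subspaces[OF subspace_UNIV subspace_hyperplane dim])
    fix E :: "real ^ 'a hyperplane_index \<Rightarrow> 'a" and G
    assume "linear E" "linear G" and range: "range E = {x. u \<bullet> x = 0}"
      and "\<And>y. y \<in> UNIV \<Longrightarrow> norm (E y) = norm y" "\<And>y. y \<in> UNIV \<Longrightarrow> G (E y) = y"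
        "\<And>x. x \<in> {x. u \<bullet> x = 0} \<Longrightarrow> E (G x) = x"
    moreover have "u \<bullet> E y = 0" for y
      using range by auto
    ultimately show thesis
      by (intro that[of E G]) auto
  qed
qed

text \<open>In an orthonormal frame adapted to \<open>u\<close> the base is \<open>T \<times> {k}\<close> with \<open>T\<close> in the model of the
  hyperplane; the common value \<open>m\<close> is the Lebesgue measure of \<open>T\<close>. In dimension 1 the base is empty or
  a single point.\<close>

lemma hyperplane_slice_measures:
  fixes u :: "'a::euclidean_space"
  assumes u: "norm u = 1" and S: "compact S" and plane: "\<And>x. x \<in> S \<Longrightarrow> u \<bullet> x = k"
  shows "\<exists>m. (\<forall>h\<ge>0. measure lebesgue (cylinder u S h) = h * m) \<and>
    (k > 0 \<longrightarrow> measure lebesgue (pyramid S) = k * m / real DIM('a)) \<and>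
    hausdorff_measure (DIM('a) - 1) S = ennreal m"
proof (cases "DIM('a) = 1")
  case True
  have "dim {x. u \<bullet> x = 0} = 0"
    using u True by (subst dim_hyperplane) auto
  then have zero: "x = 0" if "u \<bullet> x = 0" for x
    using that by (auto simp: dim_eq_0)
  have uu: "u \<bullet> u = 1"
    using u by (simp add: norm_eq_1)
  have "x = k *\<^sub>R u" if "x \<in> S" for x
    using zero[of "x - k *\<^sub>R u"] plane[OF that] uu by (simp add: inner_diff_right)
  then consider "S = {}" | "S = {k *\<^sub>R u}"
    by blast
  then show ?thesis
  proof cases
    case 1
    then show ?thesis
      by (intro exI[of _ 0]) (auto simp: cylinder_def pyramid_def hausdorff_measure_empty)
  next
    case 2
    have segment: "measure lebesgue ((\<lambda>s. s *\<^sub>R u) ` {a..b}) = b - a" if "a \<le> b" for a b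
    proof -
      have "emeasure lebesgue ((\<lambda>s. s *\<^sub>R u) ` {a..b}) = emeasure lebesgue {a..b}"
        using True u
        by (intro emeasure_isometric_image) (auto simp: dist_norm simp flip: scaleR_diff_left)
      then show ?thesis
        using that by (simp add: measure_def)
    qed
    have "cylinder u S h = (\<lambda>s. s *\<^sub>R u) ` {k..k+h}" if "h \<ge> 0" for h
    proof -
      have "cylinder u S h = (\<lambda>s. (k + s) *\<^sub>R u) ` {0..h}"
      proof -
        have "{k *\<^sub>R u} \<times> {0..h} = Pair (k *\<^sub>R u) ` {0..h}"
          by auto
        then show ?thesis
          by (simp add: cylinder_def 2 image_image scaleR_add_left)
      qed
      also have "\<dots> = (\<lambda>s. s *\<^sub>R u) ` ((+) k ` {0..h})"
        by (simp only: image_image)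
      finally show ?thesis by (simp add: add.commute)
    qed
    moreover have "pyramid S = (\<lambda>s. s *\<^sub>R u) ` {0..k}" if "k > 0"
    proof -
      have "pyramid S = (\<lambda>s. (s * k) *\<^sub>R u) ` {0..1}"
      proof -
        have eq: "{0..1} \<times> {k *\<^sub>R u} = (\<lambda>s. (s, k *\<^sub>R u)) ` {0..1::real}"
          by auto
        show ?thesis
          unfolding pyramid_def 2 eq image_image by simp
      qed
      also have "\<dots> = (\<lambda>s. s *\<^sub>R u) ` ((\<lambda>s. s * k) ` {0..1})"
        by (simp only: image_image)
      also have "(\<lambda>s. s * k) ` {0..1} = {0..k}"
        using image_mult_atLeastAtMost[OF that, of 0 1] by (simp add: mult.commute)
      finally show ?thesis .
    qed
    ultimately show ?thesis
      using segment True 2 by (intro exI[of _ 1]) (auto simp: hausdorff_measure_0_singleton)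
  qed
next
  case False
  obtain E :: "real ^ 'a hyperplane_index \<Rightarrow> 'a" and G
    where EG: "linear E" "linear G" "\<And>y. norm (E y) = norm y" "\<And>y. u \<bullet> E y = 0" "\<And>y. G (E y) = y"
      "\<And>x. u \<bullet> x = 0 \<Longrightarrow> E (G x) = x"
    by (rule hyperplane_coordinates[OF u False]) (rule that)
  have uu: "u \<bullet> u = 1"
    using u by (simp add: norm_eq_1)
  have card: "CARD('a hyperplane_index) = DIM('a) - 1" "DIM('a) \<ge> 2"
    using card_hyperplane_index[OF False] False DIM_positive[where 'a='a] by linarith+
  define T where "T = (\<lambda>x. G (x - k *\<^sub>R u)) ` S"
  have T: "compact T"
    unfolding T_def using S EG(2)
    by (intro compact_continuous_image continuous_intros linear_continuous_on_compose[of _ _ G])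
  have S_eq: "S = (\<lambda>y. E y + k *\<^sub>R u) ` T"
  proof -
    have "E (G (x - k *\<^sub>R u)) + k *\<^sub>R u = x" if "x \<in> S" for x
      using EG(6)[of "x - k *\<^sub>R u"] plane[OF that] uu by (simp add: inner_diff_right)
    then show ?thesis
      by (force simp: T_def image_image)
  qed
  \<comment> \<open>the isometry that straightens the hyperplanes orthogonal to \<open>u\<close>\<close>
  define J where "J = (\<lambda>(y, s). E y + s *\<^sub>R u)"
  have J: "dist (J p) (J q) = dist p q" for p q
  proof -
    have "norm (J (p - q)) ^ 2 = norm (p - q) ^ 2"
    proof -
      obtain y s where p: "p - q = (y, s)" by fastforce
      have "norm (E y + s *\<^sub>R u) ^ 2 = norm (E y) ^ 2 + s ^ 2"
        unfolding power2_norm_eq_inner using EG(4)[of y] uu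
        by (simp add: inner_add_left inner_add_right inner_commute power2_eq_square)
      then show ?thesis
        by (simp add: p J_def norm_Pair EG(3))
    qed
    then have "norm (J (p - q)) = norm (p - q)"
      by simp
    moreover have "J (p - q) = J p - J q"
      by (simp add: J_def split_beta linear_diff[OF EG(1)] algebra_simps)
    ultimately show ?thesis
      by (simp add: dist_norm)
  qed
  have J_measure: "measure lebesgue (J ` K) = measure lebesgue K" if "compact K" for K
    using emeasure_isometric_image[OF _ J that] card by (simp add: measure_def)
  define m where "m = measure lebesgue T"
  have "measure lebesgue (cylinder u S h) = h * m" if "h \<ge> 0" for h
  proof -
    have "cylinder u S h = J ` (T \<times> {k..k+h})"
    proof (intro subset_antisym subsetI)
      fix x assume "x \<in> cylinder u S h"
      then obtain y s where "y \<in> T" "0 \<le> s" "s \<le> h" "x = E y + k *\<^sub>R u + s *\<^sub>R u"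
        by (auto simp: cylinder_def S_eq)
      then show "x \<in> J ` (T \<times> {k..k+h})"
        by (intro image_eqI[of _ _ "(y, k + s)"]) (auto simp: J_def algebra_simps)
    next
      fix x assume "x \<in> J ` (T \<times> {k..k+h})"
      then obtain y s where "y \<in> T" "k \<le> s" "s \<le> k + h" "x = E y + s *\<^sub>R u"
        by (auto simp: J_def)
      then show "x \<in> cylinder u S h"
        unfolding cylinder_def S_eq
        by (intro image_eqI[of _ _ "(E y + k *\<^sub>R u, s - k)"]) (auto simp: algebra_simps)
    qed
    moreover have "measure lebesgue (T \<times> {k..k+h}) = h * m"
    proof -
      have "emeasure lborel (T \<times> {k..k+h}) = emeasure (lborel \<Otimes>\<^sub>M lborel) (T \<times> {k..k+h})"
        by (simp add: lborel_prod)
      also have "\<dots> = emeasure lborel T * emeasure lborel {k..k+h}"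
        using T by (intro lborel.emeasure_pair_measure_Times) (auto simp: compact_imp_closed)
      also have "\<dots> = ennreal m * ennreal h"
        using T that
        by (simp add: m_def emeasure_lebesgue_compact[symmetric] emeasure_eq_measure2 lmeasurable_compact del: emeasure_completion)
      also have "\<dots> = ennreal (h * m)"
        using that by (simp add: ennreal_mult mult.commute m_def)
      finally have "measure lborel (T \<times> {k..k+h}) = h * m"
        using that by (intro measure_eq_emeasure_eq_ennreal) (auto simp: m_def)
      then show ?thesis
        using T by (simp add: measure_lebesgue_compact compact_Times)
    qed
    ultimately show ?thesis
      using J_measure[of "T \<times> {k..k+h}"] T by (simp add: compact_Times)
  qed
  moreover have "measure lebesgue (pyramid S) = k * m / real DIM('a)" if "k > 0"
  proof -
    let ?X = "(\<lambda>(t, y). (t *\<^sub>R y, t * k)) ` ({0..1} \<times> T)"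
    have "pyramid S = J ` ?X"
      by (force simp: pyramid_def S_eq J_def image_iff linear_scale[OF EG(1)] scaleR_add_right)
    moreover have "compact ?X"
      unfolding split_beta using T
      by (intro compact_continuous_image compact_Times continuous_intros) auto
    ultimately show ?thesis
      using J_measure[of ?X] measure_pyramid_product[OF T that] card by (simp add: m_def)
  qed
  moreover have "hausdorff_measure (DIM('a) - 1) S = ennreal m"
  proof -
    have "hausdorff_measure (DIM('a) - 1) S = hausdorff_measure DIM(real ^ 'a hyperplane_index) T"
      unfolding S_eq using card EG(1,3)
      by (subst hausdorff_measure_isometric_image) (auto simp: dist_norm simp flip: linear_diff)
    also have "\<dots> = emeasure lebesgue T"
      using T by (intro hausdorff_measure_eq_lebesgue) (simp add: lmeasurable_compact fmeasurableD)
    finally show ?thesis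
      using T by (simp add: m_def emeasure_eq_measure2 lmeasurable_compact del: emeasure_completion)
  qed
  ultimately show ?thesis
    by blast
qed

lemma
  fixes u :: "'a::euclidean_space"
  assumes u: "norm u = 1" and S: "compact S" and plane: "\<And>x. x \<in> S \<Longrightarrow> u \<bullet> x = k"
  shows measure_cylinder: "0 \<le> h \<Longrightarrow> measure lebesgue (cylinder u S h) = h * facet_area u S"
    and measure_pyramid: "0 < k \<Longrightarrow> measure lebesgue (pyramid S) = k * facet_area u S / real DIM('a)"
    and hausdorff_measure_facet: "hausdorff_measure (DIM('a) - 1) S = ennreal (facet_area u S)"
proof -
  obtain m where m: "\<forall>h\<ge>0. measure lebesgue (cylinder u S h) = h * m"
    "k > 0 \<longrightarrow> measure lebesgue (pyramid S) = k * m / real DIM('a)"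
    "hausdorff_measure (DIM('a) - 1) S = ennreal m"
    using hyperplane_slice_measures[OF assms] by blast
  have "m = facet_area u S"
    using m(1) by (simp add: facet_area_def)
  with m show "0 \<le> h \<Longrightarrow> measure lebesgue (cylinder u S h) = h * facet_area u S"
    "0 < k \<Longrightarrow> measure lebesgue (pyramid S) = k * facet_area u S / real DIM('a)"
    "hausdorff_measure (DIM('a) - 1) S = ennreal (facet_area u S)"
    by auto
qed

text \<open>The slab projects orthogonally into the supporting hyperplane, so it lies in the cylinder of height
  \<open>h\<close> below its shadow \<open>?T h\<close>. As \<open>h\<close> decreases to 0 the shadows decrease to the face, hence their
  areas tend to the area of the face.\<close>

lemma slab_measure_near_face:
  fixes Q :: "'a::euclidean_space set"
  assumes u: "norm u = 1" and Q: "compact Q" and below: "\<And>x. x \<in> Q \<Longrightarrow> u \<bullet> x \<le> k" and e: "e > 0"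
  shows "\<exists>\<delta>>0. \<forall>h. 0 \<le> h \<longrightarrow> h \<le> \<delta> \<longrightarrow>
    measure lebesgue {x \<in> Q. k - h \<le> u \<bullet> x} \<le> h * (facet_area u {x \<in> Q. u \<bullet> x = k} + e)"
proof -
  have uu: "u \<bullet> u = 1"
    using u by (simp add: norm_eq_1)
  define slab where "slab h = {x \<in> Q. k - h \<le> u \<bullet> x}" for h
  define \<pi> where "\<pi> x = x + (k - u \<bullet> x) *\<^sub>R u" for x
  let ?T = "\<lambda>h. \<pi> ` slab h" and ?F = "{x \<in> Q. u \<bullet> x = k}"
  have slab: "compact (slab h)" for h
  proof -
    have "slab h = Q \<inter> {x. u \<bullet> x \<ge> k - h}"
      by (auto simp: slab_def)
    then show ?thesis
      using Q by (simp add: compact_Int_closed closed_halfspace_ge)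
  qed
  have T: "compact (?T h)" for h
    unfolding \<pi>_def by (intro compact_continuous_image continuous_intros slab)
  have \<pi>: "u \<bullet> \<pi> x = k" for x
    using uu by (simp add: \<pi>_def inner_add_right)
  have bound: "measure lebesgue (slab h) \<le> h * facet_area u (?T h)" if "h \<ge> 0" for h
  proof -
    have "slab h \<subseteq> (+) (- h *\<^sub>R u) ` cylinder u (?T h) h"
    proof
      fix x assume x: "x \<in> slab h"
      then have "\<pi> x + (h - (k - u \<bullet> x)) *\<^sub>R u \<in> cylinder u (?T h) h"
        using below[of x] unfolding cylinder_def
        by (intro image_eqI[of _ _ "(\<pi> x, h - (k - u \<bullet> x))"]) (auto simp: slab_def)
      moreover have "x = - h *\<^sub>R u + (\<pi> x + (h - (k - u \<bullet> x)) *\<^sub>R u)"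
        by (simp add: \<pi>_def algebra_simps)
      ultimately show "x \<in> (+) (- h *\<^sub>R u) ` cylinder u (?T h) h"
        by (metis imageI)
    qed
    then have "measure lebesgue (slab h) \<le> measure lebesgue ((+) (- h *\<^sub>R u) ` cylinder u (?T h) h)"
    proof (rule measure_mono_fmeasurable)
      show "slab h \<in> sets lebesgue"
        by (intro fmeasurableD lmeasurable_compact slab)
      show "(+) (- h *\<^sub>R u) ` cylinder u (?T h) h \<in> lmeasurable"
        by (intro lmeasurable_compact compact_translation compact_cylinder T)
    qed
    also have "\<dots> = measure lebesgue (cylinder u (?T h) h)"
      by (rule measure_translation)
    also have "\<dots> = h * facet_area u (?T h)"
      using that T \<pi> by (intro measure_cylinder[OF u]) auto
    finally show ?thesis .
  qed
  let ?h = "\<lambda>n. 1 / real (Suc n)"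
  have Inter: "(\<Inter>n. cylinder u (?T (?h n)) 1) = cylinder u ?F 1"
  proof (intro subset_antisym subsetI)
    fix z assume "z \<in> (\<Inter>n. cylinder u (?T (?h n)) 1)"
    then have z: "z \<in> cylinder u (?T (?h n)) 1" for n
      by blast
    define s where "s = u \<bullet> z - k"
    define y where "y = z - s *\<^sub>R u"
    have near: "0 \<le> s \<and> s \<le> 1 \<and> (\<exists>x\<in>Q. dist x y \<le> ?h n)" for n
    proof -
      obtain x s' where x: "x \<in> slab (?h n)" "0 \<le> s'" "s' \<le> 1" "z = \<pi> x + s' *\<^sub>R u"
        using z[of n] by (auto simp: cylinder_def)
      have "s' = s"
        using \<pi>[of x] uu by (simp add: s_def x(4) inner_add_right)
      then have "dist x y = norm ((k - u \<bullet> x) *\<^sub>R u)"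
        using x(4) by (simp add: y_def dist_norm \<pi>_def norm_minus_commute)
      also have "\<dots> = k - u \<bullet> x"
        using u below[of x] x(1) by (simp add: slab_def)
      also have "\<dots> \<le> ?h n"
        using x(1) by (simp add: slab_def)
      finally show ?thesis
        using x \<open>s' = s\<close> by (auto simp: slab_def)
    qed
    have "y \<in> closure Q"
      unfolding closure_approachable
    proof (intro allI impI)
      fix \<epsilon> :: real assume "\<epsilon> > 0"
      then obtain n where "?h n < \<epsilon>"
        by (metis reals_Archimedean inverse_eq_divide)
      then show "\<exists>x\<in>Q. dist x y < \<epsilon>"
        using near[of n] by (meson le_less_trans)
    qed
    then have "y \<in> Q"
      using Q by (simp add: compact_imp_closed)
    moreover have "u \<bullet> y = k"
      using uu by (simp add: y_def s_def inner_diff_right)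
    ultimately show "z \<in> cylinder u ?F 1"
      using near unfolding cylinder_def
      by (intro image_eqI[of _ _ "(y, s)"]) (auto simp: y_def)
  next
    fix z assume "z \<in> cylinder u ?F 1"
    then obtain x s where x: "x \<in> ?F" "0 \<le> s" "s \<le> 1" "z = x + s *\<^sub>R u"
      by (auto simp: cylinder_def)
    have "x \<in> ?T (?h n)" for n
      using x(1) by (intro image_eqI[of _ _ x]) (auto simp: \<pi>_def slab_def)
    then show "z \<in> (\<Inter>n. cylinder u (?T (?h n)) 1)"
      using x by (auto simp: cylinder_def)
  qed
  have "(\<lambda>n. measure lebesgue (cylinder u (?T (?h n)) 1)) \<longlonglongrightarrow>
      measure lebesgue (\<Inter>n. cylinder u (?T (?h n)) 1)"
  proof (rule Lim_measure_decseq)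
    have cc: "cylinder u (?T (?h n)) 1 \<in> lmeasurable" for n
      by (intro lmeasurable_compact compact_cylinder T)
    then show "range (\<lambda>n. cylinder u (?T (?h n)) 1) \<subseteq> sets lebesgue"
      by (auto dest: fmeasurableD)
    show "emeasure lebesgue (cylinder u (?T (?h n)) 1) \<noteq> \<infinity>" for n
      using fmeasurableD2[OF cc] by simp
    show "decseq (\<lambda>n. cylinder u (?T (?h n)) 1)"
    proof (rule decseq_SucI)
      fix n
      have "?h (Suc n) \<le> ?h n"
        by (simp add: frac_le)
      then have "slab (?h (Suc n)) \<subseteq> slab (?h n)"
        by (auto simp: slab_def)
      then show "cylinder u (?T (?h (Suc n))) 1 \<subseteq> cylinder u (?T (?h n)) 1"
        unfolding cylinder_def by (intro image_mono Sigma_mono order_refl) auto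
    qed
  qed
  then have "(\<lambda>n. facet_area u (?T (?h n))) \<longlonglongrightarrow> facet_area u ?F"
    by (simp only: Inter facet_area_def)
  then have "\<forall>\<^sub>F n in sequentially. facet_area u (?T (?h n)) < facet_area u ?F + e"
    using e by (intro order_tendstoD(2)[of _ "facet_area u ?F"]) auto
  then obtain n where n: "facet_area u (?T (?h n)) < facet_area u ?F + e"
    by (auto simp: eventually_sequentially)
  show ?thesis
  proof (intro exI[of _ "?h n"] conjI allI impI)
    fix h assume h: "0 \<le> h" "h \<le> ?h n"
    have "facet_area u (?T h) \<le> facet_area u (?T (?h n))"
      unfolding facet_area_def
    proof (rule measure_mono_fmeasurable)
      have "slab h \<subseteq> slab (?h n)"
        using h by (auto simp: slab_def)
      then show "cylinder u (?T h) 1 \<subseteq> cylinder u (?T (?h n)) 1"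
        unfolding cylinder_def by (intro image_mono Sigma_mono order_refl) auto
    qed (auto intro!: lmeasurable_compact fmeasurableD compact_cylinder T)
    then have "h * facet_area u (?T h) \<le> h * (facet_area u ?F + e)"
      using n h by (intro mult_left_mono) auto
    then show "measure lebesgue {x \<in> Q. k - h \<le> u \<bullet> x} \<le> h * (facet_area u ?F + e)"
      using bound[OF h(1)] by (simp add: slab_def)
  qed simp
qed

lemma facet_area_empty: "facet_area u {} = 0"
  by (simp add: facet_area_def cylinder_def)

lemma facet_area_translate: "facet_area u ((+) a ` S) = facet_area u S"
proof -
  have "cylinder u ((+) a ` S) 1 = (+) a ` cylinder u S 1"
    by (force simp: cylinder_def image_iff algebra_simps)
  then show ?thesis
    by (simp add: facet_area_def measure_translation)
qed

text \<open>A set of smaller dimension spans, together with \<open>u\<close>, a proper affine subspace, so the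
  cylinder over it is a null set.\<close>

lemma aff_dim_ge_if_facet_area_pos:
  fixes F :: "'a::euclidean_space set"
  assumes "facet_area u F > 0"
  shows "aff_dim F \<ge> int DIM('a) - 1"
proof (rule ccontr)
  assume "\<not> aff_dim F \<ge> int DIM('a) - 1"
  moreover obtain p where p: "p \<in> F"
    using assms by (force simp: facet_area_empty)
  ultimately have "dim ((+) (- p) ` F) + 1 < DIM('a)"
    using aff_dim_eq_dim[of p F] by (auto simp: hull_inc)
  moreover have "dim (insert u ((+) (- p) ` F)) \<le> dim ((+) (- p) ` F) + 1"
    by (simp add: dim_insert)
  ultimately have "negligible (span (insert u ((+) (- p) ` F)))"
    by (intro negligible_lowdim) simp
  then have "negligible ((+) p ` span (insert u ((+) (- p) ` F)))"
    by (rule negligible_translation)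
  moreover have "cylinder u F 1 \<subseteq> (+) p ` span (insert u ((+) (- p) ` F))"
  proof
    fix z assume "z \<in> cylinder u F 1"
    then obtain x s where xs: "x \<in> F" "z = x + s *\<^sub>R u"
      by (auto simp: cylinder_def)
    have "(- p + x) + s *\<^sub>R u \<in> span (insert u ((+) (- p) ` F))"
      using xs(1) by (intro span_add span_scale span_base) auto
    then have "p + ((- p + x) + s *\<^sub>R u) \<in> (+) p ` span (insert u ((+) (- p) ` F))"
      by (rule imageI)
    then show "z \<in> (+) p ` span (insert u ((+) (- p) ` F))"
      using xs(2) by (simp add: algebra_simps)
  qed
  ultimately have "negligible (cylinder u F 1)"
    by (rule negligible_subset)
  then have "facet_area u F = 0"
    by (simp add: facet_area_def negligible_imp_measure0)
  then show False
    using assms by simp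
qed

section \<open>Comparing functions through a one-sided derivative\<close>

text \<open>Only a lower bound for the right derivative of \<open>f\<close> is available, so the mean value theorem does not
  apply. The tilted difference \<open>D\<close> stays nonnegative: at the last point \<open>\<tau>\<close> up to which it is
  nonnegative, left continuity gives \<open>0 \<le> D \<tau>\<close>, and the slope \<open>e\<close> of the tilt carries the
  inequality beyond \<open>\<tau>\<close>.\<close>

lemma derivative_comparison:
  fixes f g m :: "real \<Rightarrow> real"
  assumes start: "g 0 \<le> f 0"
    and left: "\<And>t. 0 < t \<Longrightarrow> t < b \<Longrightarrow> \<exists>\<sigma>. (\<forall>n::nat. 0 \<le> \<sigma> n \<and> \<sigma> n < t) \<and> \<sigma> \<longlonglongrightarrow> t \<and> (\<lambda>n. f (\<sigma> n)) \<longlonglongrightarrow> f t"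
    and right: "\<And>t e. 0 \<le> t \<Longrightarrow> t < b \<Longrightarrow> 0 < e \<Longrightarrow>
      \<exists>\<delta>>0. \<forall>h. 0 \<le> h \<longrightarrow> h \<le> \<delta> \<longrightarrow> f t - h * (m t + e) \<le> f (t + h)"
    and deriv: "\<And>t. DERIV g t :> - m t"
    and T: "0 \<le> T" "T < b"
  shows "g T \<le> f T"
proof (rule field_le_epsilon)
  fix e' :: real assume e': "e' > 0"
  define e where "e = e' / (T + 1)"
  have e: "e > 0" "e * T \<le> e'"
    using e' T by (auto simp: e_def field_simps)
  define D where "D t = f t - g t + e * t" for t
  define S where "S = {t. 0 \<le> t \<and> t \<le> T \<and> (\<forall>s. 0 \<le> s \<longrightarrow> s \<le> t \<longrightarrow> 0 \<le> D s)}"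
  define \<tau> where "\<tau> = Sup S"
  have S0: "0 \<in> S"
    using start T by (auto simp: S_def D_def)
  have bdd: "bdd_above S"
    by (auto simp: S_def bdd_above_def)
  have \<tau>: "0 \<le> \<tau>" "\<tau> \<le> T"
  proof -
    show "0 \<le> \<tau>"
      unfolding \<tau>_def using S0 bdd by (rule cSup_upper)
    show "\<tau> \<le> T"
      unfolding \<tau>_def using S0 by (intro cSup_least) (auto simp: S_def)
  qed
  have below: "0 \<le> D s" if "0 \<le> s" "s < \<tau>" for s
  proof -
    have "s < Sup S"
      using that by (simp add: \<tau>_def)
    then obtain t where "t \<in> S" "s < t"
      using less_cSupD[of S s] S0 by blast
    then show ?thesis
      using that by (auto simp: S_def)
  qed
  have at: "0 \<le> D \<tau>"
  proof (cases "\<tau> = 0")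
    case True
    then show ?thesis
      using start by (simp add: D_def)
  next
    case False
    then obtain \<sigma> where \<sigma>: "\<And>n::nat. 0 \<le> \<sigma> n \<and> \<sigma> n < \<tau>" "\<sigma> \<longlonglongrightarrow> \<tau>" "(\<lambda>n. f (\<sigma> n)) \<longlonglongrightarrow> f \<tau>"
      using left[of \<tau>] \<tau> T by force
    have "isCont g \<tau>"
      using deriv by (rule DERIV_isCont)
    then have "(\<lambda>n. g (\<sigma> n)) \<longlonglongrightarrow> g \<tau>"
      using \<sigma>(2) by (rule isCont_tendsto_compose)
    then have "(\<lambda>n. D (\<sigma> n)) \<longlonglongrightarrow> D \<tau>"
      unfolding D_def using \<sigma> by (intro tendsto_intros)
    then show ?thesis
      by (rule LIMSEQ_le_const) (use below \<sigma>(1) in blast)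
  qed
  have "\<tau> = T"
  proof (rule ccontr)
    assume "\<tau> \<noteq> T"
    then have "\<tau> < T"
      using \<tau> by simp
    obtain \<delta> where \<delta>: "\<delta> > 0" "\<And>h. 0 \<le> h \<Longrightarrow> h \<le> \<delta> \<Longrightarrow> f \<tau> - h * (m \<tau> + e / 2) \<le> f (\<tau> + h)"
      using right[of \<tau> "e / 2"] \<tau> T e by auto
    have "(\<lambda>h. (g (\<tau> + h) - g \<tau>) / h) \<midarrow>0\<rightarrow> - m \<tau>"
      using deriv[of \<tau>] by (simp add: DERIV_def)
    from LIM_D[OF this half_gt_zero[OF e(1)]] obtain \<eta> where \<eta>0: "\<eta> > 0"
      "\<forall>h. h \<noteq> 0 \<and> norm (h - 0) < \<eta> \<longrightarrow> norm ((g (\<tau> + h) - g \<tau>) / h - - m \<tau>) < e / 2"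
      by (elim exE conjE)
    have \<eta>: "\<eta> > 0" "\<bar>(g (\<tau> + h) - g \<tau>) / h + m \<tau>\<bar> < e / 2" if "h \<noteq> 0" "\<bar>h\<bar> < \<eta>" for h
      using \<eta>0 that by simp_all
    define h0 where "h0 = min (min \<delta> (\<eta> / 2)) (T - \<tau>)"
    have h0: "h0 > 0" "h0 \<le> \<delta>" "h0 < \<eta>" "\<tau> + h0 \<le> T"
      using \<delta>(1) \<eta>0(1) \<open>\<tau> < T\<close> by (simp_all add: h0_def)
    have "0 \<le> D (\<tau> + h)" if h: "0 < h" "h \<le> h0" for h
    proof -
      have "\<bar>(g (\<tau> + h) - g \<tau>) / h + m \<tau>\<bar> < e / 2"
        by (rule \<eta>(2)) (use h h0 in auto)
      then have "(g (\<tau> + h) - g \<tau>) / h + m \<tau> < e / 2"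
        by (simp only: abs_less_iff)
      then have "g (\<tau> + h) - g \<tau> + h * m \<tau> < h * (e / 2)"
        using h by (simp add: field_simps)
      moreover have "f \<tau> - h * (m \<tau> + e / 2) \<le> f (\<tau> + h)"
        using \<delta>(2)[of h] h h0 by simp
      moreover have "D (\<tau> + h) = D \<tau> + (f (\<tau> + h) - f \<tau>) - (g (\<tau> + h) - g \<tau>) + e * h"
        by (simp add: D_def algebra_simps)
      ultimately show ?thesis
        using at by (simp add: algebra_simps)
    qed
    then have "0 \<le> D s" if "0 \<le> s" "s \<le> \<tau> + h0" for s
    proof -
      consider "s < \<tau>" | "s = \<tau>" | "s > \<tau>" by linarith
      then show ?thesis
      proof cases
        case 3
        then show ?thesis
          using \<open>\<And>h. 0 < h \<Longrightarrow> h \<le> h0 \<Longrightarrow> 0 \<le> D (\<tau> + h)\<close>[of "s - \<tau>"] that by simp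
      qed (use below at that in auto)
    qed
    then have "\<tau> + h0 \<in> S"
      using \<tau> h0 by (auto simp: S_def)
    then have "\<tau> + h0 \<le> \<tau>"
      unfolding \<tau>_def using bdd by (rule cSup_upper)
    then show False
      using h0 by simp
  qed
  then show "g T \<le> f T + e'"
    using at e by (simp add: D_def)
qed


section \<open>Polytopes with balanced normals and existence of a maximizer\<close>

locale balanced_normals =
  fixes V :: "'a::euclidean_space set"
  assumes finite_V: "finite V"
    and nonzero: "0 \<notin> V"
    and distinct_directions: "inj_on (\<lambda>v. v /\<^sub>R norm v) V"
    and spanning: "span V = UNIV"
    and balanced: "(\<Sum>v\<in>V. v) = 0"
begin

abbreviation polytope_of :: "('a \<Rightarrow> real) \<Rightarrow> 'a set" where
  "polytope_of c \<equiv> cut_out V c"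

definition vol :: "('a \<Rightarrow> real) \<Rightarrow> real" where
  "vol c = measure lebesgue (polytope_of c)"

definition optimal :: "('a \<Rightarrow> real) \<Rightarrow> bool" where
  "optimal c \<longleftrightarrow> (\<Sum>v\<in>V. c v) = 1 \<and> (\<forall>c'. (\<Sum>v\<in>V. c' v) = 1 \<longrightarrow> vol c' \<le> vol c)"

lemma norm_pos: "v \<in> V \<Longrightarrow> norm v > 0"
  using nonzero by auto

lemma mem_polytope: "x \<in> polytope_of c \<longleftrightarrow> (\<forall>v\<in>V. x \<bullet> v \<le> c v)"
  by (simp add: cut_out_def halfspace_def)

lemma polytope_mono: "(\<And>v. v \<in> V \<Longrightarrow> c v \<le> c' v) \<Longrightarrow> polytope_of c \<subseteq> polytope_of c'"
  by (force simp: mem_polytope)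

lemma polytope_cong: "(\<And>v. v \<in> V \<Longrightarrow> c v = c' v) \<Longrightarrow> polytope_of c = polytope_of c'"
  by (auto simp: mem_polytope)

lemma sum_inner_zero: "(\<Sum>v\<in>V. x \<bullet> v) = 0"
  using balanced by (simp flip: inner_sum_right)

lemma polytope_translate: "polytope_of (\<lambda>v. c v + a \<bullet> v) = (+) a ` polytope_of c"
proof (intro subset_antisym subsetI)
  fix x assume "x \<in> polytope_of (\<lambda>v. c v + a \<bullet> v)"
  then have "x - a \<in> polytope_of c"
    by (simp add: mem_polytope inner_diff_left algebra_simps)
  then have "a + (x - a) \<in> (+) a ` polytope_of c"
    by (rule imageI)
  then show "x \<in> (+) a ` polytope_of c"
    by simp
qed (auto simp: mem_polytope inner_add_left)

lemma polytope_scale: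
  assumes "s > 0"
  shows "polytope_of (\<lambda>v. s * c v) = (*\<^sub>R) s ` polytope_of c"
proof (intro subset_antisym subsetI)
  fix x assume "x \<in> polytope_of (\<lambda>v. s * c v)"
  then have "(1 / s) *\<^sub>R x \<in> polytope_of c"
    using assms by (simp add: mem_polytope field_simps)
  then have "s *\<^sub>R (1 / s) *\<^sub>R x \<in> (*\<^sub>R) s ` polytope_of c"
    by (rule imageI)
  then show "x \<in> (*\<^sub>R) s ` polytope_of c"
    using assms by simp
qed (use assms in \<open>auto simp: mem_polytope\<close>)

lemma closed_polytope: "closed (polytope_of c)"
proof -
  have "polytope_of c = (\<Inter>v\<in>V. {x. v \<bullet> x \<le> c v})"
    by (auto simp: mem_polytope inner_commute)
  then show ?thesis
    by (auto intro: closed_halfspace_le)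
qed

lemma convex_polytope: "convex (polytope_of c)"
proof -
  have "polytope_of c = (\<Inter>v\<in>V. {x. v \<bullet> x \<le> c v})"
    by (auto simp: mem_polytope inner_commute)
  then show ?thesis
    by (auto intro: convex_INT convex_halfspace_le)
qed

text \<open>Every \<open>x \<bullet> v\<close> is bounded above by \<open>c v\<close>, and below because the \<open>x \<bullet> w\<close> sum to zero. The
  vectors \<open>y\<close> for which \<open>x \<bullet> y\<close> is bounded form a subspace, which contains \<open>V\<close> and thus is everything.\<close>

lemma bounded_polytope: "bounded (polytope_of c)"
proof -
  define B where "B = {y. \<exists>M. \<forall>x\<in>polytope_of c. \<bar>x \<bullet> y\<bar> \<le> M}"
  have V: "V \<subseteq> B"
  proof
    fix v assume v: "v \<in> V"
    have "\<bar>x \<bullet> v\<bar> \<le> \<bar>c v\<bar> + \<bar>\<Sum>w\<in>V - {v}. c w\<bar>" if x: "x \<in> polytope_of c" for x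
    proof -
      have "x \<bullet> v + (\<Sum>w\<in>V - {v}. x \<bullet> w) = 0"
        using sum_inner_zero[of x] v finite_V by (simp add: sum.remove)
      moreover have "(\<Sum>w\<in>V - {v}. x \<bullet> w) \<le> (\<Sum>w\<in>V - {v}. c w)"
        using x by (intro sum_mono) (simp add: mem_polytope)
      moreover have "x \<bullet> v \<le> c v"
        using x v by (simp add: mem_polytope)
      ultimately show ?thesis
        by linarith
    qed
    then show "v \<in> B"
      by (auto simp: B_def)
  qed
  have "subspace B"
    unfolding subspace_def
  proof (intro conjI ballI allI)
    show "0 \<in> B"
      by (auto simp: B_def)
    fix y z assume y: "y \<in> B" and z: "z \<in> B"
    then obtain M N where MN: "\<And>x. x \<in> polytope_of c \<Longrightarrow> \<bar>x \<bullet> y\<bar> \<le> M"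
      "\<And>x. x \<in> polytope_of c \<Longrightarrow> \<bar>x \<bullet> z\<bar> \<le> N"
      by (auto simp: B_def)
    have "\<bar>x \<bullet> (y + z)\<bar> \<le> M + N" if "x \<in> polytope_of c" for x
      using MN[OF that] by (simp add: inner_add_right)
    then show "y + z \<in> B"
      by (auto simp: B_def)
  next
    fix r :: real and y assume "y \<in> B"
    then obtain M where M: "\<And>x. x \<in> polytope_of c \<Longrightarrow> \<bar>x \<bullet> y\<bar> \<le> M"
      by (auto simp: B_def)
    have "\<bar>x \<bullet> r *\<^sub>R y\<bar> \<le> \<bar>r\<bar> * M" if "x \<in> polytope_of c" for x
      using M[OF that] by (simp add: abs_mult mult_left_mono)
    then show "r *\<^sub>R y \<in> B"
      by (auto simp: B_def)
  qed
  then have "B = UNIV"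
    using V spanning span_minimal by blast
  then have "\<forall>b. \<exists>M. \<forall>x\<in>polytope_of c. \<bar>x \<bullet> b\<bar> \<le> M"
    by (auto simp: B_def)
  then obtain M where M: "\<And>b x. x \<in> polytope_of c \<Longrightarrow> \<bar>x \<bullet> b\<bar> \<le> M b"
    by metis
  have "norm x \<le> (\<Sum>b\<in>Basis. M b)" if "x \<in> polytope_of c" for x
    using norm_le_l1[of x] sum_mono[of Basis "\<lambda>b. \<bar>x \<bullet> b\<bar>" M] M[OF that] by force
  then show ?thesis
    by (auto simp: bounded_iff)
qed

lemma compact_polytope: "compact (polytope_of c)"
  by (simp add: compact_eq_bounded_closed closed_polytope bounded_polytope)

lemma lmeasurable_polytope: "polytope_of c \<in> lmeasurable"
  by (intro lmeasurable_compact compact_polytope)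

lemma emeasure_polytope: "emeasure lebesgue (polytope_of c) = ennreal (vol c)"
  unfolding vol_def by (intro emeasure_eq_measure2 lmeasurable_polytope)

lemma vol_nonneg: "0 \<le> vol c"
  by (simp add: vol_def)

lemma vol_translate: "vol (\<lambda>v. c v + a \<bullet> v) = vol c"
  by (simp add: vol_def polytope_translate measure_translation)

lemma vol_scale: "s > 0 \<Longrightarrow> vol (\<lambda>v. s * c v) = s ^ DIM('a) * vol c"
  using measure_lebesgue_affine[of s 0 "polytope_of c"] by (simp add: vol_def polytope_scale)

lemma vol_mono: "(\<And>v. v \<in> V \<Longrightarrow> c v \<le> c' v) \<Longrightarrow> vol c \<le> vol c'"
  unfolding vol_def
  by (intro measure_mono_fmeasurable polytope_mono lmeasurable_polytope fmeasurableD)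

text \<open>Decreasing heights give decreasing compact polytopes whose intersection is the polytope of the
  limit heights.\<close>

lemma vol_tendsto_from_above:
  assumes dec: "\<And>n v. v \<in> V \<Longrightarrow> c (Suc n) v \<le> c n v"
    and lim: "\<And>v. v \<in> V \<Longrightarrow> (\<lambda>n. c n v) \<longlonglongrightarrow> l v"
  shows "(\<lambda>n. vol (c n)) \<longlonglongrightarrow> vol l"
proof -
  have "(\<lambda>n. measure lebesgue (polytope_of (c n))) \<longlonglongrightarrow> measure lebesgue (\<Inter>n. polytope_of (c n))"
  proof (rule Lim_measure_decseq)
    show "range (\<lambda>n. polytope_of (c n)) \<subseteq> sets lebesgue"
      using lmeasurable_polytope by (auto dest: fmeasurableD)
    show "decseq (\<lambda>n. polytope_of (c n))"
      by (intro decseq_SucI polytope_mono dec)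
    show "emeasure lebesgue (polytope_of (c n)) \<noteq> \<infinity>" for n
      by (simp add: emeasure_polytope del: emeasure_completion)
  qed
  also have "(\<Inter>n. polytope_of (c n)) = polytope_of l"
  proof (intro subset_antisym subsetI)
    fix x assume x: "x \<in> (\<Inter>n. polytope_of (c n))"
    have "x \<bullet> v \<le> l v" if v: "v \<in> V" for v
      by (rule LIMSEQ_le_const[OF lim[OF v]]) (use x v in \<open>auto simp: mem_polytope\<close>)
    then show "x \<in> polytope_of l"
      by (simp add: mem_polytope)
  next
    fix x assume x: "x \<in> polytope_of l"
    have "l v \<le> c n v" if v: "v \<in> V" for n v
      by (rule decseq_ge[OF decseq_SucI lim[OF v]]) (rule dec[OF v])
    then show "x \<in> (\<Inter>n. polytope_of (c n))"
      using x by (simp add: mem_polytope) (meson order_trans)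
  qed
  finally show ?thesis
    by (simp add: vol_def)
qed

lemma translate_to_nonneg:
  assumes "vol c \<noteq> 0"
  obtains a where "\<And>v. v \<in> V \<Longrightarrow> 0 \<le> c v + a \<bullet> v"
proof -
  obtain p where "p \<in> polytope_of c"
    using assms by (force simp: vol_def)
  then show thesis
    by (intro that[of "-p"]) (simp add: mem_polytope)
qed

lemma sum_translate: "(\<Sum>v\<in>V. c v + a \<bullet> v) = (\<Sum>v\<in>V. c v)"
  by (simp add: sum.distrib sum_inner_zero)

lemma interior_polytope_iff: "x \<in> interior (polytope_of c) \<longleftrightarrow> (\<forall>v\<in>V. x \<bullet> v < c v)"
proof
  assume "\<forall>v\<in>V. x \<bullet> v < c v"
  moreover have "open (\<Inter>v\<in>V. {x. v \<bullet> x < c v})"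
    using finite_V by (intro open_INT) (auto intro: open_halfspace_lt)
  moreover have "(\<Inter>v\<in>V. {x. v \<bullet> x < c v}) \<subseteq> polytope_of c"
    by (auto simp: mem_polytope inner_commute less_imp_le)
  ultimately show "x \<in> interior (polytope_of c)"
    by (intro interiorI[of "\<Inter>v\<in>V. {x. v \<bullet> x < c v}"]) (auto simp: inner_commute)
next
  assume "x \<in> interior (polytope_of c)"
  then obtain e where e: "e > 0" "cball x e \<subseteq> polytope_of c"
    by (auto simp: mem_interior_cball)
  show "\<forall>v\<in>V. x \<bullet> v < c v"
  proof
    fix v assume v: "v \<in> V"
    have "x + (e / norm v) *\<^sub>R v \<in> cball x e"
      using e norm_pos[OF v] by (simp add: dist_norm)
    then have "(x + (e / norm v) *\<^sub>R v) \<bullet> v \<le> c v"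
      using e(2) v by (auto simp: mem_polytope)
    moreover have "(e / norm v) * (v \<bullet> v) > 0"
      using e norm_pos[OF v] by (intro mult_pos_pos) auto
    ultimately show "x \<bullet> v < c v"
      by (simp add: inner_add_left)
  qed
qed

lemma vol_pos_iff: "vol c > 0 \<longleftrightarrow> interior (polytope_of c) \<noteq> {}"
proof -
  have "vol c = 0 \<longleftrightarrow> negligible (polytope_of c)"
    unfolding vol_def using lmeasurable_polytope
    by (simp add: negligible_iff_measure)
  then show ?thesis
    using negligible_convex_interior[OF convex_polytope] vol_nonneg[of c] by (metis less_eq_real_def less_irrefl)
qed

lemma V_nonempty: "V \<noteq> {}"
proof
  assume "V = {}"
  then have "(UNIV :: 'a set) = {0}"
    using spanning by simp
  then show False
    using nonempty_Basis nonzero_Basis by blast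
qed

text \<open>A competitor of positive volume can be translated so that it contains the origin, that is, so that
  its heights lie in the compact simplex \<open>\<Delta>\<close>. Along a maximizing sequence in \<open>\<Delta>\<close> with limit
  \<open>l\<close> the polytopes are eventually contained in that of \<open>l + e\<close>, whose volume tends to that of
  \<open>l\<close> as \<open>e\<close> tends to 0.\<close>

lemma exists_optimal: "\<exists>c. optimal c"
proof -
  define \<Delta> where "\<Delta> = {c :: 'a \<Rightarrow> real. (\<Sum>v\<in>V. c v) = 1 \<and> (\<forall>v\<in>V. 0 \<le> c v)}"
  let ?S = "SUP c\<in>\<Delta>. vol c"
  have le1: "c v \<le> 1" if "c \<in> \<Delta>" "v \<in> V" for c v
    using that finite_V member_le_sum[of v V c] by (auto simp: \<Delta>_def)
  have bdd: "bdd_above (vol ` \<Delta>)"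
    using le1 by (intro bdd_aboveI2[of _ _ "vol (\<lambda>_. 1)"] vol_mono) auto
  have cst: "(\<lambda>_. 1 / card V) \<in> \<Delta>"
    using finite_V V_nonempty by (simp add: \<Delta>_def)
  have "\<exists>c\<in>\<Delta>. ?S - 1 / real (Suc n) < vol c" for n
  proof -
    have "?S - 1 / real (Suc n) < ?S" by simp
    then show ?thesis
      using less_cSUP_iff[OF _ bdd] cst by blast
  qed
  then obtain c where c: "\<And>n. c n \<in> \<Delta>" "\<And>n. ?S - 1 / real (Suc n) < vol (c n)"
    by metis
  have "\<forall>D\<subseteq>V. \<exists>l::'a \<Rightarrow> real. \<exists>r::nat \<Rightarrow> nat. strict_mono r \<and>
      (\<forall>e>0. \<forall>\<^sub>F n in sequentially. \<forall>i\<in>D. dist (c (r n) i) (l i) < e)"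
  proof (rule compact_lemma_general[where unproj = "\<lambda>x. x"])
    show "bounded ((\<lambda>x. x k) ` range c)" if "k \<in> V" for k
      using c(1) le1 that by (intro boundedI[of _ 1]) (auto simp: \<Delta>_def)
  qed (auto simp: finite_V)
  then obtain l :: "'a \<Rightarrow> real" and r where r: "strict_mono r"
    "\<And>e. e > 0 \<Longrightarrow> \<forall>\<^sub>F n in sequentially. \<forall>i\<in>V. dist (c (r n) i) (l i) < e"
    by blast
  have lim: "(\<lambda>n. c (r n) v) \<longlonglongrightarrow> l v" if v: "v \<in> V" for v
    unfolding tendsto_iff
  proof (intro allI impI)
    fix e :: real assume "e > 0"
    show "\<forall>\<^sub>F n in sequentially. dist (c (r n) v) (l v) < e"
      using r(2)[OF \<open>e > 0\<close>] v by (auto elim!: eventually_mono)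
  qed
  have "(\<lambda>n. \<Sum>v\<in>V. c (r n) v) \<longlonglongrightarrow> (\<Sum>v\<in>V. l v)"
    by (intro tendsto_sum lim)
  then have l1: "(\<Sum>v\<in>V. l v) = 1"
    using c(1) by (simp add: \<Delta>_def LIMSEQ_const_iff)
  have upper: "?S \<le> vol (\<lambda>v. l v + e)" if e: "e > 0" for e
  proof -
    have "(\<lambda>n. 1 / real (Suc n)) \<longlonglongrightarrow> 0"
      using LIMSEQ_inverse_real_of_nat by (simp add: inverse_eq_divide)
    then have "(\<lambda>n. ?S - 1 / real (Suc (r n))) \<longlonglongrightarrow> ?S - 0"
      by (intro tendsto_diff tendsto_const LIMSEQ_subseq_LIMSEQ[OF _ r(1), unfolded comp_def])
    moreover have "\<forall>\<^sub>F n in sequentially. ?S - 1 / real (Suc (r n)) \<le> vol (\<lambda>v. l v + e)"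
      using r(2)[OF e]
    proof (rule eventually_mono)
      fix n assume n: "\<forall>i\<in>V. dist (c (r n) i) (l i) < e"
      have "vol (c (r n)) \<le> vol (\<lambda>v. l v + e)"
      proof (rule vol_mono)
        fix v assume "v \<in> V"
        then have "\<bar>c (r n) v - l v\<bar> < e"
          using n by (simp add: dist_real_def)
        then show "c (r n) v \<le> l v + e"
          by linarith
      qed
      then show "?S - 1 / real (Suc (r n)) \<le> vol (\<lambda>v. l v + e)"
        using c(2)[of "r n"] by linarith
    qed
    ultimately have "?S - 0 \<le> vol (\<lambda>v. l v + e)"
      by (intro tendsto_upperbound) auto
    then show ?thesis by simp
  qed
  have "(\<lambda>n. vol (\<lambda>v. l v + 1 / real (Suc n))) \<longlonglongrightarrow> vol l"
  proof (rule vol_tendsto_from_above)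
    show "(\<lambda>n. l v + 1 / real (Suc n)) \<longlonglongrightarrow> l v" for v
      using tendsto_add[OF tendsto_const LIMSEQ_inverse_real_of_nat, of "l v"]
      by (simp add: inverse_eq_divide)
  qed (simp add: frac_le)
  then have S: "?S \<le> vol l"
    by (rule LIMSEQ_le_const) (use upper in auto)
  have "vol c' \<le> vol l" if c': "(\<Sum>v\<in>V. c' v) = 1" for c'
  proof (cases "vol c' = 0")
    case True
    then show ?thesis by (simp add: vol_nonneg)
  next
    case False
    then obtain a where "\<And>v. v \<in> V \<Longrightarrow> 0 \<le> c' v + a \<bullet> v"
      using translate_to_nonneg by blast
    then have "(\<lambda>v. c' v + a \<bullet> v) \<in> \<Delta>"
      using c' by (simp add: \<Delta>_def sum_translate)
    then have "vol (\<lambda>v. c' v + a \<bullet> v) \<le> ?S"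
      using bdd by (rule cSUP_upper)
    then show ?thesis
      using S by (simp add: vol_translate)
  qed
  with l1 show ?thesis
    by (auto simp: optimal_def)
qed

lemma maximizer_iff: "maximizer V R \<longleftrightarrow> (\<exists>c. optimal c \<and> R = polytope_of c)"
  unfolding maximizer_def is_arg_max_def optimal_def emeasure_polytope
  by (auto simp: ennreal_less_iff vol_nonneg not_less)

lemma optimal_max_volume:
  assumes "optimal c"
  shows "max_volume V = ennreal (vol c)"
  unfolding max_volume_def emeasure_polytope
proof (rule antisym)
  show "(SUP c\<in>{c. sum c V = 1}. ennreal (vol c)) \<le> ennreal (vol c)"
    using assms by (intro SUP_least ennreal_leI) (auto simp: optimal_def)
  show "ennreal (vol c) \<le> (SUP c\<in>{c. sum c V = 1}. ennreal (vol c))"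
    using assms by (intro SUP_upper) (auto simp: optimal_def)
qed

lemma optimal_vol_unique: "optimal c \<Longrightarrow> optimal c' \<Longrightarrow> vol c = vol c'"
  by (simp add: optimal_def order_antisym)

lemma optimal_translate: "optimal c \<Longrightarrow> optimal (\<lambda>v. c v + a \<bullet> v)"
  by (simp add: optimal_def sum_translate vol_translate)

lemma optimal_vol_pos:
  assumes "optimal c"
  shows "vol c > 0"
proof -
  have "0 \<in> interior (polytope_of (\<lambda>_. 1 / card V))"
    using finite_V V_nonempty by (simp add: interior_polytope_iff card_gt_0_iff)
  then have "0 < vol (\<lambda>_. 1 / card V)"
    using vol_pos_iff by blast
  also have "\<dots> \<le> vol c"
    using assms finite_V V_nonempty by (auto simp: optimal_def)
  finally show ?thesis .
qed

lemma translate_to_pos: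
  assumes "optimal c"
  obtains a where "\<And>v. v \<in> V \<Longrightarrow> 0 < c v + a \<bullet> v"
proof -
  obtain p where "p \<in> interior (polytope_of c)"
    using optimal_vol_pos[OF assms] by (auto simp: vol_pos_iff)
  then show thesis
    by (intro that[of "-p"]) (simp add: interior_polytope_iff)
qed

text \<open>Maximality, extended to arbitrary positive sums of the heights by scaling.\<close>

lemma vol_le_optimal:
  assumes "optimal c" and s: "(\<Sum>v\<in>V. c' v) = s" "s > 0"
  shows "vol c' \<le> s ^ DIM('a) * vol c"
proof -
  have "(\<Sum>v\<in>V. 1 / s * c' v) = 1"
    using s by (simp add: sum_distrib_left[symmetric] sum_divide_distrib[symmetric])
  then have "vol (\<lambda>v. 1 / s * c' v) \<le> vol c"
    using assms(1) by (simp only: optimal_def)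
  then have "(1 / s) ^ DIM('a) * vol c' \<le> vol c"
    using s vol_scale[of "1 / s" c'] by simp
  then show ?thesis
    using s by (simp add: power_divide field_simps)
qed

section \<open>Facets of a maximizer\<close>

definition face :: "('a \<Rightarrow> real) \<Rightarrow> 'a \<Rightarrow> 'a set" where
  "face c v = {x \<in> polytope_of c. x \<bullet> v = c v}"

definition area :: "('a \<Rightarrow> real) \<Rightarrow> 'a \<Rightarrow> real" where
  "area c v = facet_area (v /\<^sub>R norm v) (face c v)"

lemma norm_direction: "v \<in> V \<Longrightarrow> norm (v /\<^sub>R norm v) = 1"
  using norm_pos[of v] by simp

lemma inner_direction: "v \<in> V \<Longrightarrow> (v /\<^sub>R norm v) \<bullet> x = x \<bullet> v / norm v"
  by (simp add: inner_commute divide_inverse_commute)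

lemma face_eq_supporting:
  assumes "v \<in> V"
  shows "face c v = {x \<in> polytope_of c. (v /\<^sub>R norm v) \<bullet> x = c v / norm v}"
  unfolding inner_direction[OF assms] using norm_pos[OF assms] by (auto simp: face_def)

lemma below_support: "v \<in> V \<Longrightarrow> x \<in> polytope_of c \<Longrightarrow> (v /\<^sub>R norm v) \<bullet> x \<le> c v / norm v"
  unfolding inner_direction by (simp add: mem_polytope divide_right_mono)

lemma compact_face: "compact (face c v)"
proof -
  have "face c v = polytope_of c \<inter> {x. v \<bullet> x = c v}"
    by (auto simp: face_def inner_commute)
  then show ?thesis
    using compact_Int_closed[OF compact_polytope closed_hyperplane] by simp
qed

lemma area_nonneg: "0 \<le> area c v"
  by (simp add: area_def facet_area_def)

lemma face_translate: "face (\<lambda>v. c v + a \<bullet> v) v = (+) a ` face c v"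
proof -
  have "face (\<lambda>v. c v + a \<bullet> v) v = {x \<in> (+) a ` polytope_of c. x \<bullet> v = c v + a \<bullet> v}"
    by (simp add: face_def polytope_translate)
  also have "\<dots> = (+) a ` face c v"
    by (auto simp: face_def inner_add_left)
  finally show ?thesis .
qed

lemma area_translate: "area (\<lambda>v. c v + a \<bullet> v) v = area c v"
  by (simp add: area_def face_translate facet_area_translate)

lemma slab_measure_near_facet:
  assumes v: "v \<in> V" and e: "e > 0"
  shows "\<exists>\<delta>>0. \<forall>t. 0 \<le> t \<longrightarrow> t \<le> \<delta> \<longrightarrow>
    measure lebesgue {x \<in> polytope_of c. c v - t \<le> x \<bullet> v} \<le> t / norm v * (area c v + e)"
proof -
  let ?u = "v /\<^sub>R norm v" and ?k = "c v / norm v"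
  obtain \<delta> where \<delta>: "\<delta> > 0" "\<And>h. 0 \<le> h \<Longrightarrow> h \<le> \<delta> \<Longrightarrow>
      measure lebesgue {x \<in> polytope_of c. ?k - h \<le> ?u \<bullet> x} \<le> h * (area c v + e)"
    using slab_measure_near_face[OF norm_direction[OF v] compact_polytope below_support[OF v] e]
    unfolding area_def face_eq_supporting[OF v] by blast
  note n = norm_pos[OF v]
  show ?thesis
  proof (intro exI[of _ "\<delta> * norm v"] conjI allI impI)
    show "0 < \<delta> * norm v"
      using \<delta> n by simp
    fix t assume t: "0 \<le> t" "t \<le> \<delta> * norm v"
    have eq: "{x \<in> polytope_of c. c v - t \<le> x \<bullet> v} = {x \<in> polytope_of c. ?k - t / norm v \<le> ?u \<bullet> x}"
      unfolding inner_direction[OF v] diff_divide_distrib[symmetric] using n by (auto simp: divide_le_cancel)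
    have "0 \<le> t / norm v" "t / norm v \<le> \<delta>"
      using t n by (simp_all add: pos_divide_le_eq)
    then show "measure lebesgue {x \<in> polytope_of c. c v - t \<le> x \<bullet> v} \<le> t / norm v * (area c v + e)"
      unfolding eq by (rule \<delta>(2))
  qed
qed

lemma lmeasurable_slab: "{x \<in> polytope_of c. b \<le> x \<bullet> v} \<in> lmeasurable"
proof -
  have "{x \<in> polytope_of c. b \<le> x \<bullet> v} = polytope_of c \<inter> {x. v \<bullet> x \<ge> b}"
    by (auto simp: inner_commute)
  then show ?thesis
    using compact_polytope by (simp add: lmeasurable_compact compact_Int_closed closed_halfspace_ge)
qed

text \<open>Lowering the single height \<open>c v\<close> by \<open>t\<close> removes at most a slab of volume about
  \<open>t * area c v / norm v\<close>; by maximality what is left has volume at most \<open>(1 - t) ^ DIM('a) * vol c\<close>.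
  Comparing the terms of first order in \<open>t\<close> gives the bound.\<close>

lemma optimal_area_ge:
  assumes c: "optimal c" and v: "v \<in> V"
  shows "DIM('a) * vol c * norm v \<le> area c v"
proof (rule field_le_epsilon)
  fix e :: real assume e: "e > 0"
  note n = norm_pos[OF v]
  obtain \<delta> where \<delta>: "\<delta> > 0" "\<And>t. 0 \<le> t \<Longrightarrow> t \<le> \<delta> \<Longrightarrow>
      measure lebesgue {x \<in> polytope_of c. c v - t \<le> x \<bullet> v} \<le> t / norm v * (area c v + e)"
    using slab_measure_near_facet[OF v e] by blast
  have step: "vol c * (\<Sum>i<DIM('a). (1 - t) ^ i) \<le> (area c v + e) / norm v"
    if t: "0 < t" "t < min \<delta> 1" for t
  proof -
    let ?c = "c(v := c v - t)"
    have sum: "(\<Sum>w\<in>V. ?c w) = 1 - t"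
    proof -
      have "(\<Sum>w\<in>V. ?c w) = c v - t + (\<Sum>w\<in>V - {v}. c w)"
        using v finite_V by (simp add: sum.remove)
      moreover have "(\<Sum>w\<in>V. c w) = c v + (\<Sum>w\<in>V - {v}. c w)"
        using v finite_V by (simp add: sum.remove)
      ultimately show ?thesis
        using c by (simp add: optimal_def)
    qed
    have "vol c \<le> measure lebesgue ({x \<in> polytope_of c. c v - t \<le> x \<bullet> v} \<union> polytope_of ?c)"
      unfolding vol_def
    proof (rule measure_mono_fmeasurable)
      show "polytope_of c \<subseteq> {x \<in> polytope_of c. c v - t \<le> x \<bullet> v} \<union> polytope_of ?c"
        by (auto simp: mem_polytope split: if_splits)
      show "{x \<in> polytope_of c. c v - t \<le> x \<bullet> v} \<union> polytope_of ?c \<in> lmeasurable"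
        by (intro fmeasurable.Un lmeasurable_slab lmeasurable_polytope)
    qed (intro fmeasurableD lmeasurable_polytope)
    also have "\<dots> \<le> measure lebesgue {x \<in> polytope_of c. c v - t \<le> x \<bullet> v} + vol ?c"
      unfolding vol_def by (intro measure_Un_le fmeasurableD lmeasurable_slab lmeasurable_polytope)
    also have "\<dots> \<le> t / norm v * (area c v + e) + (1 - t) ^ DIM('a) * vol c"
    proof (rule add_mono)
      show "measure lebesgue {x \<in> polytope_of c. c v - t \<le> x \<bullet> v} \<le> t / norm v * (area c v + e)"
        using t by (intro \<delta>(2)) auto
      show "vol ?c \<le> (1 - t) ^ DIM('a) * vol c"
        using t by (intro vol_le_optimal[OF c sum]) auto
    qed
    finally have "vol c * (1 - (1 - t) ^ DIM('a)) \<le> t / norm v * (area c v + e)"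
      by (simp add: algebra_simps)
    also have "1 - (1 - t) ^ DIM('a) = t * (\<Sum>i<DIM('a). (1 - t) ^ i)"
      by (simp add: one_diff_power_eq)
    finally have "t * (vol c * (\<Sum>i<DIM('a). (1 - t) ^ i)) \<le> t * ((area c v + e) / norm v)"
      by (simp add: mult.left_commute)
    then show ?thesis
      using t(1) by (simp only: mult_le_cancel_left_pos)
  qed
  have "((\<lambda>t. vol c * (\<Sum>i<DIM('a). (1 - t) ^ i)) \<longlongrightarrow> vol c * (\<Sum>i<DIM('a). (1 - 0) ^ i)) (at_right 0)"
    by (intro tendsto_intros)
  moreover have "\<forall>\<^sub>F t in at_right 0. vol c * (\<Sum>i<DIM('a). (1 - t) ^ i) \<le> (area c v + e) / norm v"
    unfolding eventually_at_right_field using \<delta>(1) step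
    by (intro exI[of _ "min \<delta> 1"]) auto
  ultimately have "vol c * (\<Sum>i<DIM('a). (1 - 0) ^ i) \<le> (area c v + e) / norm v"
    by (rule tendsto_upperbound) simp
  then show "DIM('a) * vol c * norm v \<le> area c v + e"
    using n by (simp add: field_simps)
qed

text \<open>The polytope contains the pyramids with apex 0 over its faces. They do not overlap: at a point of
  the pyramid over the face of \<open>v\<close> the ratio \<open>x \<bullet> v / c v\<close> is the largest of all these ratios, so at a
  common point of two pyramids the two ratios agree. This describes a hyperplane, because the
  vectors of \<open>V\<close> have different directions.\<close>

lemma sum_pyramids_le_vol:
  assumes pos: "\<And>v. v \<in> V \<Longrightarrow> c v > 0"
  shows "(\<Sum>v\<in>V. c v / norm v * area c v / DIM('a)) \<le> vol c"
proof -
  let ?P = "\<lambda>v. pyramid (face c v)"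
  have meas: "?P v \<in> lmeasurable" for v
    by (intro lmeasurable_compact compact_pyramid compact_face)
  have m: "measure lebesgue (?P v) = c v / norm v * area c v / DIM('a)" if v: "v \<in> V" for v
    unfolding area_def
  proof (rule measure_pyramid)
    show "norm (v /\<^sub>R norm v) = 1"
      by (rule norm_direction[OF v])
    show "0 < c v / norm v"
      using pos[OF v] norm_pos[OF v] by simp
    show "(v /\<^sub>R norm v) \<bullet> x = c v / norm v" if "x \<in> face c v" for x
      using that unfolding face_eq_supporting[OF v] by blast
  qed (rule compact_face)
  have "(\<Sum>v\<in>V. c v / norm v * area c v / DIM('a)) = (\<Sum>v\<in>V. measure lebesgue (?P v))"
    by (rule sum.cong) (simp_all add: m)
  also have "\<dots> = measure lebesgue (\<Union>v\<in>V. ?P v)"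
  proof (rule measure_negligible_finite_Union_image[symmetric])
    show "pairwise (\<lambda>v w. negligible (?P v \<inter> ?P w)) V"
      unfolding pairwise_def
    proof (intro ballI impI)
      fix v w assume v: "v \<in> V" and w: "w \<in> V" and "v \<noteq> w"
      have ineq: "s \<le> t" if "y \<in> face c v" "z \<in> face c w" "t *\<^sub>R y = s *\<^sub>R z" "0 \<le> t" "w \<in> V" "c w > 0"
        for v w y z s t
      proof -
        have "y \<bullet> w \<le> c w"
          using that(1,5) by (simp add: face_def mem_polytope)
        then have "t * (y \<bullet> w) \<le> t * c w"
          using that(4) by (rule mult_left_mono)
        moreover have "t * (y \<bullet> w) = s * (z \<bullet> w)"
          using arg_cong[OF that(3), of "\<lambda>x. x \<bullet> w"] by simp
        moreover have "z \<bullet> w = c w"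
          using that(2) by (simp add: face_def)
        ultimately have "s * c w \<le> t * c w"
          by simp
        then show ?thesis
          using that(6) by simp
      qed
      have "?P v \<inter> ?P w \<subseteq> {x. (v /\<^sub>R c v - w /\<^sub>R c w) \<bullet> x = 0}"
      proof
        fix x assume x: "x \<in> ?P v \<inter> ?P w"
        obtain t y where ty: "x = t *\<^sub>R y" "0 \<le> t" "y \<in> face c v"
          using IntD1[OF x] by (auto simp: pyramid_def)
        obtain s z where sz: "x = s *\<^sub>R z" "0 \<le> s" "z \<in> face c w"
          using IntD2[OF x] by (auto simp: pyramid_def)
        note ts = ty sz
        have "s = t"
          using ineq[of y v z w t s] ineq[of z w y v s t] ts v w pos by (auto intro: antisym)
        moreover have "x \<bullet> v = t * c v" "x \<bullet> w = s * c w"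
          using ts by (auto simp: face_def) (metis inner_scaleR_left)
        ultimately show "x \<in> {x. (v /\<^sub>R c v - w /\<^sub>R c w) \<bullet> x = 0}"
          using pos[OF v] pos[OF w] by (simp add: inner_diff_left inner_diff_right inner_commute)
      qed
      moreover have "v /\<^sub>R c v - w /\<^sub>R c w \<noteq> 0"
      proof
        assume "v /\<^sub>R c v - w /\<^sub>R c w = 0"
        then have eq: "v /\<^sub>R c v = w /\<^sub>R c w"
          by simp
        have sgn_scale: "x /\<^sub>R norm x = sgn (x /\<^sub>R r)" if "r > 0" for x :: 'a and r
          using that by (simp add: sgn_div_norm)
        have "v /\<^sub>R norm v = w /\<^sub>R norm w"
          using sgn_scale[OF pos[OF v], of v] sgn_scale[OF pos[OF w], of w] eq by simp
        then show False
          using distinct_directions v w \<open>v \<noteq> w\<close> by (auto dest: inj_onD)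
      qed
      ultimately show "negligible (?P v \<inter> ?P w)"
        by (intro negligible_subset[OF negligible_hyperplane]) auto
    qed
  qed (use finite_V meas in auto)
  also have "\<dots> \<le> vol c"
    unfolding vol_def
  proof (rule measure_mono_fmeasurable)
    show "(\<Union>v\<in>V. ?P v) \<subseteq> polytope_of c"
    proof clarify
      fix v x assume "x \<in> ?P v"
      then obtain t y where ty: "x = t *\<^sub>R y" "0 \<le> t" "t \<le> 1" "y \<in> polytope_of c"
        by (auto simp: pyramid_def face_def)
      have "t * (y \<bullet> w) \<le> c w" if w: "w \<in> V" for w
      proof -
        have "t * (y \<bullet> w) \<le> t * c w"
          using ty w by (intro mult_left_mono) (auto simp: mem_polytope)
        also have "\<dots> \<le> c w"
          using ty pos[OF w] by (simp add: mult_left_le_one_le)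
        finally show ?thesis .
      qed
      then show "x \<in> polytope_of c"
        by (simp add: mem_polytope ty(1))
    qed
    show "(\<Union>v\<in>V. ?P v) \<in> sets lebesgue"
      using finite_V meas by (intro sets.finite_UN) (auto intro: fmeasurableD)
  qed (rule lmeasurable_polytope)
  finally show ?thesis .
qed

text \<open>After a translation all heights are positive. The weighted gaps between the two sides of
  \<open>optimal_area_ge\<close> are nonnegative, and the pyramids show that their sum is at most 0.\<close>

lemma optimal_area:
  assumes c: "optimal c" and v: "v \<in> V"
  shows "area c v = DIM('a) * vol c * norm v"
proof -
  obtain a where a: "\<And>v. v \<in> V \<Longrightarrow> 0 < c v + a \<bullet> v"
    by (rule translate_to_pos[OF c]) (rule that)
  define c' where "c' = (\<lambda>v. c v + a \<bullet> v)"
  have c': "optimal c'" "\<And>v. v \<in> V \<Longrightarrow> 0 < c' v" "(\<Sum>v\<in>V. c' v) = 1"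
    using optimal_translate[OF c] a by (auto simp: c'_def optimal_def)
  define gap where "gap w = c' w * (area c' w / norm w - DIM('a) * vol c')" for w
  have nonneg: "0 \<le> gap w" if w: "w \<in> V" for w
    using optimal_area_ge[OF c'(1) w] c'(2)[OF w] norm_pos[OF w]
    by (simp add: gap_def field_simps)
  have "(\<Sum>w\<in>V. gap w) = DIM('a) * (\<Sum>w\<in>V. c' w / norm w * area c' w / DIM('a)) - DIM('a) * vol c'"
    using c'(3) by (simp add: gap_def right_diff_distrib sum_subtractf sum_distrib_left sum_distrib_right[symmetric])
  also have "\<dots> \<le> 0"
    using sum_pyramids_le_vol[OF c'(2)] by (simp add: mult_left_mono)
  finally have "(\<Sum>w\<in>V. gap w) = 0"
    using sum_nonneg[of V gap] nonneg by force
  then have "gap v = 0"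
    using sum_nonneg_eq_0_iff[OF finite_V, of gap] nonneg v by blast
  then have "area c' v = DIM('a) * vol c' * norm v"
    using c'(2)[OF v] norm_pos[OF v] by (simp add: gap_def field_simps)
  then show ?thesis
    by (simp add: c'_def area_translate vol_translate)
qed

lemma optimal_area_pos: "optimal c \<Longrightarrow> v \<in> V \<Longrightarrow> area c v > 0"
  using mult_pos_pos[OF mult_pos_pos[OF _ optimal_vol_pos[of c]] norm_pos[of v], of "real DIM('a)"]
  by (simp add: optimal_area)

lemma optimal_face_nonempty: "optimal c \<Longrightarrow> v \<in> V \<Longrightarrow> face c v \<noteq> {}"
  using optimal_area_pos[of c v] by (auto simp: area_def facet_area_empty)

lemma aff_dim_optimal: "optimal c \<Longrightarrow> aff_dim (polytope_of c) = DIM('a)"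
  using optimal_vol_pos by (simp add: vol_pos_iff aff_dim_nonempty_interior)

lemma face_face_of:
  assumes v: "v \<in> V"
  shows "face c v face_of polytope_of c"
proof -
  have "polytope_of c \<inter> {x. v \<bullet> x = c v} face_of polytope_of c"
    using v by (intro face_of_Int_supporting_hyperplane_le convex_polytope) (simp add: mem_polytope inner_commute)
  moreover have "polytope_of c \<inter> {x. v \<bullet> x = c v} = face c v"
    by (auto simp: face_def inner_commute)
  ultimately show ?thesis by simp
qed

lemma face_facet_of:
  assumes c: "optimal c" and v: "v \<in> V"
  shows "face c v facet_of polytope_of c"
proof -
  have "aff_dim (face c v) \<le> aff_dim {x. v \<bullet> x = c v}"
    by (rule aff_dim_subset) (auto simp: face_def inner_commute)
  also have "\<dots> = DIM('a) - 1"
    using v nonzero by (subst aff_dim_hyperplane) auto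
  finally have "aff_dim (face c v) = aff_dim (polytope_of c) - 1"
    using aff_dim_ge_if_facet_area_pos optimal_area_pos[OF c v] aff_dim_optimal[OF c]
    by (fastforce simp: area_def)
  then show ?thesis
    using face_face_of[OF v] optimal_face_nonempty[OF c v] by (simp add: facet_of_def)
qed

lemma facet_with_normal_direction:
  assumes c: "optimal c" and v: "v \<in> V"
  shows "facet_with_normal (polytope_of c) (v /\<^sub>R norm v) F \<longleftrightarrow> F = face c v"
proof
  assume "F = face c v"
  then show "facet_with_normal (polytope_of c) (v /\<^sub>R norm v) F"
    unfolding facet_with_normal_def
    using face_facet_of[OF c v] norm_direction[OF v] below_support[OF v] face_eq_supporting[OF v, of c]
    by (intro conjI exI[of _ "c v / norm v"]) auto
next
  assume F: "facet_with_normal (polytope_of c) (v /\<^sub>R norm v) F"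
  then obtain b where b: "polytope_of c \<subseteq> {x. (v /\<^sub>R norm v) \<bullet> x \<le> b}"
    "F = polytope_of c \<inter> {x. (v /\<^sub>R norm v) \<bullet> x = b}" and "F \<noteq> {}"
    by (auto simp: facet_with_normal_def facet_of_def)
  then obtain x where x: "x \<in> polytope_of c" "(v /\<^sub>R norm v) \<bullet> x = b"
    by blast
  obtain y where y: "y \<in> polytope_of c" "(v /\<^sub>R norm v) \<bullet> y = c v / norm v"
    using optimal_face_nonempty[OF c v] by (auto simp: face_eq_supporting[OF v])
  have "b = c v / norm v"
    using below_support[OF v x(1)] x(2) b(1) y by fastforce
  then show "F = face c v"
    using b(2) by (auto simp: face_eq_supporting[OF v])
qed

text \<open>A relative interior point of a facet \<open>F\<close> lies on the hyperplane of some \<open>v\<close>, and then \<open>F\<close> lies in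
  the face of \<open>v\<close>. By dimension the two supporting hyperplanes coincide, so \<open>u\<close> is parallel to
  \<open>v\<close>, and an interior point of the polytope determines the sign.\<close>

lemma facet_normal_in_directions:
  assumes c: "optimal c" and F: "facet_with_normal (polytope_of c) u F"
  shows "\<exists>v\<in>V. u = v /\<^sub>R norm v"
proof -
  let ?R = "polytope_of c"
  obtain b where facet: "F facet_of ?R" and u: "norm u = 1" and b: "?R \<subseteq> {x. u \<bullet> x \<le> b}" "F = ?R \<inter> {x. u \<bullet> x = b}"
    using F by (auto simp: facet_with_normal_def)
  have F': "F face_of ?R" "F \<noteq> {}" "aff_dim F = DIM('a) - 1"
    using facet aff_dim_optimal[OF c] by (auto simp: facet_of_def)
  have uu: "u \<bullet> u = 1"
    using u by (simp add: norm_eq_1)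
  have "convex F"
    using F'(1) by (rule face_of_imp_convex)
  then obtain x where x: "x \<in> rel_interior F"
    using F'(2) rel_interior_eq_empty by blast
  have xF: "x \<in> F"
    using x rel_interior_subset by blast
  have "x \<notin> interior ?R"
  proof
    assume "x \<in> interior ?R"
    then obtain e where e: "e > 0" "cball x e \<subseteq> ?R"
      by (auto simp: mem_interior_cball)
    have "x + e *\<^sub>R u \<in> cball x e"
      using e u by (simp add: dist_norm)
    then have "u \<bullet> (x + e *\<^sub>R u) \<le> b"
      using e(2) b(1) by blast
    then show False
      using xF b(2) e(1) uu by (simp add: inner_add_right)
  qed
  then obtain v where v: "v \<in> V" "c v \<le> x \<bullet> v"
    by (auto simp: interior_polytope_iff not_less)
  have xR: "x \<in> ?R"
    using xF b(2) by blast
  have "x \<in> face c v"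
    using v xR by (auto simp: face_def mem_polytope intro: antisym)
  then have sub: "F \<subseteq> face c v"
    using x F'(1) by (intro subset_of_face_of[OF face_face_of[OF v(1)]]) (auto simp: disjnt_iff dest: face_of_imp_subset)
  have hyp: "affine hull F = {x. a \<bullet> x = r}" if a: "a \<noteq> 0" and sub: "F \<subseteq> {x. a \<bullet> x = r}" for a r
  proof (rule affine_dim_equal)
    show "affine hull F \<subseteq> {x. a \<bullet> x = r}"
      using sub by (intro hull_minimal affine_hyperplane)
    show "aff_dim (affine hull F) = aff_dim {x. a \<bullet> x = r}"
      using a F'(3) by (simp add: aff_dim_affine_hull aff_dim_hyperplane)
  qed (use F'(2) in \<open>auto simp: affine_hyperplane\<close>)
  have "affine hull F = {x. u \<bullet> x = b}"
    by (rule hyp) (use u b in auto)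
  moreover have "affine hull F = {x. v \<bullet> x = c v}"
    by (rule hyp) (use v nonzero sub in \<open>auto simp: face_def inner_commute\<close>)
  ultimately have same: "u \<bullet> y = b \<longleftrightarrow> v \<bullet> y = c v" for y
    by blast
  define w where "w = v - (u \<bullet> v) *\<^sub>R u"
  have ux: "u \<bullet> x = b"
    using xF b(2) by blast
  have uw: "u \<bullet> w = 0"
    using uu by (simp add: w_def inner_diff_right)
  then have "v \<bullet> (x + w) = c v"
    using same[of "x + w"] ux by (simp add: inner_add_right)
  then have "v \<bullet> w = 0"
    using same[of x] ux by (simp add: inner_add_right)
  then have "w \<bullet> w = 0"
    using uw by (simp add: w_def inner_diff_left)
  then have vu: "v = (u \<bullet> v) *\<^sub>R u"
    by (simp add: w_def)
  obtain q where q: "q \<in> interior ?R"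
    using optimal_vol_pos[OF c] by (auto simp: vol_pos_iff)
  have "v \<bullet> q < c v" "q \<in> ?R"
    using q v(1) subsetD[OF interior_subset q] by (auto simp: interior_polytope_iff inner_commute)
  then have "(u \<bullet> v) * (u \<bullet> q) < (u \<bullet> v) * b" "u \<bullet> q \<le> b"
    using same[of x] ux b(1) vu by (metis inner_scaleR_left, blast)
  then have "u \<bullet> v > 0"
    by (metis mult_left_mono_neg not_less)
  moreover have "norm v = \<bar>u \<bullet> v\<bar>"
    using vu u by (metis norm_scaleR mult.right_neutral)
  ultimately have "norm v = u \<bullet> v" "u \<bullet> v \<noteq> 0"
    by auto
  then have "u = v /\<^sub>R norm v"
    using vu by (metis scaleR_scaleR left_inverse scaleR_one)
  then show ?thesis
    using v(1) by blast
qed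

section \<open>Uniqueness up to translation\<close>

text \<open>The face of \<open>P(c - t c')\<close> plus \<open>t\<close> times the face of \<open>P(c')\<close> lies in the face of
  \<open>P(c)\<close>. Brunn-Minkowski is applied to a cylinder of height \<open>1 - t\<close> over the first face and the
  dilation by \<open>t\<close> of the unit cylinder over the second one, the heights being chosen so that the sum fits
  into the unit cylinder over the third face. Since both maximizers have the same facet areas, it
  reads \<open>root d ((1 - t) * area) \<le> (1 - t) * root d A\<close>.\<close>

lemma shrunken_facet_area_le:
  assumes c: "optimal c" and c': "optimal c'" and t: "0 \<le> t" "t < 1" and v: "v \<in> V"
  shows "area (\<lambda>w. c w - t * c' w) v \<le> (1 - t) ^ (DIM('a) - 1) * (DIM('a) * vol c * norm v)"
proof (cases "face (\<lambda>w. c w - t * c' w) v = {}")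
  case True
  then show ?thesis
    using t by (simp add: area_def facet_area_empty vol_nonneg)
next
  case False
  let ?d = "DIM('a)" and ?u = "v /\<^sub>R norm v" and ?ct = "\<lambda>w. c w - t * c' w"
  let ?A = "DIM('a) * vol c * norm v"
  let ?X = "cylinder ?u (face ?ct v) (1 - t)"
  let ?Y = "(\<lambda>x. t *\<^sub>R x) ` cylinder ?u (face c' v) 1"
  let ?Z = "cylinder ?u (face c v) 1"
  have d: "?d > 0" by simp
  have u: "norm ?u = 1"
    by (rule norm_direction[OF v])
  have A: "area c v = ?A" "area c' v = ?A" "?A \<ge> 0"
    using optimal_area[OF c v] optimal_area[OF c' v] optimal_vol_unique[OF c c'] by (auto simp: vol_nonneg)
  have X: "compact ?X" "?X \<noteq> {}"
    by (rule compact_cylinder[OF compact_face]) (use False t in \<open>auto simp: cylinder_def\<close>)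
  have Y: "compact ?Y" "?Y \<noteq> {}"
    by (rule compact_scaling[OF compact_cylinder[OF compact_face]])
      (use optimal_face_nonempty[OF c' v] in \<open>auto simp: cylinder_def\<close>)
  have "?X + ?Y \<subseteq> ?Z"
  proof
    fix z assume "z \<in> ?X + ?Y"
    then obtain x s y r where z: "z = (x + s *\<^sub>R ?u) + t *\<^sub>R (y + r *\<^sub>R ?u)" "x \<in> face ?ct v" "y \<in> face c' v"
      "0 \<le> s" "s \<le> 1 - t" "0 \<le> r" "r \<le> 1"
      by (auto simp: cylinder_def elim!: set_plus_elim)
    have "(x + t *\<^sub>R y) \<bullet> w \<le> c w" if "w \<in> V" for w
    proof -
      have "x \<bullet> w \<le> c w - t * c' w" "t * (y \<bullet> w) \<le> t * c' w"
        using z(2,3) that t by (auto simp: face_def mem_polytope intro!: mult_left_mono)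
      then show ?thesis
        by (simp add: inner_add_left)
    qed
    moreover have "(x + t *\<^sub>R y) \<bullet> v = c v"
      using z(2,3) by (simp add: face_def inner_add_left)
    ultimately have "x + t *\<^sub>R y \<in> face c v"
      by (simp add: face_def mem_polytope)
    moreover have "0 \<le> s + t * r" "s + t * r \<le> 1"
      using z t mult_left_mono[of r 1 t] by auto
    moreover have "z = (x + t *\<^sub>R y) + (s + t * r) *\<^sub>R ?u"
      by (simp add: z(1) algebra_simps)
    ultimately show "z \<in> ?Z"
      unfolding cylinder_def by (intro image_eqI[of _ _ "(x + t *\<^sub>R y, s + t * r)"]) auto
  qed
  then have "measure lebesgue (?X + ?Y) \<le> measure lebesgue ?Z"
    using X Y by (intro measure_mono_fmeasurable)
      (auto intro!: lmeasurable_compact fmeasurableD compact_cylinder compact_face compact_set_plus)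
  also have "\<dots> = ?A"
    using A(1) by (simp add: area_def facet_area_def)
  finally have "root ?d (measure lebesgue ?X) + root ?d (measure lebesgue ?Y) \<le> root ?d ?A"
    using brunn_minkowski[OF X Y] real_root_le_mono[OF d] by (meson order_trans)
  moreover have "measure lebesgue ?X = (1 - t) * area ?ct v"
    unfolding area_def using t
    by (intro measure_cylinder[OF u compact_face]) (auto simp: face_eq_supporting[OF v])
  moreover have "root ?d (measure lebesgue ?Y) = t * root ?d ?A"
  proof -
    have "measure lebesgue ?Y = t ^ ?d * measure lebesgue (cylinder ?u (face c' v) 1)"
      using measure_lebesgue_affine[of t 0] t by simp
    then show ?thesis
      using A(2) t by (simp add: area_def facet_area_def real_root_mult real_root_power_cancel)
  qed
  ultimately have "root ?d ((1 - t) * area ?ct v) \<le> (1 - t) * root ?d ?A"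
    by (simp add: algebra_simps)
  then have "root ?d ((1 - t) * area ?ct v) ^ ?d \<le> ((1 - t) * root ?d ?A) ^ ?d"
    using t area_nonneg by (intro power_mono) auto
  then have "(1 - t) * area ?ct v \<le> (1 - t) ^ ?d * ?A"
    using t area_nonneg A(3) by (simp add: power_mult_distrib real_root_pow_pos2)
  moreover have "(1 - t) ^ ?d = (1 - t) * (1 - t) ^ (?d - 1)"
    using d by (metis power_eq_if less_not_refl)
  ultimately show ?thesis
    using t by (simp add: mult.assoc)
qed

text \<open>Passing from \<open>t\<close> to \<open>t + h\<close> removes at most a slab of height \<open>h * c' v / norm v\<close> at each face, whose
  area is bounded by \<open>shrunken_facet_area_le\<close>; the bounds add up because the heights \<open>c'\<close> have sum 1.\<close>

lemma vol_decrease_le: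
  assumes c: "optimal c" and c': "optimal c'" and pos: "\<And>v. v \<in> V \<Longrightarrow> c' v > 0"
    and t: "0 \<le> t" "t < 1" and e: "e > 0"
  defines "\<psi> \<equiv> \<lambda>t. vol (\<lambda>w. c w - t * c' w)"
  shows "\<exists>\<delta>>0. \<forall>h. 0 \<le> h \<longrightarrow> h \<le> \<delta> \<longrightarrow>
    \<psi> t - h * (DIM('a) * vol c * (1 - t) ^ (DIM('a) - 1) + e) \<le> \<psi> (t + h)"
proof -
  let ?ct = "\<lambda>w. c w - t * c' w"
  let ?G = "DIM('a) * vol c * (1 - t) ^ (DIM('a) - 1)"
  \<comment> \<open>the total weight of the error terms of the slabs\<close>
  define W where "W = (\<Sum>v\<in>V. c' v / norm v)"
  have W: "W > 0"
    unfolding W_def using finite_V V_nonempty pos norm_pos by (intro sum_pos) auto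
  define good where "good v \<delta> \<longleftrightarrow> \<delta> > 0 \<and> (\<forall>s. 0 \<le> s \<longrightarrow> s \<le> \<delta> \<longrightarrow>
      measure lebesgue {x \<in> polytope_of ?ct. ?ct v - s \<le> x \<bullet> v} \<le> s / norm v * (area ?ct v + e / W))" for v \<delta>
  have "\<exists>\<delta>. good v \<delta>" if "v \<in> V" for v
    unfolding good_def using e W that by (intro slab_measure_near_facet) auto
  then obtain \<delta> where good: "\<And>v. v \<in> V \<Longrightarrow> good v (\<delta> v)"
    by metis
  have \<delta>: "\<delta> v > 0" "\<And>s. 0 \<le> s \<Longrightarrow> s \<le> \<delta> v \<Longrightarrow>
      measure lebesgue {x \<in> polytope_of ?ct. ?ct v - s \<le> x \<bullet> v} \<le> s / norm v * (area ?ct v + e / W)"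
    if "v \<in> V" for v
    using good[OF that] unfolding good_def by blast+
  define \<delta>0 where "\<delta>0 = Min ((\<lambda>v. \<delta> v / c' v) ` V)"
  have \<delta>0: "\<delta>0 > 0" "\<And>v. v \<in> V \<Longrightarrow> \<delta>0 \<le> \<delta> v / c' v"
    unfolding \<delta>0_def using finite_V V_nonempty \<delta>(1) pos by (auto simp: Min_gr_iff)
  show ?thesis
  proof (intro exI[of _ \<delta>0] conjI allI impI)
    fix h assume h: "0 \<le> h" "h \<le> \<delta>0"
    let ?slab = "\<lambda>v. {x \<in> polytope_of ?ct. ?ct v - h * c' v \<le> x \<bullet> v}"
    let ?next = "polytope_of (\<lambda>w. c w - (t + h) * c' w)"
    have slabs: "(\<Union>v\<in>V. ?slab v) \<in> lmeasurable"
      using finite_V lmeasurable_slab by (intro fmeasurable.finite_UN) auto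
    have "\<psi> t \<le> measure lebesgue (?next \<union> (\<Union>v\<in>V. ?slab v))"
      unfolding \<psi>_def vol_def
    proof (rule measure_mono_fmeasurable)
      show "polytope_of ?ct \<subseteq> ?next \<union> (\<Union>v\<in>V. ?slab v)"
      proof
        fix x assume x: "x \<in> polytope_of ?ct"
        show "x \<in> ?next \<union> (\<Union>v\<in>V. ?slab v)"
        proof (cases "x \<in> ?next")
          case False
          then obtain v where "v \<in> V" "c v - (t + h) * c' v < x \<bullet> v"
            by (auto simp: mem_polytope not_le)
          then have "x \<in> ?slab v"
            using x by (simp add: algebra_simps)
          then show ?thesis
            using \<open>v \<in> V\<close> by blast
        qed simp
      qed
      show "?next \<union> (\<Union>v\<in>V. ?slab v) \<in> lmeasurable"
        using slabs by (intro fmeasurable.Un lmeasurable_polytope)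
    qed (intro fmeasurableD lmeasurable_polytope)
    also have "\<dots> \<le> \<psi> (t + h) + measure lebesgue (\<Union>v\<in>V. ?slab v)"
      unfolding \<psi>_def vol_def using slabs by (intro measure_Un_le fmeasurableD lmeasurable_polytope)
    also have "measure lebesgue (\<Union>v\<in>V. ?slab v) \<le> (\<Sum>v\<in>V. measure lebesgue (?slab v))"
      using finite_V lmeasurable_slab by (intro measure_UNION_le) (auto intro: fmeasurableD)
    also have "\<dots> \<le> (\<Sum>v\<in>V. h * (c' v * ?G + c' v / norm v * (e / W)))"
    proof (rule sum_mono)
      fix v assume v: "v \<in> V"
      have "h * c' v \<le> \<delta>0 * c' v"
        using h(2) pos[OF v] by (intro mult_right_mono) auto
      also have "\<dots> \<le> \<delta> v"
        using \<delta>0(2)[OF v] pos[OF v] by (simp add: field_simps)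
      finally have "h * c' v \<le> \<delta> v" .
      moreover have "0 \<le> h * c' v"
        using h(1) pos[OF v] by simp
      ultimately have "measure lebesgue (?slab v) \<le> h * c' v / norm v * (area ?ct v + e / W)"
        by (intro \<delta>(2)[OF v])
      also have "\<dots> \<le> h * c' v / norm v * (?G * norm v + e / W)"
      proof (intro mult_left_mono add_right_mono)
        show "area ?ct v \<le> ?G * norm v"
          using shrunken_facet_area_le[OF c c' t v] by (simp only: mult_ac)
        show "0 \<le> h * c' v / norm v"
          using h(1) pos[OF v] by simp
      qed
      also have "\<dots> = h * (c' v * ?G + c' v / norm v * (e / W))"
        using norm_pos[OF v] by (simp add: field_simps)
      finally show "measure lebesgue (?slab v) \<le> h * (c' v * ?G + c' v / norm v * (e / W))" .
    qed
    also have "\<dots> = h * (?G + e)"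
    proof -
      have "(\<Sum>v\<in>V. h * (c' v * ?G + c' v / norm v * (e / W)))
          = h * ((\<Sum>v\<in>V. c' v) * ?G + W * (e / W))"
        unfolding W_def by (simp only: sum_distrib_left[symmetric] sum.distrib sum_distrib_right[symmetric])
      also have "\<dots> = h * (?G + e)"
        using c' W by (simp add: optimal_def)
      finally show ?thesis .
    qed
    finally show "\<psi> t - h * (?G + e) \<le> \<psi> (t + h)"
      by simp
  qed (rule \<delta>0(1))
qed

lemma shrunken_vol_ge:
  assumes c: "optimal c" and c': "optimal c'" and pos: "\<And>v. v \<in> V \<Longrightarrow> c' v > 0"
    and t: "0 \<le> t" "t < 1"
  shows "vol c * (1 - t) ^ DIM('a) \<le> vol (\<lambda>w. c w - t * c' w)"
proof (rule derivative_comparison[where f = "\<lambda>t. vol (\<lambda>w. c w - t * c' w)"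
      and g = "\<lambda>t. vol c * (1 - t) ^ DIM('a)"
      and m = "\<lambda>t. DIM('a) * vol c * (1 - t) ^ (DIM('a) - 1)"])
  fix t :: real assume t: "0 < t" "t < 1"
  show "\<exists>\<sigma>. (\<forall>n::nat. 0 \<le> \<sigma> n \<and> \<sigma> n < t) \<and> \<sigma> \<longlonglongrightarrow> t
      \<and> (\<lambda>n. vol (\<lambda>w. c w - \<sigma> n * c' w)) \<longlonglongrightarrow> vol (\<lambda>w. c w - t * c' w)"
  proof (intro exI[of _ "\<lambda>n. t - t / real (Suc n)"] conjI allI)
    show lim: "(\<lambda>n. t - t / real (Suc n)) \<longlonglongrightarrow> t"
      using tendsto_diff[OF tendsto_const tendsto_mult[OF tendsto_const LIMSEQ_inverse_real_of_nat], of t t]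
      by (simp add: divide_inverse)
    show "(\<lambda>n. vol (\<lambda>w. c w - (t - t / real (Suc n)) * c' w)) \<longlonglongrightarrow> vol (\<lambda>w. c w - t * c' w)"
    proof (rule vol_tendsto_from_above)
      fix n v assume "v \<in> V"
      have "t / real (Suc (Suc n)) \<le> t / real (Suc n)"
        using t by (intro divide_left_mono) auto
      then have "(t - t / real (Suc n)) * c' v \<le> (t - t / real (Suc (Suc n))) * c' v"
        using pos[OF \<open>v \<in> V\<close>] by (intro mult_right_mono) auto
      then show "c v - (t - t / real (Suc (Suc n))) * c' v \<le> c v - (t - t / real (Suc n)) * c' v"
        by simp
    next
      show "(\<lambda>n. c v - (t - t / real (Suc n)) * c' v) \<longlonglongrightarrow> c v - t * c' v" for v
        by (intro tendsto_intros lim)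
    qed
  qed (use t in \<open>auto simp: field_simps\<close>)
next
  fix t e :: real assume "0 \<le> t" "t < 1" "0 < e"
  then show "\<exists>\<delta>>0. \<forall>h. 0 \<le> h \<longrightarrow> h \<le> \<delta> \<longrightarrow>
      vol (\<lambda>w. c w - t * c' w) - h * (DIM('a) * vol c * (1 - t) ^ (DIM('a) - 1) + e)
      \<le> vol (\<lambda>w. c w - (t + h) * c' w)"
    using vol_decrease_le[OF c c' pos] by simp
next
  show "DERIV (\<lambda>t. vol c * (1 - t) ^ DIM('a)) t :> - (DIM('a) * vol c * (1 - t) ^ (DIM('a) - 1))" for t
    by (auto intro!: derivative_eq_intros)
qed (use t in auto)

text \<open>The polytopes for \<open>c - t k\<close> with \<open>t < 1\<close> are nested and nonempty, so they have a common point
  \<open>p\<close>. The slacks \<open>c v - k v - p \<bullet> v\<close> are nonnegative with sum 0, hence all zero.\<close>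

lemma optimal_polytopes_translates:
  assumes c: "optimal c" and c': "optimal c'"
  shows "\<exists>a. polytope_of c = (+) a ` polytope_of c'"
proof -
  obtain a where a: "\<And>v. v \<in> V \<Longrightarrow> 0 < c' v + a \<bullet> v"
    by (rule translate_to_pos[OF c']) (rule that)
  define k where "k = (\<lambda>v. c' v + a \<bullet> v)"
  have k: "optimal k" "\<And>v. v \<in> V \<Longrightarrow> k v > 0"
    using optimal_translate[OF c'] a by (auto simp: k_def)
  define P where "P n = polytope_of (\<lambda>w. c w - (1 - 1 / real (Suc n)) * k w)" for n
  have "\<Inter>(range P) \<noteq> {}"
  proof (rule compact_nest)
    show "compact (P n)" for n
      by (simp add: P_def compact_polytope)
    show "P n \<noteq> {}" for n
    proof -
      have "0 < vol c * (1 - (1 - 1 / real (Suc n))) ^ DIM('a)"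
        using optimal_vol_pos[OF c] by simp
      also have "\<dots> \<le> measure lebesgue (P n)"
        unfolding P_def vol_def[symmetric] by (rule shrunken_vol_ge[OF c k]) auto
      finally show ?thesis
        by auto
    qed
    show "P n \<subseteq> P m" if "m \<le> n" for m n
      unfolding P_def
    proof (rule polytope_mono)
      fix v assume v: "v \<in> V"
      have "1 / real (Suc n) \<le> 1 / real (Suc m)"
        using that by (simp add: frac_le)
      then have "(1 - 1 / real (Suc m)) * k v \<le> (1 - 1 / real (Suc n)) * k v"
        using k(2)[OF v] by (intro mult_right_mono) auto
      then show "c v - (1 - 1 / real (Suc n)) * k v \<le> c v - (1 - 1 / real (Suc m)) * k v"
        by simp
    qed
  qed
  then obtain p where p: "\<And>n. p \<in> P n"
    by auto
  have le: "0 \<le> c v - k v - p \<bullet> v" if v: "v \<in> V" for v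
  proof -
    have "(\<lambda>n. 1 / real (Suc n)) \<longlonglongrightarrow> 0"
      using LIMSEQ_inverse_real_of_nat by (simp add: inverse_eq_divide)
    then have "(\<lambda>n. c v - (1 - 1 / real (Suc n)) * k v) \<longlonglongrightarrow> c v - (1 - 0) * k v"
      by (intro tendsto_intros)
    then have "p \<bullet> v \<le> c v - (1 - 0) * k v"
      by (rule LIMSEQ_le_const) (use p v in \<open>auto simp: P_def mem_polytope\<close>)
    then show ?thesis by simp
  qed
  have "(\<Sum>v\<in>V. c v - k v - p \<bullet> v) = 0"
    using c k(1) by (simp add: sum_subtractf sum_inner_zero optimal_def)
  then have "\<forall>v\<in>V. c v - k v - p \<bullet> v = 0"
    using sum_nonneg_eq_0_iff[OF finite_V, of "\<lambda>v. c v - k v - p \<bullet> v"] le by blast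
  then have "polytope_of c = polytope_of (\<lambda>v. c' v + (a + p) \<bullet> v)"
    by (intro polytope_cong) (auto simp: k_def inner_add_left algebra_simps)
  then show ?thesis
    using polytope_translate[of c' "a + p"] by blast
qed

end

section \<open>Existence, uniqueness and facet areas\<close>

theorem theorem3p1:
  fixes V :: "'a::euclidean_space set"
  assumes "finite V"
    and "0 \<notin> V"
    and "inj_on (\<lambda>v. v /\<^sub>R norm v) V"
    and "span V = UNIV"
    and "(\<Sum>v\<in>V. v) = 0"
  shows "(\<exists>R. maximizer V R) \<and>
    (\<forall>R R'. maximizer V R \<longrightarrow> maximizer V R' \<longrightarrow> (\<exists>a. R' = (+) a ` R)) \<and>
    (\<forall>R. maximizer V R \<longrightarrow>
      {u. \<exists>F. facet_with_normal R u F} = (\<lambda>v. v /\<^sub>R norm v) ` V) \<and>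
    (\<exists>\<alpha>>0. \<forall>R. maximizer V R \<longrightarrow>
      (\<forall>v\<in>V. \<forall>F. facet_with_normal R (v /\<^sub>R norm v) F \<longrightarrow>
        hausdorff_measure (DIM('a) - 1) F = ennreal (\<alpha> * norm v)) \<and>
      max_volume V = emeasure lebesgue R \<and>
      emeasure lebesgue R = ennreal (\<alpha> / real DIM('a)))"
proof -
  interpret balanced_normals V
    using assms by unfold_locales
  obtain c0 where c0: "optimal c0"
    using exists_optimal by blast
  let ?\<alpha> = "DIM('a) * vol c0"
  have "{u. \<exists>F. facet_with_normal (polytope_of c) u F} = (\<lambda>v. v /\<^sub>R norm v) ` V" if c: "optimal c" for c
    using facet_normal_in_directions[OF c] facet_with_normal_direction[OF c] by blast
  moreover have "hausdorff_measure (DIM('a) - 1) F = ennreal (?\<alpha> * norm v)"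
    if c: "optimal c" and v: "v \<in> V" and F: "facet_with_normal (polytope_of c) (v /\<^sub>R norm v) F" for c v F
  proof -
    have "hausdorff_measure (DIM('a) - 1) (face c v) = ennreal (area c v)"
      unfolding area_def using v
      by (intro hausdorff_measure_facet[OF norm_direction compact_face, where k = "c v / norm v"])
        (auto simp: face_eq_supporting)
    then show ?thesis
      using F by (simp add: facet_with_normal_direction[OF c v] optimal_area[OF c v] optimal_vol_unique[OF c c0])
  qed
  moreover have "max_volume V = emeasure lebesgue (polytope_of c) \<and>
      emeasure lebesgue (polytope_of c) = ennreal (?\<alpha> / real DIM('a))" if c: "optimal c" for c
    using optimal_max_volume[OF c] optimal_vol_unique[OF c c0] by (simp add: emeasure_polytope del: emeasure_completion)
  moreover have "?\<alpha> > 0"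
    using optimal_vol_pos[OF c0] by simp
  moreover have "\<exists>R. maximizer V R"
    using c0 maximizer_iff by blast
  moreover have "\<exists>a. polytope_of c' = (+) a ` polytope_of c" if "optimal c" "optimal c'" for c c'
    using optimal_polytopes_translates that by blast
  ultimately show ?thesis
    unfolding maximizer_iff by (intro conjI exI[of _ ?\<alpha>]) blast+
qed

end
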